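(* Let $N$ be a von Neumann algebra, let $P:N\to N$ be a normal unital completely positive map, and let $(M,p,\alpha)$ be the minimal dilation of $P$. Let $M^\alpha=\{x\in M;\ \alpha(x)=x\}$ be the fixed point algebra of $\alpha$ and let $H^\infty(N,P)=\{x\in N;\ P(x)=x\}$. Then the map $$\theta: M^\alpha\ni x\mapsto pxp\in H^\infty(N,P)$$ is a completely positive order isomorphism between the two operator systems (that is, $\theta$ is a well-defined linear bijection of $M^\alpha$ onto $H^\infty(N,P)$ and both $\theta$ and $\theta^{-1}$ are completely positive). In particular, the von Neumann algebra $M^\alpha$ gives a concrete realization of the von Neumann algebra structure of $H^\infty(N,P)$, i.e. $\theta$ is a $*$-isomorphism from $M^\alpha$ onto $H^\infty(N,P)$ equipped with the Choi-Effros product.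
   Context: Minimal dilation: the minimal dilation $(M,p,\alpha)$ of a normal unital completely positive map $P$ on $N$ consists of a von Neumann algebra $M$, a projection $p\in M$, and a unital normal $*$-endomorphism $\alpha$ of $M$ such that: (i) $N=pMp$ (so $N$ is identified with a corner of $M$, and the unit of $N$ is $p$); (ii) $P^n(a)=p\,\alpha^n(a)\,p$ for all $a\in N$ and $n\ge 1$; (iii) $M$ is generated as a von Neumann algebra by $\bigcup_{n\ge 0}\alpha^n(N)$; (iv) the central carrier of $p$ in $M$ (the smallest projection in the center of $M$ dominating $p$) is $1_M$. In this situation $\{\alpha^n(p)\}_{n\geq 0}$ is an increasing sequence of projections converging strongly to $1_M$. It is unique up to isomorphisms that restrict to the identity on $N$ and intertwine the endomorphisms. Choi-Effros product: $H^\infty(N,P)$ is a weakly closed operator system in $N$ (a self-adjoint linear subspace containing the identity of $N$), and it is the image of a completely positive projection $E$ from $N$, e.g. $E(x)=\mathrm{w}\text{-}\lim_{n\to\omega}\frac1n\sum_{k=0}^{n-1}P^k(x)$ for a free ultrafilter $\omega$ on $\mathbb{N}$. It is a von Neumann algebra with respect to the Choi-Effros product $x\circ y=E(xy)$, and this product does not depend on the choice of $\omega$ (an operator system carries at most one von Neumann algebra structure). *)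

theory Defs
  imports "HOL-Analysis.Analysis"
begin

section \<open>Complex Hilbert spaces and their bounded operators\<close>

text \<open>
  The inner product is linear in the first and conjugate-linear in the second variable.
\<close>

class chilbert_space = banach +
  fixes scaleC :: "complex \<Rightarrow> 'a \<Rightarrow> 'a"  (infixr \<open>*\<^sub>C\<close> 75)
    and cinner :: "'a \<Rightarrow> 'a \<Rightarrow> complex"
  assumes scaleC_of_real: "complex_of_real r *\<^sub>C x = r *\<^sub>R x"
    and scaleC_scaleC: "c *\<^sub>C d *\<^sub>C x = (c * d) *\<^sub>C x"
    and scaleC_add_left: "(c + d) *\<^sub>C x = c *\<^sub>C x + d *\<^sub>C x"
    and scaleC_add_right: "c *\<^sub>C (x + y) = c *\<^sub>C x + c *\<^sub>C y"
    and cinner_commute: "cinner x y = cnj (cinner y x)"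
    and cinner_add_left: "cinner (x + y) z = cinner x z + cinner y z"
    and cinner_scaleC_left: "cinner (c *\<^sub>C x) y = c * cinner x y"
    and cinner_self: "cinner x x = complex_of_real ((norm x)\<^sup>2)"
begin

lemma norm_scaleC: "norm (c *\<^sub>C x) = cmod c * norm x"
proof -
  have "cinner (c *\<^sub>C x) (c *\<^sub>C x) = c * cnj c * cinner x x"
    by (metis cinner_commute cinner_scaleC_left complex_cnj_mult mult.assoc)
  then have "complex_of_real ((norm (c *\<^sub>C x))\<^sup>2) = complex_of_real ((cmod c * norm x)\<^sup>2)"
    by (simp only: cinner_self complex_norm_square power_mult_distrib of_real_mult)
  then have "(norm (c *\<^sub>C x))\<^sup>2 = (cmod c * norm x)\<^sup>2"
    by (simp only: of_real_eq_iff)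
  then show ?thesis
    by (simp add: power2_eq_iff_nonneg)
qed

lemma scaleC_scaleR: "c *\<^sub>C r *\<^sub>R x = r *\<^sub>R c *\<^sub>C x"
  by (simp add: scaleC_of_real [symmetric] scaleC_scaleC mult.commute)

end

lemma bounded_linear_scaleC: "bounded_linear (\<lambda>x::'a::chilbert_space. c *\<^sub>C x)"
  by (rule bounded_linear_intro [where K = "cmod c"])
    (simp_all add: scaleC_add_right scaleC_scaleR norm_scaleC mult.commute)

text \<open>
  The library type \<^typ>\<open>'a \<Rightarrow>\<^sub>L 'a\<close> consists of the bounded real-linear maps; \<open>B(H)\<close> is the
  set of the complex-linear ones.
\<close>

type_synonym 'h op = "'h \<Rightarrow>\<^sub>L 'h"

definition bounded_ops :: "'h::chilbert_space op set" where
  "bounded_ops = {a :: 'h op. \<forall>c \<xi>. a (c *\<^sub>C \<xi>) = c *\<^sub>C a \<xi>}"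

lift_definition scale_op :: "complex \<Rightarrow> 'h::chilbert_space op \<Rightarrow> 'h op"
  is "\<lambda>c a \<xi>. c *\<^sub>C a \<xi>"
  by (rule bounded_linear_compose [OF bounded_linear_scaleC])

definition adj :: "'h::chilbert_space op \<Rightarrow> 'h op" where
  "adj a = (THE b. b \<in> bounded_ops \<and> (\<forall>\<xi> \<eta>. cinner (a \<xi>) \<eta> = cinner \<xi> (b \<eta>)))"

definition positive_op :: "'h::chilbert_space op \<Rightarrow> bool" where
  "positive_op a \<longleftrightarrow> a \<in> bounded_ops \<and> (\<forall>\<xi>. cinner (a \<xi>) \<xi> \<in> \<real>\<^sub>\<ge>\<^sub>0)"

definition op_le :: "'h::chilbert_space op \<Rightarrow> 'h op \<Rightarrow> bool" where
  "op_le a b \<longleftrightarrow> positive_op (b - a)"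

definition is_projection :: "'h::chilbert_space op \<Rightarrow> bool" where
  "is_projection p \<longleftrightarrow> p \<in> bounded_ops \<and> p o\<^sub>L p = p \<and> adj p = p"

text \<open>
  The ultraweak (\<open>\<sigma>\<close>-weak) topology on \<open>B(H)\<close> is the initial topology of the functionals
  \<open>a \<mapsto> \<Sum>n. \<langle>a \<xi>\<^sub>n, \<eta>\<^sub>n\<rangle>\<close> with square-summable sequences \<open>\<xi>\<close> and \<open>\<eta>\<close>.
\<close>

definition square_summable :: "(nat \<Rightarrow> 'h::chilbert_space) \<Rightarrow> bool" where
  "square_summable \<xi> \<longleftrightarrow> summable (\<lambda>n. (norm (\<xi> n))\<^sup>2)"

definition ultraweak_functional ::
    "(nat \<Rightarrow> 'h::chilbert_space) \<Rightarrow> (nat \<Rightarrow> 'h) \<Rightarrow> 'h op \<Rightarrow> complex" where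
  "ultraweak_functional \<xi> \<eta> a = (\<Sum>n. cinner (a (\<xi> n)) (\<eta> n))"

definition ultraweak_topology :: "'h::chilbert_space op topology" where
  "ultraweak_topology = topology_generated_by
     {{a \<in> bounded_ops. ultraweak_functional \<xi> \<eta> a \<in> U} | \<xi> \<eta> U.
       square_summable \<xi> \<and> square_summable \<eta> \<and> open U}"


section \<open>Von Neumann algebras and maps between them\<close>

definition op_subspace :: "'h::chilbert_space op set \<Rightarrow> bool" where
  "op_subspace S \<longleftrightarrow> S \<subseteq> bounded_ops \<and> 0 \<in> S \<and>
     (\<forall>a\<in>S. \<forall>b\<in>S. a + b \<in> S) \<and> (\<forall>c. \<forall>a\<in>S. scale_op c a \<in> S)"

definition operator_system :: "'h::chilbert_space op set \<Rightarrow> bool" where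
  "operator_system S \<longleftrightarrow> op_subspace S \<and> (\<forall>a\<in>S. adj a \<in> S) \<and> id_blinfun \<in> S"

definition von_neumann_algebra :: "'h::chilbert_space op set \<Rightarrow> bool" where
  "von_neumann_algebra M \<longleftrightarrow> op_subspace M \<and> (\<forall>a\<in>M. \<forall>b\<in>M. a o\<^sub>L b \<in> M) \<and>
     (\<forall>a\<in>M. adj a \<in> M) \<and> id_blinfun \<in> M \<and> closedin ultraweak_topology M"

definition von_neumann_generated :: "'h::chilbert_space op set \<Rightarrow> 'h op set" where
  "von_neumann_generated S = \<Inter>{M. von_neumann_algebra M \<and> S \<subseteq> M}"

definition center :: "'h::chilbert_space op set \<Rightarrow> 'h op set" where
  "center M = {z \<in> M. \<forall>a\<in>M. z o\<^sub>L a = a o\<^sub>L z}"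

definition is_central_carrier ::
    "'h::chilbert_space op set \<Rightarrow> 'h op \<Rightarrow> 'h op \<Rightarrow> bool" where
  "is_central_carrier M p z \<longleftrightarrow>
     z \<in> center M \<and> is_projection z \<and> op_le p z \<and>
     (\<forall>e \<in> center M. is_projection e \<and> op_le p e \<longrightarrow> op_le z e)"

definition corner :: "'h::chilbert_space op \<Rightarrow> 'h op set \<Rightarrow> 'h op set" where
  "corner p M = {p o\<^sub>L x o\<^sub>L p | x. x \<in> M}"

definition clinear_on ::
    "'h::chilbert_space op set \<Rightarrow> ('h op \<Rightarrow> 'k::chilbert_space op) \<Rightarrow> bool" where
  "clinear_on S \<phi> \<longleftrightarrow> (\<forall>a\<in>S. \<forall>b\<in>S. \<phi> (a + b) = \<phi> a + \<phi> b) \<and>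
     (\<forall>c. \<forall>a\<in>S. \<phi> (scale_op c a) = scale_op c (\<phi> a))"

text \<open>
  An \<open>n \<times> n\<close> matrix of operators on \<open>H\<close>, indexed by \<open>i, j < n\<close>, acts on \<open>H\<^sup>n\<close> by
  \<open>(a \<xi>)\<^sub>i = \<Sum>j<n. a\<^sub>i\<^sub>j \<xi>\<^sub>j\<close>; the double sum below is \<open>\<langle>a \<xi>, \<xi>\<rangle>\<close> in \<open>H\<^sup>n\<close>.
\<close>

definition positive_matrix :: "nat \<Rightarrow> (nat \<Rightarrow> nat \<Rightarrow> 'h::chilbert_space op) \<Rightarrow> bool" where
  "positive_matrix n a \<longleftrightarrow> (\<forall>i<n. \<forall>j<n. a i j \<in> bounded_ops) \<and>
     (\<forall>\<xi> :: nat \<Rightarrow> 'h. (\<Sum>i<n. \<Sum>j<n. cinner (a i j (\<xi> j)) (\<xi> i)) \<in> \<real>\<^sub>\<ge>\<^sub>0)"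

definition completely_positive_on ::
    "'h::chilbert_space op set \<Rightarrow> ('h op \<Rightarrow> 'k::chilbert_space op) \<Rightarrow> bool" where
  "completely_positive_on S \<phi> \<longleftrightarrow> clinear_on S \<phi> \<and>
     (\<forall>n a. (\<forall>i<n. \<forall>j<n. a i j \<in> S) \<and> positive_matrix n a
        \<longrightarrow> positive_matrix n (\<lambda>i j. \<phi> (a i j)))"

definition cp_order_isomorphism ::
    "'h::chilbert_space op set \<Rightarrow> 'k::chilbert_space op set \<Rightarrow> ('h op \<Rightarrow> 'k op) \<Rightarrow> bool" where
  "cp_order_isomorphism S T \<phi> \<longleftrightarrow> operator_system S \<and> operator_system T \<and> bij_betw \<phi> S T \<and>
     completely_positive_on S \<phi> \<and> completely_positive_on T (inv_into S \<phi>)"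

definition normal_map ::
    "'h::chilbert_space op set \<Rightarrow> 'k::chilbert_space op set \<Rightarrow> ('h op \<Rightarrow> 'k op) \<Rightarrow> bool" where
  "normal_map M N \<phi> \<longleftrightarrow>
     continuous_map (subtopology ultraweak_topology M) (subtopology ultraweak_topology N) \<phi>"

definition normal_ucp_map :: "'h::chilbert_space op set \<Rightarrow> ('h op \<Rightarrow> 'h op) \<Rightarrow> bool" where
  "normal_ucp_map N P \<longleftrightarrow> P \<in> N \<rightarrow> N \<and> completely_positive_on N P \<and>
     P id_blinfun = id_blinfun \<and> normal_map N N P"

text \<open>
  The multiplications are parameters, since one of the algebras of interest does not carry
  the composition of operators as its product. The involution is always the adjoint.
\<close>

definition star_hom_on ::
    "'h::chilbert_space op set \<Rightarrow> ('h op \<Rightarrow> 'h op \<Rightarrow> 'h op) \<Rightarrow>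
     ('k::chilbert_space op \<Rightarrow> 'k op \<Rightarrow> 'k op) \<Rightarrow> ('h op \<Rightarrow> 'k op) \<Rightarrow> bool" where
  "star_hom_on S mS mT \<phi> \<longleftrightarrow> clinear_on S \<phi> \<and>
     (\<forall>a\<in>S. \<forall>b\<in>S. \<phi> (mS a b) = mT (\<phi> a) (\<phi> b)) \<and> (\<forall>a\<in>S. \<phi> (adj a) = adj (\<phi> a))"

definition star_isomorphism ::
    "'h::chilbert_space op set \<Rightarrow> ('h op \<Rightarrow> 'h op \<Rightarrow> 'h op) \<Rightarrow>
     'k::chilbert_space op set \<Rightarrow> ('k op \<Rightarrow> 'k op \<Rightarrow> 'k op) \<Rightarrow> ('h op \<Rightarrow> 'k op) \<Rightarrow> bool" where
  "star_isomorphism S mS T mT \<phi> \<longleftrightarrow> star_hom_on S mS mT \<phi> \<and> bij_betw \<phi> S T"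

definition unital_normal_endomorphism ::
    "'h::chilbert_space op set \<Rightarrow> ('h op \<Rightarrow> 'h op) \<Rightarrow> bool" where
  "unital_normal_endomorphism M \<alpha> \<longleftrightarrow> \<alpha> \<in> M \<rightarrow> M \<and> star_hom_on M (o\<^sub>L) (o\<^sub>L) \<alpha> \<and>
     \<alpha> id_blinfun = id_blinfun \<and> normal_map M M \<alpha>"


section \<open>Minimal dilations, fixed points and the Choi-Effros product\<close>

text \<open>
  \<open>N\<close> and \<open>M\<close> may act on different Hilbert spaces. The \<open>*\<close>-isomorphism \<open>\<iota>\<close> of \<open>N\<close> onto
  \<open>pMp\<close> is the identification \<open>N = pMp\<close>; it maps the unit of \<open>N\<close> to \<open>p\<close>.
\<close>

definition minimal_dilation ::
    "'k::chilbert_space op set \<Rightarrow> ('k op \<Rightarrow> 'k op) \<Rightarrow>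
     'h::chilbert_space op set \<Rightarrow> 'h op \<Rightarrow> ('h op \<Rightarrow> 'h op) \<Rightarrow> ('k op \<Rightarrow> 'h op) \<Rightarrow> bool" where
  "minimal_dilation N P M p \<alpha> \<iota> \<longleftrightarrow>
     von_neumann_algebra M \<and> p \<in> M \<and> is_projection p \<and> unital_normal_endomorphism M \<alpha> \<and>
     star_isomorphism N (o\<^sub>L) (corner p M) (o\<^sub>L) \<iota> \<and>
     (\<forall>a\<in>N. \<forall>n\<ge>1. \<iota> ((P ^^ n) a) = p o\<^sub>L (\<alpha> ^^ n) (\<iota> a) o\<^sub>L p) \<and>
     M = von_neumann_generated (\<Union>n. (\<alpha> ^^ n) ` \<iota> ` N) \<and>
     is_central_carrier M p id_blinfun"

definition fixed_points :: "'h op set \<Rightarrow> ('h::chilbert_space op \<Rightarrow> 'h op) \<Rightarrow> 'h op set" where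
  "fixed_points A \<phi> = {x \<in> A. \<phi> x = x}"

text \<open>\<open>x \<mapsto> pxp\<close>, read as a map into \<open>N\<close> through the identification \<open>\<iota>\<close>.\<close>

definition compression ::
    "'k::chilbert_space op set \<Rightarrow> ('k op \<Rightarrow> 'h op) \<Rightarrow> 'h::chilbert_space op \<Rightarrow> 'h op \<Rightarrow> 'k op" where
  "compression N \<iota> p x = inv_into N \<iota> (p o\<^sub>L x o\<^sub>L p)"

definition cp_projection_onto ::
    "'k::chilbert_space op set \<Rightarrow> 'k op set \<Rightarrow> ('k op \<Rightarrow> 'k op) \<Rightarrow> bool" where
  "cp_projection_onto N S E \<longleftrightarrow>
     completely_positive_on N E \<and> E ` N = S \<and> (\<forall>a\<in>N. E (E a) = E a)"

definition choi_effros_product ::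
    "('k::chilbert_space op \<Rightarrow> 'k op) \<Rightarrow> 'k op \<Rightarrow> 'k op \<Rightarrow> 'k op" where
  "choi_effros_product E x y = E (x o\<^sub>L y)"

end

theory Submission
  imports Defs
begin

text \<open>
  Since \<open>p \<alpha>(p) p = \<iota>(P(1)) = p\<close>, the projections \<open>q\<^sub>n = \<alpha>\<^sup>n(p)\<close> increase. A weak cluster point of them
  commutes with the generators of \<open>M\<close> and dominates \<open>p\<close>, so it is \<open>1\<close>, because \<open>p\<close> has central
  carrier \<open>1\<close>. For a fixed point \<open>x\<close> of \<open>\<alpha>\<close> we have \<open>\<alpha>\<^sup>n(pxp) = q\<^sub>n x q\<^sub>n \<rightarrow> x\<close>, so \<open>pxp\<close> determines \<open>x\<close>
  together with its matrix order. Conversely, for \<open>P(a) = a\<close> every weak cluster point \<open>x\<close> of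
  \<open>\<alpha>\<^sup>n(\<iota>(a))\<close> satisfies \<open>q\<^sub>n x q\<^sub>n = \<alpha>\<^sup>n(\<iota>(a))\<close> for all \<open>n\<close>; hence \<open>\<alpha>(x) = x\<close> and \<open>pxp = \<iota>(a)\<close>.
  If \<open>E\<close> is a completely positive projection onto the fixed points of \<open>P\<close>, then
  \<open>E(\<theta>(x)\<^sup>* \<theta>(x)) \<le> \<theta>(x\<^sup>* x)\<close> since \<open>p \<le> 1\<close>, and the Kadison-Schwarz inequality for \<open>\<theta>\<^sup>-\<^sup>1 \<circ> E\<close> gives the
  reverse inequality; polarization yields multiplicativity.
\<close>

subsection \<open>Complex Hilbert spaces\<close>

text \<open>The Hilbert spaces may be non-separable, so a bounded sequence of operators need not
  have a weakly convergent subsequence. Limits are therefore taken along a filter finer than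
  \<open>sequentially\<close>, supplied by Tychonoff's theorem. They are tested on pairs of vectors,
  and boundedness in norm is what links them to the ultraweak topology in which closedness and
  normality are stated. The second obstacle is positivity. \<open>star_hom_on\<close> is purely
  algebraic, but the order isomorphism is assembled from \<open>\<iota>\<close>, its inverse on the
  corner and the powers of \<alpha>, all of which must be completely positive. Positivity on single
  operators needs square roots that stay inside the algebra. Positivity on matrices, which is a
  statement about tuples of vectors, is reduced to tuples taken from one cyclic subspace, where the
  whole matrix collapses to a single positive operator. The norm bound on the powers of \<alpha>
  that makes cluster points available is also drawn from complete positivity, through the Schwarz
  inequality.\<close>

lemma scaleC_zero_left [simp]: "0 *\<^sub>C x = (0::'a::chilbert_space)"
  using scaleC_of_real [of 0 x] by simp

lemma scaleC_one [simp]: "1 *\<^sub>C x = (x::'a::chilbert_space)"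
  using scaleC_of_real [of 1 x] by simp

lemma scaleC_minus_one: "(-1) *\<^sub>C x = - (x::'a::chilbert_space)"
  using scaleC_of_real [of "-1" x] by simp

lemma scaleC_zero_right [simp]: "c *\<^sub>C 0 = (0::'a::chilbert_space)"
  by (rule linear_0 [OF bounded_linear.linear [OF bounded_linear_scaleC]])

lemma scaleC_diff_right: "c *\<^sub>C (x - y) = c *\<^sub>C x - c *\<^sub>C (y::'a::chilbert_space)"
  by (rule linear_diff [OF bounded_linear.linear [OF bounded_linear_scaleC]])

lemma scaleC_sum_right: "c *\<^sub>C sum f A = (\<Sum>i\<in>A. c *\<^sub>C (f i::'a::chilbert_space))"
  by (rule linear_sum [OF bounded_linear.linear [OF bounded_linear_scaleC]])

lemma cinner_add_right: "cinner x (y + z) = cinner x y + cinner x (z::'a::chilbert_space)"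
  by (metis cinner_add_left cinner_commute complex_cnj_add)

lemma cinner_scaleC_right: "cinner x (c *\<^sub>C y) = cnj c * cinner x (y::'a::chilbert_space)"
  by (metis cinner_scaleC_left cinner_commute complex_cnj_mult)

lemma cinner_scaleR_left: "cinner (r *\<^sub>R x) y = r *\<^sub>R cinner x (y::'a::chilbert_space)"
  by (metis scaleC_of_real cinner_scaleC_left scaleR_conv_of_real)

lemma cinner_scaleR_right: "cinner x (r *\<^sub>R y) = r *\<^sub>R cinner x (y::'a::chilbert_space)"
  by (metis scaleC_of_real cinner_scaleC_right complex_cnj_complex_of_real scaleR_conv_of_real)

lemma Re_cinner_self: "Re (cinner x x) = (norm (x::'a::chilbert_space))\<^sup>2"
  by (simp add: cinner_self del: of_real_power)

lemma bounded_opsD: "a \<in> bounded_ops \<Longrightarrow> blinfun_apply a (c *\<^sub>C \<xi>) = c *\<^sub>C blinfun_apply a \<xi>"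
  by (simp add: bounded_ops_def)

lemma bounded_ops_id [simp]: "id_blinfun \<in> bounded_ops"
  by (simp add: bounded_ops_def)

lemma positive_opD:
  assumes "positive_op a"
  shows "a \<in> bounded_ops" "0 \<le> Re (cinner (a \<xi>) \<xi>)" "Im (cinner (a \<xi>) \<xi>) = 0"
  using assms by (auto simp: positive_op_def complex_nonneg_Reals_iff)

text \<open>Polarization: the quadratic form is real at \<open>x + y\<close> and at
  \<open>x + \<i> *\<^sub>C y\<close>, which fixes the imaginary and the real part of the cross
  terms.\<close>

lemma positive_op_hermitian:
  assumes "positive_op a"
  shows "cinner (a y) x = cnj (cinner (a x) y)"
proof -
  note lin = blinfun.add_right cinner_add_left cinner_add_right bounded_opsD [OF positive_opD(1) [OF assms]]
    cinner_scaleC_left cinner_scaleC_right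
  have 1: "Im (cinner (a (x + y)) (x + y)) = 0" "Im (cinner (a x) x) = 0" "Im (cinner (a y) y) = 0"
    "Im (cinner (a (x + \<i> *\<^sub>C y)) (x + \<i> *\<^sub>C y)) = 0"
    by (rule positive_opD(3) [OF assms])+
  have "Im (cinner (a x) y + cinner (a y) x) = 0" using 1 by (simp add: lin)
  moreover have "Re (cinner (a y) x) = Re (cinner (a x) y)" using 1 by (simp add: lin)
  ultimately show ?thesis by (simp add: complex_eq_iff)
qed

text \<open>The scalar core of Cauchy-Schwarz, with \<open>H\<close> standing for the squared
  modulus of the mixed term. For \<open>Y > 0\<close> the minimizing value \<open>t = 1 / Y\<close>
  gives the claim.\<close>

lemma quadratic_nonneg_discriminant:
  fixes X Y H :: real
  assumes "\<And>t. 0 \<le> X - 2 * t * H + t\<^sup>2 * H * Y" and "0 \<le> X" "0 \<le> Y" "0 \<le> H"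
  shows "H \<le> X * Y"
proof (cases "H = 0")
  case False
  with assms have H: "H > 0" by simp
  show ?thesis
  proof (cases "Y = 0")
    case True
    \<comment> \<open>With \<open>Y = 0\<close> the expression is affine in \<open>t\<close>; this
      value of \<open>t\<close> makes it equal to -1, a contradiction.\<close>
    show ?thesis using assms(1) [of "(X + 1) / (2 * H)"] H True assms(2) by (simp add: field_simps)
  next
    case False
    then have "Y > 0" using assms by simp
    then show ?thesis using assms(1) [of "1 / Y"] by (simp add: field_simps power2_eq_square)
  qed
qed (use assms in simp)

lemma positive_op_Cauchy_Schwarz:
  assumes "positive_op a"
  shows "(cmod (cinner (a x) y))\<^sup>2 \<le> Re (cinner (a x) x) * Re (cinner (a y) y)"
proof (rule quadratic_nonneg_discriminant)
  fix t :: real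
  define h where "h = cinner (a x) y"
  \<comment> \<open>The factor \<open>h\<close> absorbs the phase of the mixed term, so both cross
    terms become the real number \<open>- t * (cmod h)\<^sup>2\<close>.\<close>
  define c where "c = - complex_of_real t * h"
  have "0 \<le> Re (cinner (a (x + c *\<^sub>C y)) (x + c *\<^sub>C y))"
    by (rule positive_opD(2) [OF assms])
  also have "cinner (a (x + c *\<^sub>C y)) (x + c *\<^sub>C y) =
      cinner (a x) x + cnj c * h + c * cnj h + c * cnj c * cinner (a y) y"
    using positive_op_hermitian [OF assms, of y x]
    by (simp add: h_def blinfun.add_right cinner_add_left cinner_add_right
        bounded_opsD [OF positive_opD(1) [OF assms]] cinner_scaleC_left cinner_scaleC_right algebra_simps)
  also have "cnj c * h = - complex_of_real (t * (cmod h)\<^sup>2)"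
    by (simp add: c_def complex_norm_square mult.commute del: of_real_power)
  also have "c * cnj h = - complex_of_real (t * (cmod h)\<^sup>2)"
    by (simp add: c_def complex_norm_square del: of_real_power)
  also have "c * cnj c = complex_of_real (t * t) * (h * cnj h)"
    by (simp add: c_def)
  also have "h * cnj h = complex_of_real ((cmod h)\<^sup>2)"
    by (rule complex_norm_square [symmetric])
  also have "complex_of_real (t * t) * complex_of_real ((cmod h)\<^sup>2) = complex_of_real (t\<^sup>2 * (cmod h)\<^sup>2)"
    by (simp add: power2_eq_square)
  finally show "0 \<le> Re (cinner (a x) x) - 2 * t * (cmod (cinner (a x) y))\<^sup>2 +
      t\<^sup>2 * (cmod (cinner (a x) y))\<^sup>2 * Re (cinner (a y) y)"
    by (simp add: h_def del: of_real_power of_real_mult)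
qed (use assms in \<open>auto intro: positive_opD\<close>)

lemma positive_op_id: "positive_op id_blinfun"
  by (simp add: positive_op_def cinner_self complex_nonneg_Reals_iff del: of_real_power)

lemma cinner_Cauchy_Schwarz: "cmod (cinner x y) \<le> norm x * norm (y::'a::chilbert_space)"
proof (rule power2_le_imp_le)
  show "(cmod (cinner x y))\<^sup>2 \<le> (norm x * norm y)\<^sup>2"
    using positive_op_Cauchy_Schwarz [OF positive_op_id, of x y]
    by (simp add: Re_cinner_self power_mult_distrib)
qed simp

lemma bounded_bilinear_cinner: "bounded_bilinear (cinner :: 'a::chilbert_space \<Rightarrow> 'a \<Rightarrow> complex)"
proof
  show "\<exists>K. \<forall>x y. cmod (cinner x (y::'a)) \<le> norm x * norm y * K"
    by (rule exI [of _ 1]) (simp add: cinner_Cauchy_Schwarz)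
qed (simp_all add: cinner_add_left cinner_add_right cinner_scaleR_left cinner_scaleR_right)

interpretation cinner: bounded_bilinear "cinner :: 'a::chilbert_space \<Rightarrow> 'a \<Rightarrow> complex"
  by (rule bounded_bilinear_cinner)

declare cinner.zero_left [simp] cinner.zero_right [simp]

lemmas cinner_simps = cinner.add_left cinner.add_right cinner.diff_left cinner.diff_right
  cinner.minus_left cinner.minus_right cinner_scaleC_left cinner_scaleC_right
  cinner_scaleR_left cinner_scaleR_right

lemma cinner_eq_zero_all: "(\<And>y. cinner x y = 0) \<Longrightarrow> x = (0::'a::chilbert_space)"
  by (metis Re_cinner_self norm_eq_zero power_eq_0_iff zero_complex.simps(1))

lemma cinner_eqI: "(\<And>z. cinner x z = cinner y z) \<Longrightarrow> x = (y::'a::chilbert_space)"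
  using cinner_eq_zero_all [of "x - y"] by (simp add: cinner_simps)

lemma norm_diff_square:
  "(norm (x - y))\<^sup>2 = (norm x)\<^sup>2 - 2 * Re (cinner x y) + (norm (y::'a::chilbert_space))\<^sup>2"
proof -
  have "Re (cinner y x) = Re (cinner x y)"
    by (subst cinner_commute) simp
  then show ?thesis
    by (simp flip: Re_cinner_self add: cinner_simps)
qed

lemma parallelogram_law:
  "(norm (x + y))\<^sup>2 + (norm (x - y))\<^sup>2 = 2 * (norm x)\<^sup>2 + 2 * (norm (y::'a::chilbert_space))\<^sup>2"
  by (simp flip: Re_cinner_self add: cinner_simps)

subsection \<open>Orthogonal decomposition and the Riesz representation theorem\<close>

lemma nearest_point_orthogonal:
  fixes z w :: "'a::chilbert_space"
  assumes "\<And>c. norm z \<le> norm (z - c *\<^sub>C w)"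
  shows "cinner z w = 0"
proof -
  define h where "h = cinner z w"
  \<comment> \<open>The optimal step would be \<open>1 / (norm w)\<^sup>2\<close>; adding 1 covers
    \<open>w = 0\<close> and still leaves \<open>t * (norm w)\<^sup>2 \<le> 1\<close>.\<close>
  define t where "t = 1 / ((norm w)\<^sup>2 + 1)"
  have W: "(norm w)\<^sup>2 + 1 > 0" by (smt (verit) zero_le_power2)
  then have t: "t > 0" "t * (norm w)\<^sup>2 \<le> 1" by (auto simp: t_def field_simps)
  have "(norm z)\<^sup>2 \<le> (norm (z - (of_real t * h) *\<^sub>C w))\<^sup>2"
    by (intro power_mono assms) simp
  also have "\<dots> = (norm z)\<^sup>2 - 2 * Re (cnj (of_real t * h) * h) + (cmod (of_real t * h) * norm w)\<^sup>2"
    by (simp add: norm_diff_square cinner_simps norm_scaleC h_def)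
  also have "cnj (of_real t * h) * h = of_real (t * (cmod h)\<^sup>2)"
    by (simp add: complex_norm_square mult.commute del: of_real_power)
  finally have "2 * t * (cmod h)\<^sup>2 \<le> t * (cmod h)\<^sup>2 * (t * (norm w)\<^sup>2)"
    using t by (simp add: norm_mult power_mult_distrib power2_eq_square algebra_simps del: of_real_power)
  also have "\<dots> \<le> t * (cmod h)\<^sup>2 * 1"
    using t by (intro mult_left_mono) auto
  finally have "t * (cmod h)\<^sup>2 \<le> 0" by simp
  then have "(cmod h)\<^sup>2 \<le> 0" using t by (simp add: mult_le_0_iff)
  then show ?thesis by (simp add: h_def)
qed

text \<open>A minimizing sequence for the distance to \<open>V\<close> is Cauchy by the
  parallelogram law, and its limit is a nearest point, to which
  \<open>nearest_point_orthogonal\<close> applies.\<close>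

lemma orthogonal_decomposition:
  fixes V :: "'a::chilbert_space set"
  assumes V: "closed V" "0 \<in> V" "\<And>x y. x \<in> V \<Longrightarrow> y \<in> V \<Longrightarrow> x + y \<in> V"
    "\<And>c x. x \<in> V \<Longrightarrow> c *\<^sub>C x \<in> V"
  obtains v where "v \<in> V" "\<And>w. w \<in> V \<Longrightarrow> cinner (x - v) w = 0"
proof -
  define d where "d = infdist x V"
  have d0: "0 \<le> d" by (simp add: d_def infdist_nonneg)
  have dle: "d \<le> norm (x - w)" if "w \<in> V" for w
    using infdist_le [OF that, of x] by (simp add: d_def dist_norm)
  have "\<exists>v\<in>V. (norm (x - v))\<^sup>2 < d\<^sup>2 + 1 / Suc n" for n
  proof -
    have "d < sqrt (d\<^sup>2 + 1 / Suc n)" using d0 by (intro real_less_rsqrt) simp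
    then obtain v where v: "v \<in> V" "dist x v < sqrt (d\<^sup>2 + 1 / Suc n)"
      unfolding d_def using infdist_attains_inf
      by (metis assms(2) cINF_less_iff bdd_below_image_dist empty_iff infdist_notempty)
    then have "(norm (x - v))\<^sup>2 < (sqrt (d\<^sup>2 + 1 / Suc n))\<^sup>2"
      by (intro power_strict_mono) (auto simp: dist_norm)
    with v show ?thesis by (metis add_nonneg_nonneg divide_nonneg_nonneg of_nat_0_le_iff
      real_sqrt_pow2 zero_le_one zero_le_power2)
  qed
  then obtain v where v: "\<And>n. v n \<in> V" "\<And>n. (norm (x - v n))\<^sup>2 < d\<^sup>2 + 1 / Suc n" by metis
  \<comment> \<open>The midpoint of \<open>v m\<close> and \<open>v n\<close> lies in
    \<open>V\<close>, so its distance from \<open>x\<close> is at least \<open>d\<close>. This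
    cancels the \<open>4 * d\<^sup>2\<close> in the parallelogram law and leaves only the two
    errors.\<close>
  have close: "(norm (v n - v m))\<^sup>2 \<le> 2 / Suc m + 2 / Suc n" for m n
  proof -
    have "(1/2) *\<^sub>R (v m + v n) \<in> V"
      using V v(1) by (metis scaleC_of_real)
    then have "d \<le> norm (x - (1/2) *\<^sub>R (v m + v n))" by (rule dle)
    then have "d\<^sup>2 \<le> (norm (x - (1/2) *\<^sub>R (v m + v n)))\<^sup>2" using d0 by (rule power_mono)
    moreover have "(x - v m) + (x - v n) = 2 *\<^sub>R (x - (1/2) *\<^sub>R (v m + v n))"
      by (simp add: scaleR_diff_right scaleR_2)
    then have "(norm ((x - v m) + (x - v n)))\<^sup>2 = 4 * (norm (x - (1/2) *\<^sub>R (v m + v n)))\<^sup>2"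
      by (simp add: power_mult_distrib)
    moreover have "(x - v m) - (x - v n) = v n - v m" by simp
    ultimately show ?thesis
      using parallelogram_law [of "x - v m" "x - v n"] v(2) [of m] v(2) [of n] by simp
  qed
  have "Cauchy v"
  proof (rule CauchyI)
    fix e :: real assume e: "0 < e"
    then obtain K where K: "4 / e\<^sup>2 < real K"
      using reals_Archimedean2 by blast
    have "norm (v m - v n) < e" if "K \<le> m" "K \<le> n" for m n
    proof -
      have e2: "0 < e\<^sup>2" using e by simp
      have "2 / real (Suc m) + 2 / real (Suc n) \<le> 2 / (1 + real K) + 2 / (1 + real K)"
        using that by (intro add_mono divide_left_mono) auto
      also have "\<dots> = 4 / (1 + real K)" unfolding add_divide_distrib [symmetric] by (rule arg_cong2 [of _ _ _ _ "(/)"]) auto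
      also have "\<dots> < e\<^sup>2"
      proof -
        have "4 < real K * e\<^sup>2" using K pos_divide_less_eq [OF e2] by blast
        also have "\<dots> \<le> (1 + real K) * e\<^sup>2" by (rule mult_right_mono) auto
        finally have "4 < e\<^sup>2 * (1 + real K)" by (simp only: mult.commute)
        moreover have "0 < 1 + real K" by simp
        ultimately show ?thesis by (simp only: pos_divide_less_eq)
      qed
      finally have "(norm (v m - v n))\<^sup>2 < e\<^sup>2" using close [of m n] by (simp add: add.commute norm_minus_commute)
      then show ?thesis using e by (simp add: power_less_imp_less_base)
    qed
    then show "\<exists>M. \<forall>m\<ge>M. \<forall>n\<ge>M. norm (v m - v n) < e" by blast
  qed
  then obtain l where l: "v \<longlonglongrightarrow> l" using Cauchy_convergent convergent_def by blast
  have lV: "l \<in> V" using V(1) v(1) l closed_sequentially by blast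
  have "(norm (x - l))\<^sup>2 \<le> d\<^sup>2"
  proof (rule LIMSEQ_le)
    show "(\<lambda>n. (norm (x - v n))\<^sup>2) \<longlonglongrightarrow> (norm (x - l))\<^sup>2" by (intro tendsto_intros l)
    have "(\<lambda>n. d\<^sup>2 + 1 / Suc n) \<longlonglongrightarrow> d\<^sup>2 + 0"
      by (intro tendsto_add tendsto_const LIMSEQ_Suc [OF lim_1_over_n])
    then show "(\<lambda>n. d\<^sup>2 + 1 / Suc n) \<longlonglongrightarrow> d\<^sup>2" by simp
    show "\<exists>N. \<forall>n\<ge>N. (norm (x - v n))\<^sup>2 \<le> d\<^sup>2 + 1 / Suc n" using v(2) less_imp_le by blast
  qed
  then have ld: "norm (x - l) \<le> d" using d0 power2_le_imp_le by blast
  show thesis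
  proof (rule that [OF lV])
    fix w assume w: "w \<in> V"
    show "cinner (x - l) w = 0"
    proof (rule nearest_point_orthogonal)
      fix c
      have "l + c *\<^sub>C w \<in> V" using V lV w by blast
      then show "norm (x - l) \<le> norm (x - l - c *\<^sub>C w)"
        using dle [of "l + c *\<^sub>C w"] ld by (simp add: diff_diff_eq)
    qed
  qed
qed

lemma Riesz_representation:
  fixes f :: "'a::chilbert_space \<Rightarrow> complex"
  assumes f: "bounded_linear f" "\<And>c x. f (c *\<^sub>C x) = c * f x"
  obtains w where "\<And>x. f x = cinner x w"
proof (cases "\<forall>x. f x = 0")
  case True
  then have "f x = cinner x 0" for x by simp
  then show ?thesis by (rule that)
next
  case False
  then obtain x0 where x0: "f x0 \<noteq> 0" by blast
  interpret f: bounded_linear f by (rule f)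
  define V where "V = f -` {0}"
  have V: "closed V" unfolding V_def
    by (rule closed_vimage [OF closed_singleton linear_continuous_on [OF f(1)]])
  obtain v where v: "v \<in> V" "\<And>w. w \<in> V \<Longrightarrow> cinner (x0 - v) w = 0"
    by (rule orthogonal_decomposition [OF V, of x0]) (auto simp: V_def f.add f.zero f(2))
  define z where "z = x0 - v"
  have fz: "f z \<noteq> 0" using v(1) x0 by (simp add: z_def f.diff V_def)
  then have "z \<noteq> 0" using f.zero by blast
  \<comment> \<open>The vector \<open>f z *\<^sub>C x - f x *\<^sub>C z\<close> lies in the kernel
    of \<open>f\<close>, and \<open>z\<close> is orthogonal to the kernel.\<close>
  have *: "f z * cinner x z = f x * of_real ((norm z)\<^sup>2)" for x
  proof -
    have "f z *\<^sub>C x - f x *\<^sub>C z \<in> V" by (simp add: V_def f.diff f(2))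
    then have "cinner z (f z *\<^sub>C x - f x *\<^sub>C z) = 0"
      unfolding z_def [symmetric] using v(2) z_def by blast
    then have "cinner (f z *\<^sub>C x - f x *\<^sub>C z) z = 0"
      by (subst cinner_commute) simp
    then show ?thesis by (simp only: cinner_simps cinner_self eq_iff_diff_eq_0 [symmetric])
  qed
  show ?thesis
  proof (rule that)
    fix x
    have "cinner x (cnj (f z / of_real ((norm z)\<^sup>2)) *\<^sub>C z) = f z * cinner x z / of_real ((norm z)\<^sup>2)"
      by (simp add: cinner_simps)
    also have "\<dots> = f x" using \<open>z \<noteq> 0\<close> unfolding * by simp
    finally show "f x = cinner x (cnj (f z / of_real ((norm z)\<^sup>2)) *\<^sub>C z)" by (rule sym)
  qed
qed

text \<open>Riesz representation in the second variable, for each fixed first one. It turns a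
  sesquilinear form, in particular a pointwise limit of matrix coefficients, back into an
  operator.\<close>

lemma bounded_form_operator:
  fixes B :: "'a::chilbert_space \<Rightarrow> 'a \<Rightarrow> complex"
  assumes addl: "\<And>x y z. B (x + y) z = B x z + B y z"
    and addr: "\<And>x y z. B x (y + z) = B x y + B x z"
    and scl: "\<And>c x y. B (c *\<^sub>C x) y = c * B x y"
    and scr: "\<And>c x y. B x (c *\<^sub>C y) = cnj c * B x y"
    and bound: "\<And>x y. cmod (B x y) \<le> C * norm x * norm y" and C: "0 \<le> C"
  obtains a where "a \<in> bounded_ops" "norm a \<le> C" "\<And>x y. cinner (blinfun_apply a x) y = B x y"
proof -
  have "\<exists>w. \<forall>y. B x y = cinner w y" for x
  proof -
    have "bounded_linear (\<lambda>y. cnj (B x y))"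
    proof (rule bounded_linear_intro [where K = "C * norm x"])
      fix r y show "cnj (B x (r *\<^sub>R y)) = r *\<^sub>R cnj (B x y)"
        using scr [of x "of_real r" y] by (simp add: scaleC_of_real scaleR_conv_of_real)
    qed (use bound [of x] in \<open>simp_all add: addr mult.commute\<close>)
    then obtain w where "\<And>y. cnj (B x y) = cinner y w"
      using Riesz_representation [of "\<lambda>y. cnj (B x y)"] by (metis complex_cnj_cnj complex_cnj_mult scr)
    then have "B x y = cinner w y" for y by (metis cinner_commute complex_cnj_cnj)
    then show ?thesis by blast
  qed
  then obtain g where g: "\<And>x y. B x y = cinner (g x) y" by metis
  have gb: "norm (g x) \<le> norm x * C" for x
  proof (cases "g x = 0")
    case False
    have "(norm (g x))\<^sup>2 = cmod (B x (g x))"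
      by (simp add: g cinner_self del: of_real_power)
    also have "\<dots> \<le> (norm x * C) * norm (g x)" using bound [of x "g x"] by (simp add: mult.commute)
    finally show ?thesis using False by (simp add: power2_eq_square)
  qed (use C in simp)
  have gC: "g (c *\<^sub>C x) = c *\<^sub>C g x" for c x
    by (rule cinner_eqI) (simp flip: g add: scl cinner_simps)
  have "bounded_linear g"
  proof (rule bounded_linear_intro [where K = C])
    fix x y show "g (x + y) = g x + g y"
      by (rule cinner_eqI) (simp flip: g add: addl cinner_simps)
  next
    fix r x show "g (r *\<^sub>R x) = r *\<^sub>R g x" using gC [of "of_real r" x] by (simp add: scaleC_of_real)
  qed (rule gb)
  then have B: "blinfun_apply (Blinfun g) = g" by (rule bounded_linear_Blinfun_apply)
  show ?thesis
  proof (rule that [of "Blinfun g"])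
    show "Blinfun g \<in> bounded_ops" by (simp add: bounded_ops_def B gC)
    show "norm (Blinfun g) \<le> C"
      by (rule norm_blinfun_bound [OF C]) (use gb in \<open>simp add: B mult.commute\<close>)
  qed (simp add: B g)
qed

subsection \<open>Adjoints\<close>

lemma scale_op_apply [simp]: "blinfun_apply (scale_op c a) x = c *\<^sub>C blinfun_apply a x"
  by (simp add: scale_op.rep_eq)

lemma scale_op_of_real: "scale_op (complex_of_real r) a = r *\<^sub>R a"
  by (rule blinfun_eqI) (simp add: scaleC_of_real blinfun.scaleR_left)

lemma bounded_ops_zero [simp]: "0 \<in> bounded_ops"
  by (simp add: bounded_ops_def)

lemma bounded_ops_add: "a \<in> bounded_ops \<Longrightarrow> b \<in> bounded_ops \<Longrightarrow> a + b \<in> bounded_ops"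
  by (simp add: bounded_ops_def blinfun.add_left scaleC_add_right)

lemma bounded_ops_diff: "a \<in> bounded_ops \<Longrightarrow> b \<in> bounded_ops \<Longrightarrow> a - b \<in> bounded_ops"
  by (simp add: bounded_ops_def blinfun.diff_left scaleC_diff_right)

lemma bounded_ops_compose: "a \<in> bounded_ops \<Longrightarrow> b \<in> bounded_ops \<Longrightarrow> a o\<^sub>L b \<in> bounded_ops"
  by (simp add: bounded_ops_def)

lemma bounded_ops_scale: "a \<in> bounded_ops \<Longrightarrow> scale_op c a \<in> bounded_ops"
  by (simp add: bounded_ops_def scaleC_scaleC mult.commute)

lemma op_eqI: "(\<And>x y. cinner (blinfun_apply a x) y = cinner (blinfun_apply b x) y) \<Longrightarrow> a = b"
  by (rule blinfun_eqI, rule cinner_eqI)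

text \<open>Complex polarization: testing at \<open>x + y\<close> and
  \<open>x + \<i> *\<^sub>C y\<close> recovers the mixed terms from the diagonal ones.\<close>

lemma op_eqI_quadratic:
  assumes a: "a \<in> bounded_ops" and b: "b \<in> bounded_ops"
    and eq: "\<And>x. cinner (blinfun_apply a x) x = cinner (blinfun_apply b x) x"
  shows "a = b"
proof (rule op_eqI)
  fix x y
  note lin = blinfun.add_right cinner_add_left cinner_add_right bounded_opsD [OF a] bounded_opsD [OF b]
    cinner_scaleC_left cinner_scaleC_right
  have 1: "cinner (a x) y + cinner (a y) x = cinner (b x) y + cinner (b y) x"
    using eq [of "x + y"] eq [of x] eq [of y] by (simp add: lin add.commute)
  have 2: "- cinner (a x) y + cinner (a y) x = - cinner (b x) y + cinner (b y) x"
    using eq [of "x + \<i> *\<^sub>C y"] eq [of x] eq [of y] 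
    by (simp add: lin complex_eq_iff)
  have "2 * cinner (a x) y = 2 * cinner (b x) y"
    using arg_cong2 [OF 1 2, of "(-)"] by (simp add: algebra_simps)
  then show "cinner (a x) y = cinner (b x) y" by simp
qed

lemma cinner_eqI_right: "(\<And>z. cinner z x = cinner z y) \<Longrightarrow> x = (y::'a::chilbert_space)"
  by (rule cinner_eqI) (metis cinner_commute)

lemma adj_unique:
  assumes "b \<in> bounded_ops" "\<And>x y. cinner (blinfun_apply a x) y = cinner x (blinfun_apply b y)"
  shows "adj a = b"
  unfolding adj_def
proof (rule the_equality)
  fix c assume "c \<in> bounded_ops \<and> (\<forall>\<xi> \<eta>. cinner (a \<xi>) \<eta> = cinner \<xi> (blinfun_apply c \<eta>))"
  then show "c = b"
    using assms(2) by (intro blinfun_eqI cinner_eqI_right) simp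
qed (use assms in auto)

lemma adjoint_exists:
  assumes a: "a \<in> bounded_ops"
  obtains b where "b \<in> bounded_ops" "\<And>x y. cinner (blinfun_apply a x) y = cinner x (blinfun_apply b y)"
proof -
  have "cmod (cinner x (a y)) \<le> norm a * norm x * norm y" for x y
  proof -
    have "cmod (cinner x (a y)) \<le> norm x * norm (a y)" by (rule cinner_Cauchy_Schwarz)
    also have "\<dots> \<le> norm x * (norm a * norm y)" by (intro mult_left_mono norm_blinfun) simp
    finally show ?thesis by (simp add: algebra_simps)
  qed
  then obtain b where b: "b \<in> bounded_ops" "\<And>x y. cinner (blinfun_apply b x) y = cinner x (a y)"
    by (rule bounded_form_operator [of "\<lambda>x y. cinner x (a y)" "norm a", rotated 4])
      (simp_all add: cinner_simps blinfun.add_right bounded_opsD [OF a])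
  have "cinner (a x) y = cinner x (b y)" for x y
    by (metis b(2) cinner_commute)
  with b(1) show ?thesis by (rule that)
qed

lemma
  assumes "a \<in> bounded_ops"
  shows adj_bounded_ops: "adj a \<in> bounded_ops"
    and cinner_adj_right: "cinner x (blinfun_apply (adj a) y) = cinner (blinfun_apply a x) y"
    and cinner_adj_left: "cinner (blinfun_apply (adj a) x) y = cinner x (blinfun_apply a y)"
proof -
  obtain b where b: "b \<in> bounded_ops" "\<And>x y. cinner (blinfun_apply a x) y = cinner x (blinfun_apply b y)"
    using adjoint_exists [OF assms] by metis
  have eq: "adj a = b" using b by (rule adj_unique)
  show "adj a \<in> bounded_ops" "cinner x (blinfun_apply (adj a) y) = cinner (blinfun_apply a x) y"
    using b by (simp_all add: eq)
  have "cinner (b x) y = cnj (cinner y (b x))" by (rule cinner_commute)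
  also have "\<dots> = cnj (cinner (a y) x)" by (simp only: b(2))
  also have "\<dots> = cinner x (a y)" by (rule cinner_commute [symmetric])
  finally show "cinner (blinfun_apply (adj a) x) y = cinner x (blinfun_apply a y)" by (simp add: eq)
qed

lemma adj_adj: "a \<in> bounded_ops \<Longrightarrow> adj (adj a) = a"
  by (rule adj_unique) (simp_all add: cinner_adj_left)

lemma adj_compose: "a \<in> bounded_ops \<Longrightarrow> b \<in> bounded_ops \<Longrightarrow> adj (a o\<^sub>L b) = adj b o\<^sub>L adj a"
  by (rule adj_unique) (simp_all add: bounded_ops_compose adj_bounded_ops cinner_adj_right)

lemma adj_add: "a \<in> bounded_ops \<Longrightarrow> b \<in> bounded_ops \<Longrightarrow> adj (a + b) = adj a + adj b"
  by (rule adj_unique)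
    (simp_all add: bounded_ops_add adj_bounded_ops cinner_adj_right blinfun.add_left cinner_simps)

lemma adj_diff: "a \<in> bounded_ops \<Longrightarrow> b \<in> bounded_ops \<Longrightarrow> adj (a - b) = adj a - adj b"
  by (rule adj_unique)
    (simp_all add: bounded_ops_diff adj_bounded_ops cinner_adj_right blinfun.diff_left cinner_simps)

lemma adj_scale_op: "a \<in> bounded_ops \<Longrightarrow> adj (scale_op c a) = scale_op (cnj c) (adj a)"
  by (rule adj_unique)
    (simp_all add: bounded_ops_scale adj_bounded_ops cinner_adj_right cinner_simps)

lemma adj_id [simp]: "adj id_blinfun = id_blinfun"
  by (rule adj_unique) simp_all

lemma positive_op_adj_compose: "a \<in> bounded_ops \<Longrightarrow> positive_op (adj a o\<^sub>L a)"
  by (simp add: positive_op_def bounded_ops_compose adj_bounded_ops cinner_adj_left cinner_self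
      complex_nonneg_Reals_iff del: of_real_power)

lemma positive_op_adj: 
  assumes "positive_op a" shows "adj a = a"
proof (rule adj_unique)
  show "cinner (a x) y = cinner x (a y)" for x y
    using positive_op_hermitian [OF assms, of x y] by (metis cinner_commute)
qed (rule positive_opD(1) [OF assms])

lemma positive_op_antisym:
  assumes "positive_op (a - b)" "positive_op (b - a)" "a \<in> bounded_ops" "b \<in> bounded_ops"
  shows "a = b"
proof (rule op_eqI_quadratic [OF assms(3,4)])
  fix x
  show "cinner (a x) x = cinner (b x) x"
    using positive_opD(2,3) [OF assms(1), of x] positive_opD(2,3) [OF assms(2), of x]
    by (simp add: blinfun.diff_left cinner_simps complex_eq_iff)
qed

lemma blinfun_compose_assoc: "(a o\<^sub>L b) o\<^sub>L c = a o\<^sub>L (b o\<^sub>L c)"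
  by (rule blinfun_eqI) simp

lemma blinfun_compose_id [simp]: "id_blinfun o\<^sub>L a = a" "a o\<^sub>L id_blinfun = a"
  by (rule blinfun_eqI, simp)+

lemmas blinfun_compose_add_left = bounded_bilinear.add_left [OF bounded_bilinear_blinfun_compose]
  and blinfun_compose_add_right = bounded_bilinear.add_right [OF bounded_bilinear_blinfun_compose]
  and blinfun_compose_diff_left = bounded_bilinear.diff_left [OF bounded_bilinear_blinfun_compose]
  and blinfun_compose_diff_right = bounded_bilinear.diff_right [OF bounded_bilinear_blinfun_compose]

lemma scale_op_compose:
  "a \<in> bounded_ops \<Longrightarrow> scale_op c a o\<^sub>L b = scale_op c (a o\<^sub>L b)"
  "a \<in> bounded_ops \<Longrightarrow> a o\<^sub>L scale_op c b = scale_op c (a o\<^sub>L b)"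
  by (rule blinfun_eqI, simp add: bounded_opsD)+

lemma is_projectionD:
  assumes "is_projection p"
  shows "p \<in> bounded_ops" "p o\<^sub>L p = p" "adj p = p" "blinfun_apply p (blinfun_apply p x) = p x"
    "cinner (blinfun_apply p x) y = cinner x (blinfun_apply p y)"
    "cinner (blinfun_apply p x) x = of_real ((norm (blinfun_apply p x))\<^sup>2)"
proof -
  show 1: "p \<in> bounded_ops" "p o\<^sub>L p = p" "adj p = p"
    using assms by (simp_all add: is_projection_def)
  show 2: "p (p x) = p x" for x using 1(2) by (metis blinfun_apply_blinfun_compose)
  show 3: "cinner (p x) y = cinner x (p y)" for x y
    using cinner_adj_right [OF 1(1), of x y] 1(3) by simp
  show "cinner (blinfun_apply p x) x = of_real ((norm (blinfun_apply p x))\<^sup>2)"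
    using 3 [of "p x" x] by (simp add: 2 cinner_self)
qed

lemma projection_complement_square:
  assumes "is_projection p"
  shows "cinner (x - blinfun_apply p x) x = of_real ((norm (x - blinfun_apply p x))\<^sup>2)"
proof -
  have "cinner (p x) (x - p x) = cinner x (p (x - p x))" by (rule is_projectionD(5) [OF assms])
  also have "p (x - p x) = 0" by (simp add: blinfun.diff_right is_projectionD(4) [OF assms])
  finally have "cinner (x - p x) (p x) = 0" by (subst cinner_commute) simp
  then have "cinner (x - p x) x = cinner (x - p x) (x - p x)"
    by (simp only: cinner.diff_right [of "x - p x" x "p x"] diff_0_right)
  then show ?thesis by (simp only: cinner_self)
qed

lemma projection_norm_le:
  assumes "is_projection p" shows "norm (blinfun_apply p x) \<le> norm x"
proof -
  have "(norm (x - p x))\<^sup>2 = (norm x)\<^sup>2 - (norm (p x))\<^sup>2"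
    using projection_complement_square [OF assms, of x] is_projectionD(6) [OF assms, of x]
    by (simp add: cinner_simps cinner_self flip: of_real_diff of_real_power)
  then show ?thesis by (smt (verit) norm_ge_zero power2_le_imp_le zero_le_power2)
qed

subsection \<open>Weak limits of bounded nets\<close>

lemma topspace_ultraweak [simp]: "topspace (ultraweak_topology :: 'h::chilbert_space op topology) = bounded_ops"
proof -
  have "square_summable (\<lambda>_. 0 :: 'h)" by (simp add: square_summable_def)
  then show ?thesis
    unfolding ultraweak_topology_def topology_generated_by_topspace by blast
qed

lemma continuous_map_vector_functional:
  "continuous_map ultraweak_topology euclidean (\<lambda>a. cinner (blinfun_apply a x) y)"
proof (clarsimp simp: continuous_map_def)
  fix U :: "complex set" assume U: "open U"
  \<comment> \<open>A single matrix coefficient is the ultraweak functional of two sequences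
    supported at index 0.\<close>
  define \<xi> where "\<xi> = (\<lambda>n::nat. if n = 0 then x else 0)"
  define \<eta> where "\<eta> = (\<lambda>n::nat. if n = 0 then y else 0)"
  have s: "square_summable \<xi>" "square_summable \<eta>"
    unfolding square_summable_def \<xi>_def \<eta>_def by (rule summable_finite [of "{0}"]; simp)+
  have "ultraweak_functional \<xi> \<eta> a = (\<Sum>n\<in>{0::nat}. cinner (a (\<xi> n)) (\<eta> n))" for a
    unfolding ultraweak_functional_def by (rule suminf_finite) (auto simp: \<xi>_def)
  then have "ultraweak_functional \<xi> \<eta> a = cinner (a x) y" for a
    by (simp add: \<xi>_def \<eta>_def)
  then have "{a \<in> bounded_ops. cinner (blinfun_apply a x) y \<in> U} =
      {a \<in> bounded_ops. ultraweak_functional \<xi> \<eta> a \<in> U}" by simp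
  also have "openin ultraweak_topology \<dots>"
    unfolding ultraweak_topology_def using s U by (intro topology_generated_by_Basis) blast
  finally show "openin ultraweak_topology {a \<in> bounded_ops. cinner (blinfun_apply a x) y \<in> U}" .
qed

lemma limitin_ultraweakD:
  assumes "limitin ultraweak_topology f a F"
  shows "((\<lambda>i. cinner (blinfun_apply (f i) x) y) \<longlongrightarrow> cinner (blinfun_apply a x) y) F"
  using continuous_map_limit [OF continuous_map_vector_functional assms, of x y] by (simp add: o_def)

section \<open>Weak operator limits along filters\<close>

definition weak_limit :: "('i \<Rightarrow> 'h::chilbert_space op) \<Rightarrow> 'h op \<Rightarrow> 'i filter \<Rightarrow> bool" where
  "weak_limit f a F \<longleftrightarrow> (\<forall>x y. ((\<lambda>i. cinner (f i x) y) \<longlongrightarrow> cinner (a x) y) F)"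

lemma weak_limitD: "weak_limit f a F \<Longrightarrow> ((\<lambda>i. cinner (f i x) y) \<longlongrightarrow> cinner (a x) y) F"
  by (simp add: weak_limit_def)

text \<open>Dominated convergence for series: the terms converge one by one, and the norm bound
  gives the summable majorant
  \<open>C * ((norm (\<xi> n))\<^sup>2 + (norm (\<eta> n))\<^sup>2)\<close>, independent of
  \<open>i\<close>.\<close>

lemma ultraweak_functional_tendsto:
  assumes F: "F \<noteq> bot" and bound: "\<And>i. norm (f i) \<le> C" and lim: "weak_limit f a F"
    and sq: "square_summable \<xi>" "square_summable \<eta>"
  shows "((\<lambda>i. ultraweak_functional \<xi> \<eta> (f i)) \<longlongrightarrow> ultraweak_functional \<xi> \<eta> a) F"
proof -
  have C: "0 \<le> C" using norm_ge_zero bound order_trans by blast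
  have le: "norm (cinner (f i (\<xi> n)) (\<eta> n)) \<le> C * ((norm (\<xi> n))\<^sup>2 + (norm (\<eta> n))\<^sup>2)" for i n
  proof -
    have "norm (cinner (f i (\<xi> n)) (\<eta> n)) \<le> norm (f i (\<xi> n)) * norm (\<eta> n)"
      by (rule cinner_Cauchy_Schwarz)
    also have "\<dots> \<le> (C * norm (\<xi> n)) * norm (\<eta> n)"
      by (intro mult_right_mono order_trans [OF norm_blinfun] bound) simp_all
    also have "\<dots> = C * (norm (\<xi> n) * norm (\<eta> n))" by simp
    also have "\<dots> \<le> C * ((norm (\<xi> n))\<^sup>2 + (norm (\<eta> n))\<^sup>2)"
    proof (rule mult_left_mono [OF _ C])
      show "norm (\<xi> n) * norm (\<eta> n) \<le> (norm (\<xi> n))\<^sup>2 + (norm (\<eta> n))\<^sup>2"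
        using sum_squares_bound [of "norm (\<xi> n)" "norm (\<eta> n)"]
          mult_nonneg_nonneg [OF norm_ge_zero [of "\<xi> n"] norm_ge_zero [of "\<eta> n"]] by linarith
    qed
    finally show ?thesis .
  qed
  have S: "summable (\<lambda>n. C * ((norm (\<xi> n))\<^sup>2 + (norm (\<eta> n))\<^sup>2))"
    using sq by (intro summable_mult summable_add) (simp_all add: square_summable_def)
  have ev: "eventually (\<lambda>(n, i). norm (cinner (f i (\<xi> n)) (\<eta> n)) \<le>
      C * ((norm (\<xi> n))\<^sup>2 + (norm (\<eta> n))\<^sup>2)) (at_top \<times>\<^sub>F F)"
    by (rule always_eventually) (simp add: le)
  show ?thesis
    unfolding ultraweak_functional_def
    using tannerys_theorem [where a = "\<lambda>n i. cinner (f i (\<xi> n)) (\<eta> n)", OF weak_limitD [OF lim] ev S F]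
    by blast
qed

text \<open>Convergence passes from the generating sets to finite intersections and unions, so the
  functionals defining the topology suffice.\<close>

lemma limitin_ultraweak:
  assumes F: "F \<noteq> bot" and f: "\<And>i. f i \<in> bounded_ops" and a: "a \<in> bounded_ops"
    and bound: "\<And>i. norm (f i) \<le> C" and lim: "weak_limit f a F"
  shows "limitin ultraweak_topology f a F"
  unfolding limitin_def
proof (intro conjI allI impI; (elim conjE)?)
  fix U assume U: "openin ultraweak_topology U" and aU: "a \<in> U"
  from U have "generate_topology_on {{a \<in> bounded_ops. ultraweak_functional \<xi> \<eta> a \<in> U} | \<xi> \<eta> U.
       square_summable \<xi> \<and> square_summable \<eta> \<and> open U} U"
    unfolding ultraweak_topology_def by (rule openin_topology_generated_by)
  then show "eventually (\<lambda>i. f i \<in> U) F" using aU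
  proof induction
    case (Int V W)
    then show ?case by (simp add: eventually_conj)
  next
    case (UN K)
    then obtain V where V: "V \<in> K" "a \<in> V" by blast
    with UN have "eventually (\<lambda>i. f i \<in> V) F" by blast
    then show ?case using V(1) by (auto elim: eventually_mono)
  next
    case (Basis V)
    then obtain \<xi> \<eta> W where V: "V = {a \<in> bounded_ops. ultraweak_functional \<xi> \<eta> a \<in> W}"
      and sq: "square_summable \<xi>" "square_summable \<eta>" "open W" by blast
    have "ultraweak_functional \<xi> \<eta> a \<in> W" using Basis V by blast
    then have "eventually (\<lambda>i. ultraweak_functional \<xi> \<eta> (f i) \<in> W) F"
      using ultraweak_functional_tendsto [OF F bound lim sq(1,2)] sq(3) by (rule topological_tendstoD [rotated 2])
    then show ?case by (simp add: V f)
  qed simp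
qed (use a in simp)

lemma von_neumann_algebraD:
  assumes "von_neumann_algebra M"
  shows "M \<subseteq> bounded_ops" "0 \<in> M" "a \<in> M \<Longrightarrow> b \<in> M \<Longrightarrow> a + b \<in> M" "a \<in> M \<Longrightarrow> scale_op c a \<in> M"
    "a \<in> M \<Longrightarrow> b \<in> M \<Longrightarrow> a o\<^sub>L b \<in> M" "a \<in> M \<Longrightarrow> adj a \<in> M" "id_blinfun \<in> M"
    "closedin ultraweak_topology M"
  using assms by (auto simp: von_neumann_algebra_def op_subspace_def)

lemma von_neumann_algebra_weak_limit:
  assumes M: "von_neumann_algebra M" and F: "F \<noteq> bot" and f: "\<And>i. f i \<in> M"
    and a: "a \<in> bounded_ops" and bound: "\<And>i. norm (f i) \<le> C" and lim: "weak_limit f a F"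
  shows "a \<in> M"
proof -
  have "limitin ultraweak_topology f a F"
    using von_neumann_algebraD(1) [OF M] f by (intro limitin_ultraweak [OF F _ a bound lim]) blast
  then show ?thesis
    using limitin_closedin [OF _ von_neumann_algebraD(8) [OF M] _ F] f by auto
qed

text \<open>On bounded families weak limits are ultraweak limits, which a normal map preserves; the
  limit point itself stays in \<open>M\<close> because \<open>M\<close> is ultraweakly
  closed.\<close>

lemma normal_map_weak_limit:
  assumes M: "von_neumann_algebra M" and \<phi>: "normal_map M M' \<phi>" and F: "F \<noteq> bot"
    and f: "\<And>i. f i \<in> M" and a: "a \<in> bounded_ops" and bound: "\<And>i. norm (f i) \<le> C"
    and lim: "weak_limit f a F"
  shows "weak_limit (\<lambda>i. \<phi> (f i)) (\<phi> a) F"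
proof -
  have "limitin ultraweak_topology f a F"
    using von_neumann_algebraD(1) [OF M] f by (intro limitin_ultraweak [OF F _ a bound lim]) blast
  then have "limitin (subtopology ultraweak_topology M) f a F"
    using f von_neumann_algebra_weak_limit [OF assms(1,3-)] by (simp add: limitin_subtopology)
  then have "limitin ultraweak_topology (\<phi> \<circ> f) (\<phi> a) F"
    using continuous_map_limit [OF \<phi> [unfolded normal_map_def]] unfolding limitin_subtopology by blast
  then show ?thesis
    using limitin_ultraweakD by (fastforce simp: weak_limit_def o_def)
qed

lemma closed_bounded_ops: "closed (bounded_ops :: 'h::chilbert_space op set)"
  unfolding closed_sequential_limits
proof (intro allI impI; elim conjE)
  fix f and a :: "'h op" assume f: "\<forall>n. f n \<in> bounded_ops" "f \<longlonglongrightarrow> a"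
  have "a (c *\<^sub>C x) = c *\<^sub>C a x" for c x
  proof (rule LIMSEQ_unique)
    show "(\<lambda>n. f n (c *\<^sub>C x)) \<longlonglongrightarrow> a (c *\<^sub>C x)" by (intro tendsto_intros f)
    have "(\<lambda>n. c *\<^sub>C f n x) \<longlonglongrightarrow> c *\<^sub>C a x"
      by (intro bounded_linear.tendsto [OF bounded_linear_scaleC] tendsto_intros f)
    then show "(\<lambda>n. f n (c *\<^sub>C x)) \<longlonglongrightarrow> c *\<^sub>C a x" using f(1) by (simp add: bounded_opsD)
  qed
  then show "a \<in> bounded_ops" by (simp add: bounded_ops_def)
qed

text \<open>A norm convergent sequence is bounded and weakly convergent. Norm closedness is what the
  square root iteration requires.\<close>

lemma von_neumann_algebra_closed:
  assumes M: "von_neumann_algebra M"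
  shows "closed M"
  unfolding closed_sequential_limits
proof (intro allI impI; elim conjE)
  fix f a assume f: "\<forall>n. f n \<in> M" "f \<longlonglongrightarrow> a"
  have a: "a \<in> bounded_ops"
    using f von_neumann_algebraD(1) [OF M] by (intro closed_sequentially [OF closed_bounded_ops _ f(2)]) auto
  obtain C where C: "\<And>n. norm (f n) \<le> C"
    using convergent_imp_Bseq [of f] f(2) by (auto simp: convergent_def Bseq_def)
  have "weak_limit f a sequentially"
    unfolding weak_limit_def by (intro allI cinner.tendsto tendsto_intros f)
  then show "a \<in> M"
    using f(1) C by (intro von_neumann_algebra_weak_limit [OF M _ _ a]) auto
qed

text \<open>Closedness: the fixed points form an intersection of equalizers of the continuous
  functionals that pair \<open>\<phi> a\<close> and \<open>a\<close> with two vectors.\<close>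

lemma von_neumann_algebra_fixed_points:
  assumes M: "von_neumann_algebra M" and \<phi>: "normal_map M M \<phi>"
    and hom: "star_hom_on M (o\<^sub>L) (o\<^sub>L) \<phi>" "\<phi> id_blinfun = id_blinfun"
  shows "von_neumann_algebra (fixed_points M \<phi>)"
proof -
  note MD = von_neumann_algebraD [OF M]
  let ?X = "subtopology ultraweak_topology M"
  have top: "topspace ?X = M" using MD(1) by auto
  have c1: "continuous_map ?X euclidean (\<lambda>a. cinner (blinfun_apply a x) y)" for x y
    by (intro continuous_map_from_subtopology continuous_map_vector_functional)
  have c2: "continuous_map ?X euclidean (\<lambda>a. cinner (blinfun_apply (\<phi> a) x) y)" for x y
    using continuous_map_compose [OF \<phi> [unfolded normal_map_def] c1] by (simp add: o_def)
  have "closedin ?X {a \<in> topspace ?X. cinner (blinfun_apply (\<phi> a) x) y = cinner (blinfun_apply a x) y}" for x y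
    by (rule closedin_continuous_maps_eq [OF _ c2 c1]) simp
  then have "closedin ?X (\<Inter>(x,y). {a \<in> topspace ?X. cinner (blinfun_apply (\<phi> a) x) y = cinner (blinfun_apply a x) y})"
    by (intro closedin_INT) auto
  moreover have "(\<Inter>(x,y). {a \<in> topspace ?X. cinner (blinfun_apply (\<phi> a) x) y = cinner (blinfun_apply a x) y})
      = fixed_points M \<phi>"
    unfolding top by (auto simp: fixed_points_def intro!: op_eqI)
  ultimately have "closedin ultraweak_topology (fixed_points M \<phi>)"
    using MD(8) closedin_trans_full by metis
  moreover have "\<phi> 0 = 0"
    using hom(1) MD(2) unfolding star_hom_on_def clinear_on_def
    by (metis add.right_neutral add_left_cancel)
  ultimately show ?thesis
    using MD hom unfolding von_neumann_algebra_def op_subspace_def star_hom_on_def clinear_on_def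
      fixed_points_def by auto
qed

text \<open>Moving the self-adjoint \<open>q\<close> across the inner product expresses commutation
  by functionals of \<open>a\<close> alone. The result lets commutation with \<open>q\<close> be
  checked on generators.\<close>

lemma von_neumann_algebra_commutant:
  assumes q: "q \<in> bounded_ops" "adj q = q"
  shows "von_neumann_algebra {a \<in> bounded_ops. q o\<^sub>L a = a o\<^sub>L q}"
proof -
  let ?X = "ultraweak_topology"
  let ?E = "\<lambda>x y. {a \<in> topspace ?X. cinner (blinfun_apply a x) (q y) = cinner (blinfun_apply a (q x)) y}"
  have "closedin ?X (?E x y)" for x y
    by (rule closedin_continuous_maps_eq [OF _ continuous_map_vector_functional continuous_map_vector_functional]) simp
  then have "closedin ?X (\<Inter>(x,y). ?E x y)"
    by (intro closedin_INT) auto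
  moreover have "cinner x (q y) = cinner (q x) y" for x y
    using cinner_adj_right [OF q(1), of x y] q(2) by simp
  then have "(\<Inter>(x,y). ?E x y) = {a \<in> bounded_ops. q o\<^sub>L a = a o\<^sub>L q}"
    by (auto intro!: op_eqI) (metis blinfun_apply_blinfun_compose)
  moreover have "q o\<^sub>L adj a = adj a o\<^sub>L q" if "a \<in> bounded_ops" "q o\<^sub>L a = a o\<^sub>L q" for a
    using that q by (metis adj_compose)
  moreover have "q o\<^sub>L (a o\<^sub>L b) = (a o\<^sub>L b) o\<^sub>L q" if "q o\<^sub>L a = a o\<^sub>L q" "q o\<^sub>L b = b o\<^sub>L q" for a b
    using that by (metis blinfun_compose_assoc)
  moreover have "q o\<^sub>L scale_op c a = scale_op c a o\<^sub>L q" if "a \<in> bounded_ops" "q o\<^sub>L a = a o\<^sub>L q" for a c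
    using that q by (simp add: scale_op_compose)
  ultimately show ?thesis
    unfolding von_neumann_algebra_def op_subspace_def
    by (auto simp: bounded_ops_add bounded_ops_scale bounded_ops_compose adj_bounded_ops
        blinfun_compose_add_left blinfun_compose_add_right)
qed

subsection \<open>Square roots in operator algebras\<close>

text \<open>The unit \<open>e\<close> need not be the identity operator; the corner \<open>pMp\<close> has unit \<open>p\<close>.\<close>

locale unital_star_algebra =
  fixes S :: "'h::chilbert_space op set" and e :: "'h op"
  assumes bounded: "S \<subseteq> bounded_ops" and closed: "closed S"
    and add: "a \<in> S \<Longrightarrow> b \<in> S \<Longrightarrow> a + b \<in> S"
    and scale: "a \<in> S \<Longrightarrow> scale_op c a \<in> S"
    and compose: "a \<in> S \<Longrightarrow> b \<in> S \<Longrightarrow> a o\<^sub>L b \<in> S"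
    and adjoint: "a \<in> S \<Longrightarrow> adj a \<in> S"
    and unit: "e \<in> S" "is_projection e"
    and unit_compose: "a \<in> S \<Longrightarrow> e o\<^sub>L a = a" "a \<in> S \<Longrightarrow> a o\<^sub>L e = a"
begin

lemma bounded_op: "a \<in> S \<Longrightarrow> a \<in> bounded_ops"
  using bounded by blast

lemma scaleR: "a \<in> S \<Longrightarrow> r *\<^sub>R a \<in> S"
  using scale [of a "of_real r"] by (simp add: scale_op_of_real)

lemma diff: "a \<in> S \<Longrightarrow> b \<in> S \<Longrightarrow> a - b \<in> S"
  using add [of a "- b"] scaleR [of b "-1"] by simp

lemma zero: "0 \<in> S"
  using scaleR [OF unit(1), of 0] by simp

lemma sum: "(\<And>i. i \<in> A \<Longrightarrow> f i \<in> S) \<Longrightarrow> sum f A \<in> S"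
  by (induction A rule: infinite_finite_induct) (auto simp: zero intro: add)

end

text \<open>Cauchy-Schwarz for the form of \<open>c\<close>, applied to \<open>x\<close> and
  \<open>c x\<close>.\<close>

lemma positive_op_norm_le:
  assumes c: "positive_op c" and K: "0 \<le> K"
    and le: "\<And>x. Re (cinner (blinfun_apply c x) x) \<le> K * (norm x)\<^sup>2"
  shows "norm c \<le> K"
proof (rule norm_blinfun_bound [OF K])
  fix x
  show "norm (c x) \<le> K * norm x"
  proof (cases "c x = 0")
    case False
    have "((norm (c x))\<^sup>2)\<^sup>2 = (cmod (cinner (c x) (c x)))\<^sup>2"
      by (simp add: cinner_self del: of_real_power)
    also have "\<dots> \<le> Re (cinner (c x) x) * Re (cinner (c (c x)) (c x))"
      by (rule positive_op_Cauchy_Schwarz [OF c])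
    also have "\<dots> \<le> (K * (norm x)\<^sup>2) * (K * (norm (c x))\<^sup>2)"
      using K by (intro mult_mono le positive_opD(2) [OF c]) simp
    also have "\<dots> = (K * norm x)\<^sup>2 * (norm (c x))\<^sup>2" by (simp add: power2_eq_square)
    finally have "(norm (c x))\<^sup>2 * (norm (c x))\<^sup>2 \<le> (K * norm x)\<^sup>2 * (norm (c x))\<^sup>2"
      by (simp only: power2_eq_square [of "(norm (c x))\<^sup>2"])
    moreover have "0 < (norm (c x))\<^sup>2" using False by simp
    ultimately have "(norm (c x))\<^sup>2 \<le> (K * norm x)\<^sup>2" by (rule mult_right_le_imp_le)
    then show ?thesis by (rule power2_le_imp_le) (use K in simp)
  qed (use K in simp)
qed

lemma adj_limit_self:
  assumes u: "\<And>n. u n \<in> bounded_ops" "\<And>n. adj (u n) = u n" and l: "u \<longlonglongrightarrow> l" "l \<in> bounded_ops"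
  shows "adj l = l"
proof (rule adj_unique [OF l(2)])
  fix x y
  have 1: "(\<lambda>n. cinner (u n x) y) \<longlonglongrightarrow> cinner (l x) y"
    by (intro cinner.tendsto tendsto_intros l)
  have 2: "(\<lambda>n. cinner x (u n y)) \<longlonglongrightarrow> cinner x (l y)"
    by (intro cinner.tendsto tendsto_intros l)
  have "cinner (u n x) y = cinner x (u n y)" for n
    using cinner_adj_right [OF u(1), of x n y] u(2) by simp
  with 1 2 show "cinner (l x) y = cinner x (l y)"
    using LIMSEQ_unique by auto
qed

fun majorant :: "nat \<Rightarrow> real" where
  "majorant 0 = 0"
| "majorant (Suc n) = (1 + (majorant n)\<^sup>2) / 2"

lemma majorant_bounds: "0 \<le> majorant n" "majorant n \<le> 1"
  by (induction n) (auto simp: power_le_one)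

lemma majorant_mono: "majorant n \<le> majorant (Suc n)"
proof -
  have "0 \<le> (1 - majorant n)\<^sup>2" by simp
  then show ?thesis by (simp add: power2_diff)
qed

text \<open>The increments telescope along a bounded monotone sequence. The limit 1 is a double root
  of the fixed point equation, so no geometric bound on the increments is available.\<close>

lemma majorant_summable: "summable (\<lambda>n. majorant (Suc n) - majorant n)"
proof -
  have "Bseq majorant" by (rule BseqI' [of _ 1]) (use majorant_bounds in auto)
  moreover have "monoseq majorant" using majorant_mono by (simp add: incseq_SucI incseq_imp_monoseq)
  ultimately obtain l where "majorant \<longlonglongrightarrow> l" using Bseq_monoseq_convergent convergent_def by blast
  then show ?thesis by (rule telescope_summable)
qed

text \<open>With \<open>c = e - a\<close> the iteration \<open>u \<mapsto> (c + u\<^sup>2)/2\<close> converges to \<open>e - \<surd>a\<close>. All iterates are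
  polynomials in \<open>c\<close> with nonnegative coefficients, so their increments are dominated in norm by
  those of the scalar iteration for \<open>c = 1\<close>.\<close>

fun sqrt_iterate :: "'h::chilbert_space op \<Rightarrow> nat \<Rightarrow> 'h op" where
  "sqrt_iterate c 0 = 0"
| "sqrt_iterate c (Suc n) = (1/2) *\<^sub>R (c + (sqrt_iterate c n o\<^sub>L sqrt_iterate c n))"

lemmas blinfun_compose_scaleR_left = bounded_bilinear.scaleR_left [OF bounded_bilinear_blinfun_compose]
  and blinfun_compose_scaleR_right = bounded_bilinear.scaleR_right [OF bounded_bilinear_blinfun_compose]

lemma sqrt_iterate_commute: "c o\<^sub>L sqrt_iterate c n = sqrt_iterate c n o\<^sub>L c"
proof (induction n)
  case (Suc n)
  then have "c o\<^sub>L (sqrt_iterate c n o\<^sub>L sqrt_iterate c n) = (sqrt_iterate c n o\<^sub>L sqrt_iterate c n) o\<^sub>L c"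
    by (metis blinfun_compose_assoc)
  then show ?case
    by (simp add: blinfun_compose_add_left blinfun_compose_add_right
        blinfun_compose_scaleR_left blinfun_compose_scaleR_right)
qed simp

lemma sqrt_iterate_commute_Suc:
  "sqrt_iterate c n o\<^sub>L sqrt_iterate c (Suc n) = sqrt_iterate c (Suc n) o\<^sub>L sqrt_iterate c n"
  by (simp add: blinfun_compose_add_left blinfun_compose_add_right blinfun_compose_scaleR_left
      blinfun_compose_scaleR_right sqrt_iterate_commute blinfun_compose_assoc)

lemma sqrt_iterate_norm:
  assumes "norm c \<le> 1"
  shows "norm (sqrt_iterate c n) \<le> majorant n"
proof (induction n)
  case (Suc n)
  let ?u = "sqrt_iterate c n"
  have "norm (c + (?u o\<^sub>L ?u)) \<le> norm c + norm ?u * norm ?u"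
    by (intro order_trans [OF norm_triangle_ineq] add_left_mono norm_blinfun_compose)
  also have "\<dots> \<le> 1 + (majorant n)\<^sup>2"
    unfolding power2_eq_square by (intro add_mono mult_mono assms Suc majorant_bounds) simp
  finally show ?case by simp
qed simp

lemma sqrt_iterate_increment:
  assumes "norm c \<le> 1"
  shows "norm (sqrt_iterate c (Suc n) - sqrt_iterate c n) \<le> majorant (Suc n) - majorant n"
proof (induction n)
  case 0
  then show ?case using assms by simp
next
  case (Suc n)
  let ?u = "sqrt_iterate c n" and ?v = "sqrt_iterate c (Suc n)"
  \<comment> \<open>A difference of squares, valid because consecutive iterates commute.\<close>
  have "(?v o\<^sub>L ?v) - (?u o\<^sub>L ?u) = (?v - ?u) o\<^sub>L (?v + ?u)"
    using sqrt_iterate_commute_Suc [of c n]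
    by (simp only: blinfun_compose_diff_left blinfun_compose_add_right) (simp del: sqrt_iterate.simps)
  then have "sqrt_iterate c (Suc (Suc n)) - ?v = (1/2) *\<^sub>R ((?v - ?u) o\<^sub>L (?v + ?u))"
    by (simp only: sqrt_iterate.simps(2) [of c "Suc n"] scaleR_diff_right [symmetric]
        sqrt_iterate.simps(2) [of c n]) (simp add: algebra_simps)
  then have "norm (sqrt_iterate c (Suc (Suc n)) - ?v) = norm ((?v - ?u) o\<^sub>L (?v + ?u)) / 2"
    by (simp del: sqrt_iterate.simps)
  also have "norm ((?v - ?u) o\<^sub>L (?v + ?u)) \<le> norm (?v - ?u) * norm (?v + ?u)"
    by (rule norm_blinfun_compose)
  also have "\<dots> \<le> (majorant (Suc n) - majorant n) * (majorant (Suc n) + majorant n)"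
  proof (rule mult_mono [OF Suc])
    show "norm (?v + ?u) \<le> majorant (Suc n) + majorant n"
      by (intro order_trans [OF norm_triangle_ineq] add_mono sqrt_iterate_norm assms)
  qed (use majorant_mono [of n] in simp_all)
  also have "(majorant (Suc n) - majorant n) * (majorant (Suc n) + majorant n) / 2 =
      majorant (Suc (Suc n)) - majorant (Suc n)"
    by (simp add: power2_eq_square field_simps)
  finally show ?case by simp
qed

context unital_star_algebra
begin

lemma sqrt_iterate_mem:
  assumes c: "c \<in> S" "adj c = c"
  shows "sqrt_iterate c n \<in> S \<and> adj (sqrt_iterate c n) = sqrt_iterate c n"
proof (induction n)
  case 0
  then show ?case by (simp add: zero) (rule adj_unique, simp_all)
next
  case (Suc n)
  then have "adj (c + (sqrt_iterate c n o\<^sub>L sqrt_iterate c n)) = c + (sqrt_iterate c n o\<^sub>L sqrt_iterate c n)"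
    using c by (simp add: adj_add adj_compose bounded_op compose)
  moreover have "c + (sqrt_iterate c n o\<^sub>L sqrt_iterate c n) \<in> S"
    using c Suc by (simp add: add compose)
  ultimately show ?case
    by (simp add: scaleR) (simp flip: scale_op_of_real add: adj_scale_op bounded_op)
qed

lemma square_root_contraction:
  assumes c: "c \<in> S" "adj c = c" "norm c \<le> 1"
  shows "\<exists>b\<in>S. adj b = b \<and> b o\<^sub>L b = e - c"
proof -
  let ?u = "sqrt_iterate c"
  have "summable (\<lambda>n. ?u (Suc n) - ?u n)"
    by (rule summable_comparison_test' [OF majorant_summable, of 0])
      (simp add: sqrt_iterate_increment [OF c(3)] del: sqrt_iterate.simps majorant.simps)
  then have "(\<lambda>n. \<Sum>i<n. ?u (Suc i) - ?u i) \<longlonglongrightarrow> (\<Sum>n. ?u (Suc n) - ?u n)"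
    by (rule summable_LIMSEQ)
  then obtain u where u: "?u \<longlonglongrightarrow> u"
    by (simp add: sum_lessThan_telescope del: sqrt_iterate.simps(2))
  have uS: "u \<in> S" using closed_sequentially [OF closed _ u] sqrt_iterate_mem [OF c(1,2)] by blast
  have adj_u: "adj u = u"
    using adj_limit_self [OF _ _ u bounded_op [OF uS]] sqrt_iterate_mem [OF c(1,2)] bounded_op by blast
  have "(\<lambda>n. (1/2) *\<^sub>R (c + (?u n o\<^sub>L ?u n))) \<longlonglongrightarrow> (1/2) *\<^sub>R (c + (u o\<^sub>L u))"
    by (intro tendsto_intros bounded_bilinear.tendsto [OF bounded_bilinear_blinfun_compose] u)
  then have "(\<lambda>n. ?u (Suc n)) \<longlonglongrightarrow> (1/2) *\<^sub>R (c + (u o\<^sub>L u))" by simp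
  with LIMSEQ_Suc [OF u] have "u = (1/2) *\<^sub>R (c + (u o\<^sub>L u))" by (rule LIMSEQ_unique)
  then have "2 *\<^sub>R u = 2 *\<^sub>R ((1/2) *\<^sub>R (c + (u o\<^sub>L u)))" by (rule arg_cong)
  then have "u o\<^sub>L u = u + u - c" by (simp add: scaleR_2)
  \<comment> \<open>The limit satisfies \<open>u = (c + u\<^sup>2) / 2\<close>; completing the
    square makes \<open>e - u\<close> the root of \<open>e - c\<close>.\<close>
  then have "(e - u) o\<^sub>L (e - u) = e - c"
    by (simp add: blinfun_compose_diff_left blinfun_compose_diff_right unit_compose uS unit(1))
  moreover have "adj (e - u) = e - u"
    using adj_u is_projectionD(3) [OF unit(2)] by (simp add: adj_diff bounded_op unit(1) uS)
  ultimately show ?thesis using diff [OF unit(1) uS] by blast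
qed

lemma cinner_unit_compress:
  assumes "a \<in> S"
  shows "cinner (blinfun_apply a (blinfun_apply e x)) (blinfun_apply e x) = cinner (blinfun_apply a x) x"
proof -
  have "cinner (a (e x)) (e x) = cinner (e (a (e x))) x"
    by (rule is_projectionD(5) [OF unit(2), symmetric])
  also have "\<dots> = cinner ((e o\<^sub>L a o\<^sub>L e) x) x" by simp
  also have "e o\<^sub>L a o\<^sub>L e = a" using assms by (simp add: unit_compose)
  finally show ?thesis .
qed

lemma square_root:
  assumes a: "a \<in> S" "positive_op a"
  obtains b where "b \<in> S" "adj b = b" "b o\<^sub>L b = a"
proof (cases "norm a = 0")
  case True
  then show ?thesis using that [of 0] zero positive_op_adj [OF a(2)] by simp
next
  case False
  define t where "t = norm a"
  have t: "0 < t" using False by (simp add: t_def)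
  \<comment> \<open>Dividing by \<open>t = norm a\<close> puts \<open>c\<close> between 0 and
    \<open>e\<close>, hence in the unit ball; the root of \<open>e - c = a / t\<close> is rescaled
    by \<open>sqrt t\<close> at the end.\<close>
  define c where "c = e - (1/t) *\<^sub>R a"
  have cS: "c \<in> S" unfolding c_def by (intro diff unit scaleR a)
  have quad: "cinner (c x) x = of_real ((norm (e x))\<^sup>2) - of_real (Re (cinner (a x) x) / t)" for x
    using positive_opD(3) [OF a(2), of x] is_projectionD(6) [OF unit(2), of x]
    by (simp add: c_def blinfun.diff_left blinfun.scaleR_left cinner_simps complex_eq_iff)
  have "Re (cinner (a x) x) \<le> t * (norm (e x))\<^sup>2" for x
  proof -
    have "Re (cinner (a (e x)) (e x)) \<le> norm (a (e x)) * norm (e x)"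
      using complex_Re_le_cmod cinner_Cauchy_Schwarz order_trans by blast
    also have "\<dots> \<le> (t * norm (e x)) * norm (e x)"
      unfolding t_def by (intro mult_right_mono norm_blinfun) simp
    finally show ?thesis by (simp add: cinner_unit_compress [OF a(1)] power2_eq_square)
  qed
  then have "positive_op c"
    unfolding positive_op_def using bounded_op [OF cS] t
    by (simp add: quad complex_nonneg_Reals_iff pos_divide_le_eq mult.commute)
  moreover have "Re (cinner (c x) x) \<le> 1 * (norm x)\<^sup>2" for x
  proof -
    have "Re (cinner (c x) x) = (norm (e x))\<^sup>2 - Re (cinner (a x) x) / t" by (simp add: quad)
    also have "\<dots> \<le> (norm (e x))\<^sup>2" using positive_opD(2) [OF a(2), of x] t by simp
    also have "\<dots> \<le> (norm x)\<^sup>2" by (intro power_mono projection_norm_le unit) simp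
    finally show ?thesis by simp
  qed
  ultimately have "norm c \<le> 1" "adj c = c"
    using positive_op_norm_le [of c 1] positive_op_adj by auto
  then obtain b where b: "b \<in> S" "adj b = b" "b o\<^sub>L b = e - c"
    using square_root_contraction cS by blast
  show ?thesis
  proof (rule that)
    show "sqrt t *\<^sub>R b \<in> S" by (intro scaleR b)
    show "adj (sqrt t *\<^sub>R b) = sqrt t *\<^sub>R b"
      using b by (simp flip: scale_op_of_real add: adj_scale_op bounded_op)
    show "sqrt t *\<^sub>R b o\<^sub>L sqrt t *\<^sub>R b = a"
      using b(3) t by (simp add: blinfun_compose_scaleR_left blinfun_compose_scaleR_right c_def)
  qed
qed

end

subsection \<open>Complete positivity of *-homomorphisms\<close>

lemma (in unital_star_algebra) clinear_on_sum:
  assumes "clinear_on S \<phi>" "\<And>i. i \<in> A \<Longrightarrow> f i \<in> S"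
  shows "\<phi> (sum f A) = (\<Sum>i\<in>A. \<phi> (f i))"
proof -
  have 0: "\<phi> 0 = 0"
    using assms(1) zero unfolding clinear_on_def by (metis add_0 add_cancel_right_left)
  show ?thesis using assms(2)
  proof (induction A rule: infinite_finite_induct)
    case (insert x A)
    then show ?case using assms(1) sum [of A f] by (simp add: clinear_on_def)
  qed (simp_all add: 0)
qed

lemma nonneg_Reals_sum: "(\<And>i. i \<in> A \<Longrightarrow> f i \<in> \<real>\<^sub>\<ge>\<^sub>0) \<Longrightarrow> sum f A \<in> (\<real>\<^sub>\<ge>\<^sub>0 :: complex set)"
  by (induction A rule: infinite_finite_induct) (auto intro: nonneg_Reals_add_I)

locale star_hom = unital_star_algebra S e for S :: "'h::chilbert_space op set" and e +
  fixes \<phi> :: "'h op \<Rightarrow> 'k::chilbert_space op"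
  assumes hom: "star_hom_on S (o\<^sub>L) (o\<^sub>L) \<phi>" and range: "a \<in> S \<Longrightarrow> \<phi> a \<in> bounded_ops"
begin

lemma hom_clinear: "clinear_on S \<phi>"
  and hom_compose: "a \<in> S \<Longrightarrow> b \<in> S \<Longrightarrow> \<phi> (a o\<^sub>L b) = \<phi> a o\<^sub>L \<phi> b"
  and hom_adj: "a \<in> S \<Longrightarrow> \<phi> (adj a) = adj (\<phi> a)"
  using hom by (auto simp: star_hom_on_def)

lemma hom_move: "a \<in> S \<Longrightarrow> cinner (blinfun_apply (\<phi> a) x) y = cinner x (blinfun_apply (\<phi> (adj a)) y)"
  by (simp add: hom_adj cinner_adj_right range)

text \<open>The square root of \<open>a\<close> lies in the domain of \<open>\<phi>\<close>, so
  \<open>\<phi> a\<close> again has the form of an adjoint times itself.\<close>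

lemma hom_positive:
  assumes "a \<in> S" "positive_op a" shows "positive_op (\<phi> a)"
proof -
  obtain b where b: "b \<in> S" "adj b = b" "b o\<^sub>L b = a" by (rule square_root [OF assms])
  have "\<phi> a = \<phi> (adj b o\<^sub>L b)" using b by simp
  also have "\<dots> = adj (\<phi> b) o\<^sub>L \<phi> b" using b(1) by (simp add: hom_compose hom_adj adjoint)
  finally show ?thesis using positive_op_adj_compose [OF range [OF b(1)]] by simp
qed

definition form :: "nat \<Rightarrow> (nat \<Rightarrow> nat \<Rightarrow> 'h op) \<Rightarrow> (nat \<Rightarrow> 'k) \<Rightarrow> complex" where
  "form n a \<xi> = (\<Sum>i<n. \<Sum>j<n. cinner (\<phi> (a i j) (\<xi> j)) (\<xi> i))"

text \<open>On vectors from one orbit the form is the value at \<open>\<eta>\<close> of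
  \<open>\<phi>\<close> applied to the single operator \<open>c\<close>, which is positive because
  the matrix \<open>a\<close> is.\<close>

lemma form_cyclic:
  assumes a: "\<And>i j. i < n \<Longrightarrow> j < n \<Longrightarrow> a i j \<in> S" "positive_matrix n a" and b: "\<And>i. b i \<in> S"
  shows "form n a (\<lambda>i. \<phi> (b i) \<eta>) \<in> \<real>\<^sub>\<ge>\<^sub>0"
proof -
  define c where "c = (\<Sum>i<n. \<Sum>j<n. adj (b i) o\<^sub>L (a i j o\<^sub>L b j))"
  have inS: "adj (b i) o\<^sub>L (a i j o\<^sub>L b j) \<in> S" if "i < n" "j < n" for i j
    by (intro compose adjoint a b that)
  have rowS: "(\<Sum>j<n. adj (b i) o\<^sub>L (a i j o\<^sub>L b j)) \<in> S" if "i < n" for i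
    using that by (intro sum inS) auto
  have cS: "c \<in> S" unfolding c_def by (intro sum rowS) auto
  have "cinner (c x) x = (\<Sum>i<n. \<Sum>j<n. cinner (a i j (b j x)) (b i x))" for x
    by (simp add: c_def blinfun.sum_left cinner.sum_left cinner_adj_left bounded_op b)
  then have "positive_op c"
    unfolding positive_op_def using a(2) bounded_op [OF cS] by (simp add: positive_matrix_def)
  then have "cinner (\<phi> c \<eta>) \<eta> \<in> \<real>\<^sub>\<ge>\<^sub>0"
    using hom_positive [OF cS] by (simp add: positive_op_def)
  also have "\<phi> c = (\<Sum>i<n. \<Sum>j<n. \<phi> (adj (b i) o\<^sub>L (a i j o\<^sub>L b j)))"
  proof -
    have "\<phi> c = (\<Sum>i<n. \<phi> (\<Sum>j<n. adj (b i) o\<^sub>L (a i j o\<^sub>L b j)))"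
      unfolding c_def by (rule clinear_on_sum [OF hom_clinear]) (use rowS in auto)
    also have "\<dots> = (\<Sum>i<n. \<Sum>j<n. \<phi> (adj (b i) o\<^sub>L (a i j o\<^sub>L b j)))"
      by (intro sum.cong refl clinear_on_sum [OF hom_clinear]) (use inS in auto)
    finally show ?thesis .
  qed
  also have "cinner (\<dots> \<eta>) \<eta> = form n a (\<lambda>i. \<phi> (b i) \<eta>)"
    by (simp add: form_def blinfun.sum_left cinner.sum_left hom_compose hom_adj adjoint compose a b
        cinner_adj_left range)
  finally show ?thesis .
qed

text \<open>Splitting all vectors along the reducing subspace generated by \<open>\<phi>(S) \<xi>\<^sub>m\<close> removes \<open>\<xi>\<^sub>m\<close> from
  the complementary part, while the other part is a limit of vectors \<open>\<phi>(b) \<xi>\<^sub>m\<close>. Hence positivity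
  of \<open>\<phi>\<close> on single operators suffices.\<close>

lemma form_nonneg:
  assumes a: "\<And>i j. i < n \<Longrightarrow> j < n \<Longrightarrow> a i j \<in> S" "positive_matrix n a"
    and "\<And>i. i < n \<Longrightarrow> m \<le> i \<Longrightarrow> \<xi> i = 0"
  shows "form n a \<xi> \<in> \<real>\<^sub>\<ge>\<^sub>0"
  using assms(3)
proof (induction m arbitrary: \<xi>)
  case 0
  then show ?case by (simp add: form_def blinfun.zero_right)
next
  case (Suc m)
  define W where "W = {\<phi> b (\<xi> m) | b. b \<in> S}"
  define V where "V = closure W"
  have W_closed: "0 \<in> W" "x \<in> W \<Longrightarrow> y \<in> W \<Longrightarrow> x + y \<in> W" "x \<in> W \<Longrightarrow> c *\<^sub>C x \<in> W"
    "x \<in> W \<Longrightarrow> b \<in> S \<Longrightarrow> \<phi> b x \<in> W" for x y c b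
  proof -
    have "\<phi> (scale_op 0 e) = scale_op 0 (\<phi> e)" "scale_op 0 e \<in> S"
      using hom_clinear unit(1) scale by (auto simp: clinear_on_def)
    then show "0 \<in> W" unfolding W_def by (force intro!: exI [of _ "scale_op 0 e"])
    show "x + y \<in> W" if xy: "x \<in> W" "y \<in> W"
    proof -
      obtain b c where "x = \<phi> b (\<xi> m)" "y = \<phi> c (\<xi> m)" "b \<in> S" "c \<in> S"
        using xy unfolding W_def by blast
      then show ?thesis using add hom_clinear unfolding W_def
        by (auto intro!: exI [of _ "b + c"] simp: clinear_on_def blinfun.add_left)
    qed
    show "c *\<^sub>C x \<in> W" if x: "x \<in> W"
    proof -
      obtain b where "x = \<phi> b (\<xi> m)" "b \<in> S"
        using x unfolding W_def by blast
      then show ?thesis using scale hom_clinear unfolding W_def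
        by (auto intro!: exI [of _ "scale_op c b"] simp: clinear_on_def)
    qed
    show "\<phi> b x \<in> W" if x: "x \<in> W" "b \<in> S"
    proof -
      obtain c where "x = \<phi> c (\<xi> m)" "c \<in> S"
        using x unfolding W_def by blast
      then show ?thesis using compose x(2) unfolding W_def
        by (auto intro!: exI [of _ "b o\<^sub>L c"] simp: hom_compose)
    qed
  qed
  have V: "closed V" "0 \<in> V" unfolding V_def using W_closed(1) closure_subset by auto
  have V_add: "x + y \<in> V" if xy: "x \<in> V" "y \<in> V" for x y
  proof -
    obtain f g where "\<And>n. f n \<in> W" "f \<longlonglongrightarrow> x" "\<And>n. g n \<in> W" "g \<longlonglongrightarrow> y"
      using xy unfolding V_def closure_sequential by blast
    then show ?thesis unfolding V_def closure_sequential
      by (intro exI [of _ "\<lambda>n. f n + g n"]) (auto intro: tendsto_add W_closed)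
  qed
  have V_image: "L x \<in> V" if L: "x \<in> V" "bounded_linear L" "\<And>y. y \<in> W \<Longrightarrow> L y \<in> W" for L x
  proof -
    obtain f where "\<And>n. f n \<in> W" "f \<longlonglongrightarrow> x"
      using L(1) unfolding V_def closure_sequential by blast
    then show ?thesis unfolding V_def closure_sequential
      by (intro exI [of _ "\<lambda>n. L (f n)"]) (auto intro: L bounded_linear.tendsto [OF L(2)])
  qed
  have V_scale: "c *\<^sub>C x \<in> V" if "x \<in> V" for c x
    by (rule V_image [OF that bounded_linear_scaleC]) (rule W_closed)
  have V_hom: "\<phi> b x \<in> V" if "x \<in> V" "b \<in> S" for b x
    by (rule V_image [OF that(1) blinfun.bounded_linear_right]) (rule W_closed(4) [OF _ that(2)])
  have "\<exists>v\<in>V. \<forall>w\<in>V. cinner (\<xi> j - v) w = 0" for j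
    using orthogonal_decomposition [OF V V_add V_scale] by metis
  then obtain v where v: "\<And>j. v j \<in> V" "\<And>j y. y \<in> V \<Longrightarrow> cinner (\<xi> j - v j) y = 0" by metis
  define w where "w = (\<lambda>j. \<xi> j - v j)"
  have w: "cinner (w j) y = 0" "cinner y (w j) = 0" if "y \<in> V" for j y
  proof -
    show "cinner (w j) y = 0" using v(2) that by (simp add: w_def)
    then show "cinner y (w j) = 0" by (subst cinner_commute) simp
  qed
  \<comment> \<open>\<open>\<phi>\<close> need not be unital, so \<open>\<xi> m\<close> may lie
    outside \<open>V\<close>. Its remainder is nevertheless killed by all of
    \<open>\<phi>(S)\<close>: the image lies in \<open>V\<close> and is orthogonal to
    \<open>V\<close>.\<close>
  have w_hom: "\<phi> b (w m) = 0" if b: "b \<in> S" for b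
  proof (rule cinner_eq_zero_all)
    have "\<phi> b (\<xi> m) \<in> V" unfolding V_def using b closure_subset by (fastforce simp: W_def)
    moreover have "(-1) *\<^sub>C \<phi> b (v m) \<in> V" by (intro V_scale V_hom v b)
    ultimately have mem: "\<phi> b (w m) \<in> V"
      using V_add by (fastforce simp: w_def blinfun.diff_right scaleC_minus_one)
    have "cinner (\<phi> b (w m)) (\<phi> b (w m)) = cinner (w m) (\<phi> (adj b) (\<phi> b (w m)))"
      by (rule hom_move [OF b])
    also have "\<dots> = 0" by (intro w V_hom mem adjoint b)
    finally have "\<phi> b (w m) = 0" by (simp add: cinner_self)
    then show "cinner (\<phi> b (w m)) y = 0" for y by simp
  qed
  \<comment> \<open>The remainder of \<open>\<xi> m\<close> contributes nothing to the form, so it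
    may be replaced by 0; this shortens the support and makes the induction hypothesis
    applicable.\<close>
  define w' where "w' = (\<lambda>j. if j = m then 0 else w j)"
  have w'_zero: "w' i = 0" if "i < n" "m \<le> i" for i
  proof (cases "i = m")
    case False
    \<comment> \<open>For \<open>i > m\<close> the vector is 0, so its two orthogonal parts
      \<open>v i\<close> and \<open>w i\<close> are opposite and both vanish.\<close>
    then have 0: "\<xi> i = 0" using Suc.prems that by simp
    have "cinner (w i) (v i) = 0" by (intro w v)
    then have "v i = 0" by (simp add: w_def 0 cinner_simps cinner_self)
    then show ?thesis by (simp add: w'_def w_def 0)
  qed (simp add: w'_def)
  have term_eq: "cinner (\<phi> b (\<xi> j)) (\<xi> i) = cinner (\<phi> b (v j)) (v i) + cinner (\<phi> b (w' j)) (w' i)"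
    if b: "b \<in> S" for b i j
  proof -
    have *: "\<phi> b (\<xi> j) = \<phi> b (v j) + \<phi> b (w j)" "\<xi> i = v i + w i"
      by (simp_all add: w_def blinfun.diff_right)
    have "cinner (\<phi> b (v j)) (w i) = 0" by (intro w V_hom v b)
    moreover have "cinner (\<phi> b (w j)) (v i) = 0"
      unfolding hom_move [OF b] by (intro w V_hom v adjoint b)
    moreover have "cinner (\<phi> b (w j)) (w i) = cinner (\<phi> b (w' j)) (w' i)"
      using hom_move [OF b, of "w j" "w m"] w_hom [OF b] w_hom [OF adjoint [OF b]]
      by (simp add: w'_def blinfun.zero_right)
    ultimately show ?thesis unfolding * by (simp add: cinner_simps)
  qed
  have split: "form n a \<xi> = form n a v + form n a w'"
    using a(1) by (simp add: form_def term_eq sum.distrib)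
  have "form n a w' \<in> \<real>\<^sub>\<ge>\<^sub>0" by (rule Suc.IH [OF w'_zero])
  moreover have "form n a v \<in> \<real>\<^sub>\<ge>\<^sub>0"
  proof -
    \<comment> \<open>All \<open>v j\<close> are approximated from the one vector
      \<open>\<xi> m\<close>, which serves as the common \<open>\<eta>\<close> of
      \<open>form_cyclic\<close>.\<close>
    have "\<exists>b. (\<forall>k. b k \<in> S) \<and> (\<lambda>k. \<phi> (b k) (\<xi> m)) \<longlonglongrightarrow> v j" for j
    proof -
      obtain f where f: "\<And>k. f k \<in> W" "f \<longlonglongrightarrow> v j"
        using v(1) [of j] unfolding V_def closure_sequential by blast
      then have "\<forall>k. \<exists>b. b \<in> S \<and> f k = \<phi> b (\<xi> m)" unfolding W_def by blast
      then obtain b where "\<And>k. b k \<in> S \<and> f k = \<phi> (b k) (\<xi> m)" by metis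
      with f(2) show ?thesis by (intro exI [of _ b]) (simp add: LIMSEQ_iff)
    qed
    then obtain b where b: "\<And>j k. b j k \<in> S" "\<And>j. (\<lambda>k. \<phi> (b j k) (\<xi> m)) \<longlonglongrightarrow> v j" by metis
    have lim: "(\<lambda>k. form n a (\<lambda>i. \<phi> (b i k) (\<xi> m))) \<longlonglongrightarrow> form n a v"
      unfolding form_def
      by (intro tendsto_sum cinner.tendsto bounded_linear.tendsto [OF blinfun.bounded_linear_right] b)
    show ?thesis
      by (rule closed_sequentially [OF closed_nonneg_Reals_complex _ lim]) (rule form_cyclic [OF a b(1)])
  qed
  ultimately show ?case unfolding split by (rule nonneg_Reals_add_I [rotated])
qed

lemma completely_positive: "completely_positive_on S \<phi>"
  unfolding completely_positive_on_def
proof (intro conjI allI impI hom_clinear)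
  fix n a assume a: "(\<forall>i<n. \<forall>j<n. a i j \<in> S) \<and> positive_matrix n a"
  have "form n a \<xi> \<in> \<real>\<^sub>\<ge>\<^sub>0" for \<xi> using a by (intro form_nonneg [where m = n]) auto
  then show "positive_matrix n (\<lambda>i j. \<phi> (a i j))"
    using a range by (simp add: positive_matrix_def form_def)
qed

end

subsection \<open>Completely positive maps\<close>

lemma completely_positive_on_compose:
  assumes "completely_positive_on S \<phi>" "\<phi> \<in> S \<rightarrow> T" "completely_positive_on T \<psi>"
  shows "completely_positive_on S (\<lambda>a. \<psi> (\<phi> a))"
proof -
  have "positive_matrix n (\<lambda>i j. \<psi> (\<phi> (a i j)))"
    if a: "\<forall>i<n. \<forall>j<n. a i j \<in> S" "positive_matrix n a" for n a
  proof -
    have "positive_matrix n (\<lambda>i j. \<phi> (a i j))" "\<forall>i<n. \<forall>j<n. \<phi> (a i j) \<in> T"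
      using assms(1,2) a by (auto simp: completely_positive_on_def)
    then show ?thesis using assms(3) by (simp add: completely_positive_on_def)
  qed
  then show ?thesis
    using assms unfolding completely_positive_on_def clinear_on_def by (auto simp: Pi_iff)
qed

lemma completely_positive_on_positive:
  assumes "completely_positive_on S \<phi>" "a \<in> S" "positive_op a"
  shows "positive_op (\<phi> a)"
proof -
  have "positive_matrix 1 (\<lambda>_ _. a)"
    using assms(3) by (simp add: positive_matrix_def positive_op_def)
  then have "positive_matrix 1 (\<lambda>_ _. \<phi> a)"
    using assms(1,2) unfolding completely_positive_on_def
    by (elim conjE allE [of _ 1] allE [of _ "\<lambda>_ _. a"] impE) simp_all
  then have *: "\<phi> a \<in> bounded_ops" "\<And>\<xi> :: nat \<Rightarrow> _. cinner (\<phi> a (\<xi> 0)) (\<xi> 0) \<in> \<real>\<^sub>\<ge>\<^sub>0"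
    by (simp_all add: positive_matrix_def)
  show ?thesis unfolding positive_op_def using *(1) *(2) [of "\<lambda>_. x" for x] by blast
qed

locale unital_cp_map = unital_star_algebra S id_blinfun for S :: "'h::chilbert_space op set" +
  fixes \<psi> :: "'h op \<Rightarrow> 'k::chilbert_space op"
  assumes cp: "completely_positive_on S \<psi>" and unital: "\<psi> id_blinfun = id_blinfun"
begin

lemma cp_clinear: "clinear_on S \<psi>"
  using cp by (simp add: completely_positive_on_def)

text \<open>The 2 by 2 matrix with rows \<open>(1, b)\<close> and \<open>(b*, b* b)\<close> is
  positive, since its form at \<open>(\<xi> 0, \<xi> 1)\<close> is the squared norm of
  \<open>\<xi> 0 + b (\<xi> 1)\<close>. All later inequalities for \<psi> come from its
  image.\<close>

lemma cp_two_positive: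
  assumes b: "b \<in> S"
  shows "\<psi> b \<in> bounded_ops"
    and "cinner x x + cinner (\<psi> b y) x + cinner (\<psi> (adj b) x) y + cinner (\<psi> (adj b o\<^sub>L b) y) y \<in> \<real>\<^sub>\<ge>\<^sub>0"
proof -
  define a where "a = (\<lambda>(i::nat) (j::nat). if i = 0 then (if j = 0 then id_blinfun else b)
    else if j = 0 then adj b else adj b o\<^sub>L b)"
  have S: "a i j \<in> S" for i j by (simp add: a_def unit(1) b adjoint compose)
  have sum2: "(\<Sum>i<2::nat. \<Sum>j<2::nat. f i j) = f 0 0 + f 0 1 + f 1 0 + f 1 (1::nat)" for f :: "nat \<Rightarrow> nat \<Rightarrow> complex"
    by (simp add: numeral_2_eq_2)
  have "(\<Sum>i<2::nat. \<Sum>j<2::nat. cinner (a i j (\<xi> j)) (\<xi> i)) =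
      cinner (\<xi> 0 + b (\<xi> 1)) (\<xi> 0 + b (\<xi> 1))" for \<xi> :: "nat \<Rightarrow> 'h"
    by (simp add: sum2 a_def cinner_simps cinner_adj_left bounded_op b)
  then have "positive_matrix 2 a"
    using S bounded_op by (simp add: positive_matrix_def cinner_self complex_nonneg_Reals_iff del: of_real_power)
  then have *: "positive_matrix 2 (\<lambda>i j. \<psi> (a i j))"
    using cp S by (simp add: completely_positive_on_def)
  then have "\<psi> (a 0 1) \<in> bounded_ops" by (simp add: positive_matrix_def)
  then show "\<psi> b \<in> bounded_ops" by (simp add: a_def)
  have "(\<Sum>i<2::nat. \<Sum>j<2::nat. cinner (\<psi> (a i j) (if j = (0::nat) then x else y)) (if i = (0::nat) then x else y)) \<in> \<real>\<^sub>\<ge>\<^sub>0"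
    using conjunct2 [OF * [unfolded positive_matrix_def], THEN spec, of "\<lambda>i. if i = 0 then x else y"] .
  then show "cinner x x + cinner (\<psi> b y) x + cinner (\<psi> (adj b) x) y + cinner (\<psi> (adj b o\<^sub>L b) y) y \<in> \<real>\<^sub>\<ge>\<^sub>0"
    by (simp add: sum2 a_def unital)
qed

text \<open>The diagonal terms of the 2 by 2 form are real, so the sum of the off-diagonal ones is
  real as well; replacing \<open>x\<close> by \<open>\<i> *\<^sub>C x\<close> yields the other half
  of the identity.\<close>

lemma cp_adj:
  assumes b: "b \<in> S" shows "\<psi> (adj b) = adj (\<psi> b)"
proof (rule adj_unique [symmetric])
  show "\<psi> (adj b) \<in> bounded_ops" by (intro cp_two_positive adjoint b)
  fix y x
  have pos: "positive_op (\<psi> (adj b o\<^sub>L b))"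
    using b by (intro completely_positive_on_positive [OF cp] compose adjoint positive_op_adj_compose bounded_op)
  have im: "Im (cinner (\<psi> b y) x + cinner (\<psi> (adj b) x) y) = 0" for x y
    using cp_two_positive(2) [OF b, of x y] positive_opD(3) [OF pos, of y]
    by (simp add: complex_nonneg_Reals_iff cinner_self del: of_real_power)
  have "Im (- \<i> * cinner (\<psi> b y) x + \<i> * cinner (\<psi> (adj b) x) y) = 0"
    using im [of y "\<i> *\<^sub>C x"] cp_two_positive(1) [OF adjoint [OF b]] by (simp add: bounded_opsD cinner_simps)
  with im [of y x] have "cinner (\<psi> b y) x = cnj (cinner (\<psi> (adj b) x) y)" by (simp add: complex_eq_iff)
  then show "cinner (\<psi> b y) x = cinner y (\<psi> (adj b) x)" by (metis cinner_commute)
qed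

lemma cp_Schwarz:
  assumes b: "b \<in> S" shows "positive_op (\<psi> (adj b o\<^sub>L b) - (adj (\<psi> b) o\<^sub>L \<psi> b))"
proof -
  note B = cp_two_positive(1) [OF b]
  have *: "cinner ((\<psi> (adj b o\<^sub>L b) - (adj (\<psi> b) o\<^sub>L \<psi> b)) y) y \<in> \<real>\<^sub>\<ge>\<^sub>0" for y
  proof -
    \<comment> \<open>The choice \<open>x = - \<psi> b y\<close> minimizes the 2 by 2 form over
      \<open>x\<close>.\<close>
    have "cinner (- \<psi> b y) (- \<psi> b y) + cinner (\<psi> b y) (- \<psi> b y) + cinner (\<psi> (adj b) (- \<psi> b y)) y
        + cinner (\<psi> (adj b o\<^sub>L b) y) y = cinner ((\<psi> (adj b o\<^sub>L b) - (adj (\<psi> b) o\<^sub>L \<psi> b)) y) y"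
      by (simp add: cp_adj b cinner_simps blinfun.minus_right blinfun.diff_left)
    then show ?thesis using cp_two_positive(2) [OF b, of "- \<psi> b y" y] by simp
  qed
  have "\<psi> (adj b o\<^sub>L b) \<in> bounded_ops" by (intro cp_two_positive compose adjoint b)
  then show ?thesis
    unfolding positive_op_def using * B by (simp add: bounded_ops_diff bounded_ops_compose adj_bounded_ops)
qed

lemma cp_diff: "a \<in> S \<Longrightarrow> b \<in> S \<Longrightarrow> \<psi> (a - b) = \<psi> a - \<psi> b"
  using cp_clinear diff [of a b] unfolding clinear_on_def by (metis diff_add_cancel eq_diff_eq)

text \<open>By Schwarz, \<open>(norm (\<psi> b y))\<^sup>2\<close> is bounded by the form of
  \<open>\<psi> (adj b o\<^sub>L b)\<close>, and positivity with unitality bounds that operator by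
  \<open>(norm b)\<^sup>2\<close>.\<close>

lemma cp_contractive:
  assumes b: "b \<in> S" shows "norm (\<psi> b) \<le> norm b"
proof (rule norm_blinfun_bound)
  fix y
  define t where "t = (norm b)\<^sup>2"
  have pos: "positive_op (scale_op (of_real t) id_blinfun - (adj b o\<^sub>L b))"
  proof -
    have "(norm (b x))\<^sup>2 \<le> t * (norm x)\<^sup>2" for x
      unfolding t_def power_mult_distrib [symmetric] by (intro power_mono norm_blinfun) simp
    then have "cinner ((scale_op (of_real t) id_blinfun - (adj b o\<^sub>L b)) x) x \<in> \<real>\<^sub>\<ge>\<^sub>0" for x
      by (simp add: blinfun.diff_left cinner_simps cinner_adj_left bounded_op b cinner_self
          complex_nonneg_Reals_iff del: of_real_power)
    then show ?thesis unfolding positive_op_def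
      by (simp add: bounded_ops_diff bounded_ops_scale bounded_ops_compose adj_bounded_ops bounded_op b)
  qed
  have "positive_op (\<psi> (scale_op (of_real t) id_blinfun - (adj b o\<^sub>L b)))"
    by (intro completely_positive_on_positive [OF cp] pos diff scale unit compose adjoint b)
  also have "\<psi> (scale_op (of_real t) id_blinfun - (adj b o\<^sub>L b)) = scale_op (of_real t) id_blinfun - \<psi> (adj b o\<^sub>L b)"
    using cp_clinear unital by (simp add: cp_diff scale unit compose adjoint b clinear_on_def)
  finally have "Re (cinner (\<psi> (adj b o\<^sub>L b) y) y) \<le> t * (norm y)\<^sup>2"
    using positive_opD(2) [of _ y] by (fastforce simp: blinfun.diff_left cinner_simps cinner_self simp del: of_real_power)
  moreover have "(norm (\<psi> b y))\<^sup>2 \<le> Re (cinner (\<psi> (adj b o\<^sub>L b) y) y)"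
    using positive_opD(2) [OF cp_Schwarz [OF b], of y] cp_two_positive(1) [OF b]
    by (simp add: blinfun.diff_left cinner_simps cinner_adj_left cinner_self del: of_real_power)
  ultimately have "(norm (\<psi> b y))\<^sup>2 \<le> (norm b * norm y)\<^sup>2" by (simp add: t_def power_mult_distrib)
  then show "norm (\<psi> b y) \<le> norm b * norm y" by (rule power2_le_imp_le) simp
qed simp

end

lemma von_neumann_algebra_unital_star_algebra:
  assumes "von_neumann_algebra M"
  shows "unital_star_algebra M id_blinfun"
  using von_neumann_algebraD [OF assms] von_neumann_algebra_closed [OF assms]
  by unfold_locales (simp_all add: is_projection_def)

lemma corner_eq:
  assumes M: "von_neumann_algebra M" and p: "p \<in> M" "is_projection p"
  shows "corner p M = {x \<in> M. p o\<^sub>L x o\<^sub>L p = x}"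
proof -
  have "p o\<^sub>L (p o\<^sub>L x o\<^sub>L p) o\<^sub>L p = p o\<^sub>L x o\<^sub>L p" for x
    by (rule blinfun_eqI) (simp add: is_projectionD(4) [OF p(2)])
  then show ?thesis
    unfolding corner_def using von_neumann_algebraD(5) [OF M] p(1) by (auto intro: sym)
qed

text \<open>Makes square roots, and hence complete positivity of homomorphisms, available for maps
  defined on the corner only.\<close>

lemma corner_unital_star_algebra:
  assumes M: "von_neumann_algebra M" and p: "p \<in> M" "is_projection p"
  shows "unital_star_algebra (corner p M) p"
proof -
  note MD = von_neumann_algebraD [OF M] and pD = is_projectionD [OF p(2)]
  have C: "corner p M = {x \<in> M. p o\<^sub>L x o\<^sub>L p = x}" by (rule corner_eq [OF assms])
  have unit: "p o\<^sub>L x = x" "x o\<^sub>L p = x" if "x \<in> corner p M" for x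
    using that unfolding C by (metis (mono_tags, lifting) mem_Collect_eq blinfun_compose_assoc pD(2))+
  have mem: "x \<in> corner p M" if "x \<in> M" "p o\<^sub>L x = x" "x o\<^sub>L p = x" for x
    using that unfolding C by simp
  have sub: "corner p M \<subseteq> M" by (auto simp: C)
  show ?thesis
  proof
    show "corner p M \<subseteq> bounded_ops" using sub MD(1) by blast
    have "closed {x. p o\<^sub>L x o\<^sub>L p = x}"
      by (intro closed_Collect_eq continuous_intros bounded_bilinear.continuous_on [OF bounded_bilinear_blinfun_compose])
    then show "closed (corner p M)"
      unfolding C Collect_conj_eq using von_neumann_algebra_closed [OF M] by (simp add: closed_Int)
    show "p \<in> corner p M" using p pD by (intro mem) simp_all
    fix a assume a: "a \<in> corner p M"
    then have aM: "a \<in> M" using sub by blast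
    then have aB: "a \<in> bounded_ops" using MD(1) by blast
    show "p o\<^sub>L a = a" "a o\<^sub>L p = a" using unit a by auto
    show "adj a \<in> corner p M"
    proof (rule mem)
      show "p o\<^sub>L adj a = adj a" using adj_compose [OF aB pD(1)] unit(2) [OF a] pD(3) by simp
      show "adj a o\<^sub>L p = adj a" using adj_compose [OF pD(1) aB] unit(1) [OF a] pD(3) by simp
    qed (rule MD(6) [OF aM])
    show "scale_op c a \<in> corner p M" for c
      using MD(4) aM unit [OF a] by (intro mem) (simp_all add: scale_op_compose pD(1) aB)
    fix b assume b: "b \<in> corner p M"
    then have bM: "b \<in> M" using sub by blast
    show "a + b \<in> corner p M"
      using MD(3) [OF aM bM] unit [OF a] unit [OF b]
      by (intro mem) (simp_all add: blinfun_compose_add_left blinfun_compose_add_right)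
    show "a o\<^sub>L b \<in> corner p M"
    proof (rule mem)
      show "p o\<^sub>L (a o\<^sub>L b) = a o\<^sub>L b" using unit(1) [OF a] by (metis blinfun_compose_assoc)
      show "a o\<^sub>L b o\<^sub>L p = a o\<^sub>L b" using unit(2) [OF b] by (metis blinfun_compose_assoc)
    qed (rule MD(5) [OF aM bM])
  qed (rule p)
qed

subsection \<open>Weak cluster points of bounded sequences of operators\<close>

text \<open>Compactness without sequential compactness: the sequence is made to converge along a
  finer filter, which plays the part of a subnet.\<close>

lemma compact_cluster_filter:
  fixes f :: "nat \<Rightarrow> 'a::topological_space"
  assumes "compact K" "\<And>n. f n \<in> K"
  obtains l G where "G \<noteq> bot" "G \<le> sequentially" "(f \<longlongrightarrow> l) G"
proof -
  have "filtermap f sequentially \<noteq> bot" by (simp add: filtermap_bot_iff)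
  moreover have "eventually (\<lambda>x. x \<in> K) (filtermap f sequentially)"
    using assms(2) by (simp add: eventually_filtermap)
  ultimately obtain l where l: "inf (nhds l) (filtermap f sequentially) \<noteq> bot"
    using assms(1) unfolding compact_filter by blast
  define G where "G = inf sequentially (filtercomap f (nhds l))"
  have "G \<noteq> bot"
  proof
    assume "G = bot"
    then have "eventually (\<lambda>_. False) (inf sequentially (filtercomap f (nhds l)))"
      by (simp add: G_def)
    then obtain P Q where PQ: "eventually P sequentially" "eventually Q (filtercomap f (nhds l))"
      "\<And>n. P n \<Longrightarrow> Q n \<Longrightarrow> False" unfolding eventually_inf by blast
    then obtain R where R: "eventually R (nhds l)" "\<And>n. R (f n) \<Longrightarrow> Q n"
      unfolding eventually_filtercomap by blast
    have "eventually (\<lambda>x. \<not> R x) (filtermap f sequentially)"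
      unfolding eventually_filtermap using PQ(1) by eventually_elim (use PQ(3) R(2) in blast)
    then have "eventually (\<lambda>_. False) (inf (nhds l) (filtermap f sequentially))"
      unfolding eventually_inf using R(1) by blast
    with l show False by (simp add: trivial_limit_def)
  qed
  moreover have "G \<le> sequentially" by (simp add: G_def)
  moreover have "(f \<longlongrightarrow> l) G"
    by (rule filterlim_mono [OF filterlim_filtercomap [of f "nhds l"] order_refl]) (simp add: G_def)
  ultimately show ?thesis by (rule that)
qed

text \<open>Tychonoff over all triples of an index and two vectors: the coefficients of each family
  lie in fixed discs. Putting the index \<open>i\<close> into the product makes one filter serve all
  families at once, so linear relations between them survive in the limit.\<close>

lemma weak_cluster_point:
  fixes A :: "nat \<Rightarrow> 'i \<Rightarrow> 'h::chilbert_space op"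
  assumes A: "\<And>n i. A n i \<in> bounded_ops" and bound: "\<And>n i. norm (A n i) \<le> C i"
  obtains G B where "G \<noteq> bot" "G \<le> sequentially" "\<And>i. B i \<in> bounded_ops"
    "\<And>i. weak_limit (\<lambda>n. A n i) (B i) G"
proof -
  define f where "f = (\<lambda>n (i, x, y). cinner (A n i x) y)"
  define K where "K = (\<Pi>\<^sub>E c\<in>UNIV. case c of (i, x, y) \<Rightarrow> cball (0::complex) (C i * norm (x::'h) * norm (y::'h)))"
  have "compactin (product_topology (\<lambda>_. euclidean) UNIV) K"
    unfolding K_def by (subst compactin_PiE) (auto split: prod.split)
  then have K: "compact K" by (simp add: euclidean_product_topology)
  have form_le: "cmod (cinner (A n i x) y) \<le> C i * norm x * norm y" for n i x y
  proof -
    have "cmod (cinner (A n i x) y) \<le> norm (A n i x) * norm y" by (rule cinner_Cauchy_Schwarz)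
    also have "\<dots> \<le> (norm (A n i) * norm x) * norm y" by (intro mult_right_mono norm_blinfun) simp
    also have "\<dots> \<le> (C i * norm x) * norm y" by (intro mult_right_mono bound) simp_all
    finally show ?thesis .
  qed
  then have "f n \<in> K" for n by (auto simp: f_def K_def)
  then obtain l G where G: "G \<noteq> bot" "G \<le> sequentially" "(f \<longlongrightarrow> l) G"
    using compact_cluster_filter [OF K] by metis
  have lim: "((\<lambda>n. cinner (A n i x) y) \<longlongrightarrow> l (i, x, y)) G" for i x y
  proof -
    have "((\<lambda>n. f n (i, x, y)) \<longlongrightarrow> l (i, x, y)) G"
    proof (rule topological_tendstoI)
      fix U :: "complex set" assume U: "open U" "l (i, x, y) \<in> U"
      have "open ((\<lambda>g. g (i, x, y)) -` U)"
        by (rule open_vimage [OF U(1) continuous_on_product_coordinates])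
      with topological_tendstoD [OF G(3)] U(2) show "eventually (\<lambda>n. f n (i, x, y) \<in> U) G" by fastforce
    qed
    then show ?thesis by (simp add: f_def)
  qed
  have C: "0 \<le> C i" for i using norm_ge_zero bound order_trans by blast
  have "\<exists>b. b \<in> bounded_ops \<and> (\<forall>x y. cinner (blinfun_apply b x) y = l (i, x, y))" for i
  proof -
    have add1: "l (i, x + y, z) = l (i, x, z) + l (i, y, z)" for x y z
      by (rule tendsto_unique [OF G(1) lim])
        (simp add: blinfun.add_right cinner_simps tendsto_add lim)
    have add2: "l (i, x, y + z) = l (i, x, y) + l (i, x, z)" for x y z
      by (rule tendsto_unique [OF G(1) lim]) (simp add: cinner_simps tendsto_add lim)
    have scale1: "l (i, c *\<^sub>C x, y) = c * l (i, x, y)" for c x y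
      by (rule tendsto_unique [OF G(1) lim])
        (simp add: bounded_opsD [OF A] cinner_simps tendsto_mult lim)
    have scale2: "l (i, x, c *\<^sub>C y) = cnj c * l (i, x, y)" for c x y
      by (rule tendsto_unique [OF G(1) lim]) (simp add: cinner_simps tendsto_mult lim)
    have le: "cmod (l (i, x, y)) \<le> C i * norm x * norm y" for x y
      by (rule tendsto_upperbound [OF tendsto_norm [OF lim] _ G(1)]) (simp add: form_le)
    show ?thesis
      using bounded_form_operator [of "\<lambda>x y. l (i, x, y)", OF add1 add2 scale1 scale2 le C] by metis
  qed
  then obtain B where B: "\<And>i. B i \<in> bounded_ops" "\<And>i x y. cinner (blinfun_apply (B i) x) y = l (i, x, y)"
    by metis
  show ?thesis
    by (rule that [of G B]) (simp_all add: G B weak_limit_def lim)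
qed

lemma weak_limit_unique:
  assumes "G \<noteq> bot" "weak_limit f a G" "weak_limit f b G"
  shows "a = b"
  by (rule op_eqI) (rule tendsto_unique [OF assms(1) weak_limitD [OF assms(2)] weak_limitD [OF assms(3)]])

lemma weak_limit_add: "weak_limit f a G \<Longrightarrow> weak_limit g b G \<Longrightarrow> weak_limit (\<lambda>i. f i + g i) (a + b) G"
  by (simp add: weak_limit_def blinfun.add_left cinner_simps tendsto_add)

lemma weak_limit_scale: "weak_limit f a G \<Longrightarrow> weak_limit (\<lambda>i. scale_op c (f i)) (scale_op c a) G"
  by (simp add: weak_limit_def cinner_simps tendsto_mult)

lemma weak_limit_const: "weak_limit (\<lambda>i. a) a G"
  by (simp add: weak_limit_def)

lemma weak_limit_cong:
  assumes "weak_limit f a G" "((\<lambda>n. f n - g n) \<longlongrightarrow> 0) G"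
  shows "weak_limit g a G"
  unfolding weak_limit_def
proof (intro allI)
  fix x y
  have "((\<lambda>n. (f n - g n) x) \<longlongrightarrow> (0::_ op) x) G" by (intro tendsto_intros assms)
  then have "((\<lambda>n. cinner ((f n - g n) x) y) \<longlongrightarrow> cinner ((0::_ op) x) y) G"
    by (intro cinner.tendsto tendsto_const)
  from tendsto_diff [OF weak_limitD [OF assms(1), of x y] this]
  show "((\<lambda>n. cinner (g n x) y) \<longlongrightarrow> cinner (a x) y) G"
    by (simp add: blinfun.diff_left cinner_simps)
qed

text \<open>For a fixed tuple of vectors the form is a finite sum of matrix coefficients, and the
  nonnegative reals are closed.\<close>

lemma positive_matrix_weak_limit:
  assumes G: "G \<noteq> bot" and pos: "\<And>k. positive_matrix n (\<lambda>i j. f k i j)"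
    and lim: "\<And>i j. i < n \<Longrightarrow> j < n \<Longrightarrow> weak_limit (\<lambda>k. f k i j) (a i j) G"
    and a: "\<And>i j. i < n \<Longrightarrow> j < n \<Longrightarrow> a i j \<in> bounded_ops"
  shows "positive_matrix n a"
proof -
  have "(\<Sum>i<n. \<Sum>j<n. cinner (a i j (\<xi> j)) (\<xi> i)) \<in> \<real>\<^sub>\<ge>\<^sub>0" for \<xi>
  proof (rule Lim_in_closed_set [OF closed_nonneg_Reals_complex _ G])
    show "eventually (\<lambda>k. (\<Sum>i<n. \<Sum>j<n. cinner (f k i j (\<xi> j)) (\<xi> i)) \<in> \<real>\<^sub>\<ge>\<^sub>0) G"
      using pos by (simp add: positive_matrix_def)
    show "((\<lambda>k. \<Sum>i<n. \<Sum>j<n. cinner (f k i j (\<xi> j)) (\<xi> i)) \<longlongrightarrow>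
        (\<Sum>i<n. \<Sum>j<n. cinner (a i j (\<xi> j)) (\<xi> i))) G"
      by (intro tendsto_sum weak_limitD lim) auto
  qed
  then show ?thesis using a by (simp add: positive_matrix_def)
qed

subsection \<open>Existence of a completely positive projection onto the fixed points\<close>

locale normal_ucp =
  fixes N :: "'k::chilbert_space op set" and P :: "'k op \<Rightarrow> 'k op"
  assumes N: "von_neumann_algebra N" and P: "normal_ucp_map N P"
begin

sublocale N: unital_star_algebra N id_blinfun
  by (rule von_neumann_algebra_unital_star_algebra [OF N])

lemma P_mem: "a \<in> N \<Longrightarrow> P a \<in> N"
  using P by (auto simp: normal_ucp_map_def)

sublocale P: unital_cp_map N P
  using P by unfold_locales (simp_all add: normal_ucp_map_def)

lemma funpow_mem: "a \<in> N \<Longrightarrow> (P ^^ k) a \<in> N"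
  by (induction k) (simp_all add: P_mem)

lemma funpow_completely_positive: "completely_positive_on N (P ^^ k)"
proof (induction k)
  case 0
  then show ?case by (simp add: completely_positive_on_def clinear_on_def)
next
  case (Suc k)
  have "completely_positive_on N (\<lambda>a. P ((P ^^ k) a))"
    by (rule completely_positive_on_compose [OF Suc _ P.cp]) (simp add: funpow_mem)
  then show ?case by (simp add: o_def)
qed

lemma funpow_contractive: "a \<in> N \<Longrightarrow> norm ((P ^^ k) a) \<le> norm a"
  by (induction k) (auto intro: order_trans [OF P.cp_contractive] funpow_mem)

text \<open>The averages run over \<open>n + 1\<close> powers, so the denominator never
  vanishes.\<close>

definition cesaro :: "nat \<Rightarrow> 'k op \<Rightarrow> 'k op" where
  "cesaro n a = scale_op (of_real (1 / real (Suc n))) (\<Sum>k<Suc n. (P ^^ k) a)"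

lemma cesaro_mem: "a \<in> N \<Longrightarrow> cesaro n a \<in> N"
  unfolding cesaro_def by (intro N.scale N.sum funpow_mem)

lemma cesaro_norm:
  assumes "a \<in> N" shows "norm (cesaro n a) \<le> norm a"
proof -
  have "norm (\<Sum>k<Suc n. (P ^^ k) a) \<le> (\<Sum>k<Suc n. norm a)"
    by (rule sum_norm_le) (rule funpow_contractive [OF assms])
  then have "norm (\<Sum>k<Suc n. (P ^^ k) a) \<le> Suc n * norm a" by simp
  then show ?thesis
    unfolding cesaro_def scale_op_of_real norm_scaleR
    by (simp add: pos_divide_le_eq mult.commute del: sum.lessThan_Suc)
qed

text \<open>Applying \<open>P\<close> shifts the sum by one, and all but the two end terms
  cancel.\<close>

lemma cesaro_invariance:
  assumes a: "a \<in> N" shows "norm (P (cesaro n a) - cesaro n a) \<le> 2 * norm a * inverse (Suc n)"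
proof -
  have "P (\<Sum>k<Suc n. (P ^^ k) a) = (\<Sum>k<Suc n. P ((P ^^ k) a))"
    by (rule N.clinear_on_sum [OF P.cp_clinear]) (rule funpow_mem [OF a])
  moreover have "(\<Sum>k<Suc n. (P ^^ k) a) \<in> N" by (intro N.sum funpow_mem a)
  ultimately have "P (cesaro n a) = scale_op (of_real (1 / real (Suc n))) (\<Sum>k<Suc n. (P ^^ Suc k) a)"
    using P.cp_clinear unfolding cesaro_def clinear_on_def by (simp del: sum.lessThan_Suc)
  then have "P (cesaro n a) - cesaro n a =
      (1 / real (Suc n)) *\<^sub>R ((\<Sum>k<Suc n. (P ^^ Suc k) a) - (\<Sum>k<Suc n. (P ^^ k) a))"
    unfolding cesaro_def scale_op_of_real scaleR_diff_right by simp
  also have "(\<Sum>k<Suc n. (P ^^ Suc k) a) - (\<Sum>k<Suc n. (P ^^ k) a) = (P ^^ Suc n) a - (P ^^ 0) a"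
    unfolding sum_subtractf [symmetric] by (rule sum_lessThan_telescope)
  also have "norm ((1 / real (Suc n)) *\<^sub>R ((P ^^ Suc n) a - (P ^^ 0) a)) \<le> (1 / real (Suc n)) * (norm a + norm a)"
    unfolding norm_scaleR
    by (intro mult_mono order_trans [OF norm_triangle_ineq4] add_mono funpow_contractive a) simp_all
  finally show ?thesis by (simp add: divide_inverse mult.commute)
qed

lemma cesaro_clinear: "clinear_on N (cesaro n)"
proof -
  have "clinear_on N (P ^^ k)" for k
    using funpow_completely_positive by (simp add: completely_positive_on_def)
  then show ?thesis
    unfolding clinear_on_def cesaro_def
    by (auto simp del: sum.lessThan_Suc simp: sum.distrib blinfun.add_left blinfun.sum_left
        scaleC_add_right scaleC_sum_right scaleC_scaleC mult.commute intro!: blinfun_eqI)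
qed

lemma cesaro_positive_matrix:
  assumes a: "\<forall>i<m. \<forall>j<m. a i j \<in> N" "positive_matrix m a"
  shows "positive_matrix m (\<lambda>i j. cesaro n (a i j))"
proof -
  have "(\<Sum>i<m. \<Sum>j<m. cinner (cesaro n (a i j) (\<xi> j)) (\<xi> i)) =
      of_real (1 / real (Suc n)) * (\<Sum>k<Suc n. \<Sum>i<m. \<Sum>j<m. cinner ((P ^^ k) (a i j) (\<xi> j)) (\<xi> i))" for \<xi>
  proof -
    have "(\<Sum>i<m. \<Sum>j<m. cinner (cesaro n (a i j) (\<xi> j)) (\<xi> i)) =
      (\<Sum>i<m. \<Sum>j<m. of_real (1 / real (Suc n)) * (\<Sum>k<Suc n. cinner ((P ^^ k) (a i j) (\<xi> j)) (\<xi> i)))"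
      by (simp add: cesaro_def blinfun.sum_left cinner_simps cinner.sum_left del: sum.lessThan_Suc)
    also have "\<dots> = of_real (1 / real (Suc n)) * (\<Sum>i<m. \<Sum>j<m. \<Sum>k<Suc n. cinner ((P ^^ k) (a i j) (\<xi> j)) (\<xi> i))"
      by (simp only: sum_distrib_left)
    also have "(\<Sum>i<m. \<Sum>j<m. \<Sum>k<Suc n. cinner ((P ^^ k) (a i j) (\<xi> j)) (\<xi> i)) =
        (\<Sum>i<m. \<Sum>k<Suc n. \<Sum>j<m. cinner ((P ^^ k) (a i j) (\<xi> j)) (\<xi> i))"
      by (intro sum.cong refl sum.swap)
    also have "\<dots> = (\<Sum>k<Suc n. \<Sum>i<m. \<Sum>j<m. cinner ((P ^^ k) (a i j) (\<xi> j)) (\<xi> i))"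
      by (rule sum.swap)
    finally show ?thesis .
  qed
  moreover have "(\<Sum>i<m. \<Sum>j<m. cinner ((P ^^ k) (a i j) (\<xi> j)) (\<xi> i)) \<in> \<real>\<^sub>\<ge>\<^sub>0" for k \<xi>
    using funpow_completely_positive [of k] a by (simp add: completely_positive_on_def positive_matrix_def)
  ultimately show ?thesis
    using a(1) by (simp add: positive_matrix_def N.bounded_op cesaro_mem nonneg_Reals_mult_I
        nonneg_Reals_sum nonneg_Reals_of_real_iff del: sum.lessThan_Suc of_real_divide)
qed

lemma funpow_fixed: "a \<in> fixed_points N P \<Longrightarrow> (P ^^ k) a = a"
  by (induction k) (simp_all add: fixed_points_def)

lemma cesaro_fixed:
  assumes "a \<in> fixed_points N P" shows "cesaro n a = a"
proof (rule blinfun_eqI)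
  fix x
  have "cesaro n a x = (1 / real (Suc n)) *\<^sub>R (real (Suc n) *\<^sub>R a x)"
    unfolding cesaro_def scale_op_of_real funpow_fixed [OF assms]
    by (simp add: blinfun.scaleR_left blinfun.sum_left sum_constant_scaleR del: sum.lessThan_Suc)
  then show "cesaro n a x = a x" by simp
qed

lemma cp_projection_exists: "\<exists>E. cp_projection_onto N (fixed_points N P) E"
proof -
  \<comment> \<open>The cluster point lemma ranges over all operators, so the averages are set to 0
    outside \<open>N\<close>. One filter for all \<open>a\<close> makes the limit \<open>E\<close>
    linear.\<close>
  define A where "A = (\<lambda>n a. if a \<in> N then cesaro n a else 0)"
  have 1: "A n a \<in> bounded_ops" for n a by (simp add: A_def N.bounded_op cesaro_mem)
  have 2: "norm (A n a) \<le> norm a" for n a by (simp add: A_def cesaro_norm)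
  obtain G E where G: "G \<noteq> bot" "G \<le> sequentially" and E: "\<And>a. E a \<in> bounded_ops"
    and limA: "\<And>a. weak_limit (\<lambda>n. A n a) (E a) G"
    using weak_cluster_point [of A norm, OF 1 2] by metis
  have lim: "weak_limit (\<lambda>n. cesaro n a) (E a) G" if "a \<in> N" for a
    using limA [of a] that by (simp add: A_def)
  have EN: "E a \<in> N" if a: "a \<in> N" for a
    by (rule von_neumann_algebra_weak_limit [OF N G(1) cesaro_mem [OF a] E cesaro_norm [OF a] lim [OF a]])
  \<comment> \<open>By normality \<open>P (E a)\<close> is the limit of
    \<open>P (cesaro n a)\<close>, which differs from \<open>cesaro n a\<close> by a norm-null
    term.\<close>
  have P_E: "P (E a) = E a" if a: "a \<in> N" for a
  proof (rule weak_limit_unique [OF G(1)])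
    have nP: "normal_map N N P" using P by (simp add: normal_ucp_map_def)
    show "weak_limit (\<lambda>n. P (cesaro n a)) (P (E a)) G"
      by (rule normal_map_weak_limit [OF N nP G(1) cesaro_mem [OF a] E cesaro_norm [OF a] lim [OF a]])
    show "weak_limit (\<lambda>n. P (cesaro n a)) (E a) G"
    proof (rule weak_limit_cong [OF lim [OF a]])
      have "(\<lambda>n. 2 * norm a * inverse (Suc n)) \<longlonglongrightarrow> 2 * norm a * 0"
        by (intro tendsto_intros LIMSEQ_inverse_real_of_nat)
      then have "((\<lambda>n. 2 * norm a * inverse (Suc n)) \<longlongrightarrow> 0) G"
        using G(2) by (auto intro: tendsto_mono)
      then show "((\<lambda>n. cesaro n a - P (cesaro n a)) \<longlongrightarrow> 0) G"
      proof (rule Lim_null_comparison [OF always_eventually, rotated], intro allI)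
        show "norm (cesaro n a - P (cesaro n a)) \<le> 2 * norm a * inverse (Suc n)" for n
          by (subst norm_minus_commute) (rule cesaro_invariance [OF a])
      qed
    qed
  qed
  have E_id: "E a = a" if "a \<in> fixed_points N P" for a
    using lim [of a] that
    by (auto simp: cesaro_fixed fixed_points_def intro!: weak_limit_unique [OF G(1) _ weak_limit_const])
  have E_mem: "E a \<in> fixed_points N P" if "a \<in> N" for a
    using EN P_E that by (simp add: fixed_points_def)
  have "clinear_on N E"
    unfolding clinear_on_def
  proof (intro conjI ballI allI)
    fix a b assume ab: "a \<in> N" "b \<in> N"
    have "weak_limit (\<lambda>n. cesaro n (a + b)) (E a + E b) G"
      using weak_limit_add [OF lim lim] ab cesaro_clinear by (simp add: clinear_on_def)
    then show "E (a + b) = E a + E b"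
      using weak_limit_unique [OF G(1) lim] N.add ab by blast
  next
    fix c a assume a: "a \<in> N"
    have "weak_limit (\<lambda>n. cesaro n (scale_op c a)) (scale_op c (E a)) G"
      using weak_limit_scale [OF lim] a cesaro_clinear by (simp add: clinear_on_def)
    then show "E (scale_op c a) = scale_op c (E a)"
      using weak_limit_unique [OF G(1) lim] N.scale a by blast
  qed
  moreover have "positive_matrix m (\<lambda>i j. E (a i j))"
    if a: "\<forall>i<m. \<forall>j<m. a i j \<in> N" "positive_matrix m a" for m a
    by (rule positive_matrix_weak_limit [where f = "\<lambda>n i j. cesaro n (a i j)", OF G(1) cesaro_positive_matrix [OF a]]) (use a lim E in auto)
  ultimately have "completely_positive_on N E" by (simp add: completely_positive_on_def)
  moreover have "E ` N = fixed_points N P"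
    using E_mem E_id by (force simp: fixed_points_def)
  ultimately have "cp_projection_onto N (fixed_points N P) E"
    using E_mem E_id by (simp add: cp_projection_onto_def)
  then show ?thesis by blast
qed

lemma operator_system_fixed_points: "operator_system (fixed_points N P)"
proof -
  have "P 0 = 0" using P.cp_diff [OF N.zero N.zero] by simp
  then show ?thesis
    unfolding operator_system_def op_subspace_def fixed_points_def
    using P.cp_clinear P.cp_adj P.unital N.bounded
    by (auto simp: clinear_on_def N.zero N.add N.scale N.adjoint N.unit)
qed

end

subsection \<open>Minimal dilations\<close>

locale dilation = normal_ucp N P
  for N :: "'k::chilbert_space op set" and P :: "'k op \<Rightarrow> 'k op" +
  fixes M :: "'h::chilbert_space op set" and p :: "'h op" and \<alpha> :: "'h op \<Rightarrow> 'h op"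
    and \<iota> :: "'k op \<Rightarrow> 'h op"
  assumes dilation: "minimal_dilation N P M p \<alpha> \<iota>"
begin

lemma M: "von_neumann_algebra M" and p: "p \<in> M" "is_projection p"
  and \<alpha>_mem: "a \<in> M \<Longrightarrow> \<alpha> a \<in> M" and \<alpha>_hom: "star_hom_on M (o\<^sub>L) (o\<^sub>L) \<alpha>"
  and \<alpha>_id: "\<alpha> id_blinfun = id_blinfun" and \<alpha>_normal: "normal_map M M \<alpha>"
  and \<iota>_hom: "star_hom_on N (o\<^sub>L) (o\<^sub>L) \<iota>" and \<iota>_bij: "bij_betw \<iota> N (corner p M)"
  and dilates: "b \<in> N \<Longrightarrow> n \<ge> 1 \<Longrightarrow> \<iota> ((P ^^ n) b) = p o\<^sub>L (\<alpha> ^^ n) (\<iota> b) o\<^sub>L p"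
  and generated: "M = von_neumann_generated (\<Union>n. (\<alpha> ^^ n) ` \<iota> ` N)"
  and carrier: "is_central_carrier M p id_blinfun"
  using dilation by (auto simp: minimal_dilation_def unital_normal_endomorphism_def star_isomorphism_def)

sublocale M: unital_star_algebra M id_blinfun
  by (rule von_neumann_algebra_unital_star_algebra [OF M])

sublocale C: unital_star_algebra "corner p M" p
  by (rule corner_unital_star_algebra [OF M p])

lemma corner_subset: "corner p M \<subseteq> M"
  by (auto simp: corner_eq [OF M p])

lemma compress_mem: "x \<in> M \<Longrightarrow> p o\<^sub>L x o\<^sub>L p \<in> corner p M"
  by (auto simp: corner_def)

lemma \<iota>_mem: "a \<in> N \<Longrightarrow> \<iota> a \<in> corner p M"
  using \<iota>_bij by (auto simp: bij_betw_def)

sublocale \<iota>: star_hom N id_blinfun \<iota>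
  using \<iota>_hom \<iota>_mem C.bounded by unfold_locales auto

abbreviation \<kappa> :: "'h op \<Rightarrow> 'k op" where
  "\<kappa> \<equiv> inv_into N \<iota>"

lemma \<kappa>_mem: "x \<in> corner p M \<Longrightarrow> \<kappa> x \<in> N"
  and \<iota>_\<kappa>: "x \<in> corner p M \<Longrightarrow> \<iota> (\<kappa> x) = x"
  and \<kappa>_\<iota>: "a \<in> N \<Longrightarrow> \<kappa> (\<iota> a) = a"
  using \<iota>_bij by (auto simp: bij_betw_def inv_into_into f_inv_into_f)

lemma \<iota>_inj: "a \<in> N \<Longrightarrow> b \<in> N \<Longrightarrow> \<iota> a = \<iota> b \<Longrightarrow> a = b"
  by (metis \<kappa>_\<iota>)

lemma \<kappa>_eqI: "a \<in> N \<Longrightarrow> \<iota> a = x \<Longrightarrow> \<kappa> x = a"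
  using \<kappa>_\<iota> by blast

lemma \<kappa>_hom: "star_hom_on (corner p M) (o\<^sub>L) (o\<^sub>L) \<kappa>"
  unfolding star_hom_on_def clinear_on_def
proof (intro conjI ballI allI)
  fix x assume x: "x \<in> corner p M"
  show "\<kappa> (scale_op c x) = scale_op c (\<kappa> x)" for c
    using \<iota>.hom_clinear x by (intro \<kappa>_eqI) (simp_all add: N.scale \<kappa>_mem clinear_on_def \<iota>_\<kappa>)
  show "\<kappa> (adj x) = adj (\<kappa> x)"
    using x by (intro \<kappa>_eqI) (simp_all add: N.adjoint \<kappa>_mem \<iota>.hom_adj \<iota>_\<kappa>)
  fix y assume y: "y \<in> corner p M"
  show "\<kappa> (x + y) = \<kappa> x + \<kappa> y"
    using \<iota>.hom_clinear x y by (intro \<kappa>_eqI) (simp_all add: N.add \<kappa>_mem clinear_on_def \<iota>_\<kappa>)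
  show "\<kappa> (x o\<^sub>L y) = \<kappa> x o\<^sub>L \<kappa> y"
    using x y by (intro \<kappa>_eqI) (simp_all add: N.compose \<kappa>_mem \<iota>.hom_compose \<iota>_\<kappa>)
qed

text \<open>Supplies complete positivity of the inverse identification, one of the two factors of
  \<theta>.\<close>

sublocale \<kappa>: star_hom "corner p M" p \<kappa>
  using \<kappa>_hom \<kappa>_mem N.bounded by unfold_locales auto

text \<open>\<open>p\<close> is itself in the range of \<open>\<iota>\<close>, where
  \<open>\<iota> id_blinfun\<close> acts as a unit; \<open>p\<close> is a unit there too.\<close>

lemma \<iota>_id: "\<iota> id_blinfun = p"
proof -
  have "p = \<iota> id_blinfun o\<^sub>L \<iota> (\<kappa> p)"
    using \<iota>.hom_compose [OF N.unit(1) \<kappa>_mem [OF C.unit(1)]] by (simp add: \<iota>_\<kappa> C.unit)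
  also have "\<dots> = \<iota> id_blinfun" by (simp add: \<iota>_\<kappa> C.unit C.unit_compose \<iota>_mem N.unit)
  finally show ?thesis by simp
qed

lemma funpow_\<alpha>_mem: "a \<in> M \<Longrightarrow> (\<alpha> ^^ n) a \<in> M"
  by (induction n) (simp_all add: \<alpha>_mem)

lemma funpow_\<alpha>_hom: "star_hom_on M (o\<^sub>L) (o\<^sub>L) (\<alpha> ^^ n)"
proof (induction n)
  case (Suc n)
  then show ?case
    using \<alpha>_hom funpow_\<alpha>_mem [of _ n] by (simp add: star_hom_on_def clinear_on_def)
qed (simp add: star_hom_on_def clinear_on_def)

lemma funpow_\<alpha>_id: "(\<alpha> ^^ n) id_blinfun = id_blinfun"
  by (induction n) (simp_all add: \<alpha>_id)

sublocale \<alpha>: star_hom M id_blinfun "\<alpha> ^^ n" for n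
  using funpow_\<alpha>_hom funpow_\<alpha>_mem M.bounded by unfold_locales auto

text \<open>Provides the bound \<open>norm ((\<alpha> ^^ n) a) \<le> norm a\<close> that the cluster
  point argument requires.\<close>

sublocale \<alpha>: unital_cp_map M "\<alpha> ^^ n" for n
  by unfold_locales (simp_all add: \<alpha>.completely_positive funpow_\<alpha>_id)

lemma \<alpha>_compose: "a \<in> M \<Longrightarrow> b \<in> M \<Longrightarrow> \<alpha> (a o\<^sub>L b) = \<alpha> a o\<^sub>L \<alpha> b"
  using \<alpha>_hom by (simp add: star_hom_on_def)

section \<open>The increasing projections and their convergence\<close>

definition q :: "nat \<Rightarrow> 'h op" where
  "q n = (\<alpha> ^^ n) p"

lemma q_0: "q 0 = p" and q_Suc: "q (Suc n) = \<alpha> (q n)" and q_mem: "q n \<in> M"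
  by (simp_all add: q_def funpow_\<alpha>_mem p)

lemma q_projection: "is_projection (q n)"
  using \<alpha>.hom_compose [OF p(1) p(1), of n] \<alpha>.hom_adj [OF p(1), of n] is_projectionD(2,3) [OF p(2)]
    M.bounded_op [OF q_mem [of n]]
  by (simp add: is_projection_def q_def)

text \<open>The case \<open>n = 1\<close>, \<open>a = 1\<close> of the dilation property says \<open>p \<alpha>(p) p = p\<close>, that is, \<open>p \<le> \<alpha>(p)\<close>.\<close>

lemma \<alpha>_p_p: "\<alpha> p o\<^sub>L p = p"
proof (rule blinfun_eqI)
  fix x
  have *: "p o\<^sub>L \<alpha> p o\<^sub>L p = p"
    using dilates [OF N.unit(1), of 1] P.unital by (simp add: \<iota>_id)
  note r = is_projectionD [OF q_projection [of "Suc 0", unfolded q_Suc q_0]]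
    and pD = is_projectionD [OF p(2)]
  have "cinner (p x - \<alpha> p (p x)) (p x) = cinner (p (p x - \<alpha> p (p x))) x"
    by (simp only: pD(5))
  also have "p (p x - \<alpha> p (p x)) = p x - (p o\<^sub>L \<alpha> p o\<^sub>L p) x"
    by (simp add: blinfun.diff_right pD(4))
  also have "\<dots> = 0" by (simp add: * )
  finally have "(norm (p x - \<alpha> p (p x)))\<^sup>2 = 0"
    using projection_complement_square [OF q_projection [of "Suc 0", unfolded q_Suc q_0], of "p x"] by simp
  then show "(\<alpha> p o\<^sub>L p) x = p x" by simp
qed

text \<open>Each step is the image of \<open>\<alpha> p o\<^sub>L p = p\<close> under a power of
  \<alpha>; the other order of the factors follows by taking adjoints.\<close>

lemma q_increasing: assumes "n \<le> m" shows "q m o\<^sub>L q n = q n" "q n o\<^sub>L q m = q n"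
proof -
  have step: "q (Suc n) o\<^sub>L q n = q n" for n
    using \<alpha>.hom_compose [OF \<alpha>_mem [OF p(1)] p(1), of n] by (simp add: \<alpha>_p_p q_def funpow_swap1)
  show 1: "q m o\<^sub>L q n = q n" using assms
  proof (induction m rule: dec_induct)
    case base
    show ?case by (rule is_projectionD(2) [OF q_projection])
  next
    case (step m)
    then have "q (Suc m) o\<^sub>L q n = (q (Suc m) o\<^sub>L q m) o\<^sub>L q n" by (simp add: blinfun_compose_assoc)
    then show ?case using step \<open>\<And>n. q (Suc n) o\<^sub>L q n = q n\<close> by simp
  qed
  show "q n o\<^sub>L q m = q n"
    using arg_cong [OF 1, of adj] adj_compose [OF is_projectionD(1) is_projectionD(1), OF q_projection q_projection, of m n]
    by (simp add: is_projectionD(3) [OF q_projection])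
qed

text \<open>The dilation property for the exponent \<open>m - n\<close>, pushed forward by
  \<open>\<alpha> ^^ n\<close>. If \<open>P a = a\<close>, the right-hand side no longer depends on
  \<open>m\<close>; if \<open>m = n\<close>, it places \<open>(\<alpha> ^^ n) (\<iota> a)\<close>
  under \<open>q n\<close>.\<close>

lemma compress_orbit:
  assumes a: "a \<in> N" and "n \<le> m"
  shows "q n o\<^sub>L (\<alpha> ^^ m) (\<iota> a) o\<^sub>L q n = (\<alpha> ^^ n) (\<iota> ((P ^^ (m - n)) a))"
proof -
  have \<iota>M: "\<iota> a \<in> M" if "a \<in> N" for a using \<iota>_mem that corner_subset by blast
  have "\<iota> ((P ^^ k) a) = p o\<^sub>L (\<alpha> ^^ k) (\<iota> a) o\<^sub>L p" for k
  proof (cases k)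
    \<comment> \<open>The dilation property starts at exponent 1; exponent 0 holds because
      \<open>\<iota> a\<close> lies in the corner.\<close>
    case 0
    then show ?thesis using C.unit_compose [OF \<iota>_mem [OF a]] by simp
  next
    case (Suc j)
    then show ?thesis using dilates [OF a, of k] by simp
  qed
  then have "(\<alpha> ^^ n) (\<iota> ((P ^^ (m - n)) a)) = (\<alpha> ^^ n) (p o\<^sub>L (\<alpha> ^^ (m - n)) (\<iota> a) o\<^sub>L p)" by simp
  also have "\<dots> = q n o\<^sub>L (\<alpha> ^^ n) ((\<alpha> ^^ (m - n)) (\<iota> a)) o\<^sub>L q n"
    by (simp add: \<alpha>.hom_compose M.compose p funpow_\<alpha>_mem \<iota>M a q_def)
  also have "(\<alpha> ^^ n) ((\<alpha> ^^ (m - n)) (\<iota> a)) = (\<alpha> ^^ m) (\<iota> a)"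
    using funpow_add [of n "m - n" \<alpha>] assms(2) by simp
  finally show ?thesis by simp
qed

text \<open>A weak cluster point of \<open>\<alpha>\<^sup>n(p)\<close> is a projection that acts as a unit on the generators of \<open>M\<close>.
  It is therefore central and dominates \<open>p\<close>, so it is the identity.\<close>

lemma q_strongly_to_id:
  obtains G where "G \<noteq> bot" "G \<le> sequentially" "\<And>x. ((\<lambda>n. q n x) \<longlongrightarrow> x) G"
proof -
  have qB: "q n \<in> bounded_ops" for n by (rule is_projectionD(1) [OF q_projection])
  have q1: "norm (q n) \<le> 1" for n
    by (rule norm_blinfun_bound) (simp_all add: projection_norm_le [OF q_projection])
  obtain G and B :: "unit \<Rightarrow> 'h op" where G: "G \<noteq> bot" "G \<le> sequentially" and B: "\<And>i. B i \<in> bounded_ops"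
    and limB: "\<And>i. weak_limit q (B i) G"
    using weak_cluster_point [of "\<lambda>n i. q n" "\<lambda>i::unit. 1"] qB q1 by metis
  define b where "b = B ()"
  have b: "b \<in> bounded_ops" and lim: "weak_limit q b G" using B limB by (simp_all add: b_def)
  have bM: "b \<in> M" by (rule von_neumann_algebra_weak_limit [OF M G(1) q_mem b q1 lim])
  have b_q: "b o\<^sub>L q n = q n" for n
  proof (rule op_eqI)
    fix x y
    have "eventually (\<lambda>m. n \<le> m) G" using G(2) eventually_ge_at_top [of n] by (rule filter_leD)
    then have "eventually (\<lambda>m. cinner (q m (q n x)) y = cinner (q n x) y) G"
    proof eventually_elim
      case (elim m)
      have "q m (q n x) = (q m o\<^sub>L q n) x" by simp
      then show ?case by (simp only: q_increasing(1) [OF elim])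
    qed
    then have "((\<lambda>m. cinner (q m (q n x)) y) \<longlongrightarrow> cinner (q n x) y) G" by (rule tendsto_eventually)
    with weak_limitD [OF lim] have "cinner (b (q n x)) y = cinner (q n x) y" by (rule tendsto_unique [OF G(1)])
    then show "cinner ((b o\<^sub>L q n) x) y = cinner (q n x) y" by simp
  qed
  have b_move: "cinner (b x) y = cinner x (b y)" for x y
  proof (rule tendsto_unique [OF G(1) weak_limitD [OF lim]])
    have "cinner (q n x) y = cnj (cinner (q n y) x)" for n
      unfolding is_projectionD(5) [OF q_projection, of n x y] by (rule cinner_commute)
    moreover have "cinner x (b y) = cnj (cinner (b y) x)" by (rule cinner_commute)
    ultimately show "((\<lambda>n. cinner (q n x) y) \<longlongrightarrow> cinner x (b y)) G"
      using tendsto_cnj [OF weak_limitD [OF lim, of y x]] by simp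
  qed
  have adj_b: "adj b = b" by (rule adj_unique [OF b b_move])
  \<comment> \<open>A weak limit of projections need not be a projection. Here
    \<open>b o\<^sub>L q n = q n\<close> allows \<open>b\<close> to be inserted before the limit is
    taken.\<close>
  have "b o\<^sub>L b = b"
  proof (rule op_eqI)
    fix x y
    have "cinner (q n x) (b y) = cinner (q n x) y" for n
      using arg_cong [OF b_q [of n], of "\<lambda>a. cinner (a x) y"] by (simp add: b_move)
    then have "((\<lambda>n. cinner (q n x) y) \<longlongrightarrow> cinner (b x) (b y)) G"
      using weak_limitD [OF lim, of x "b y"] by simp
    then have "cinner (b x) (b y) = cinner (b x) y" by (rule tendsto_unique [OF G(1) _ weak_limitD [OF lim]])
    then show "cinner ((b o\<^sub>L b) x) y = cinner (b x) y" by (simp add: b_move)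
  qed
  with adj_b b have proj: "is_projection b" by (simp add: is_projection_def)
  have q_b: "q n o\<^sub>L b = q n" for n
    using arg_cong [OF b_q, of adj n] by (simp add: adj_compose b qB adj_b is_projectionD(3) [OF q_projection])
  have "(\<Union>n. (\<alpha> ^^ n) ` \<iota> ` N) \<subseteq> {a \<in> bounded_ops. b o\<^sub>L a = a o\<^sub>L b}"
  proof clarify
    fix n a assume a: "a \<in> N"
    let ?y = "(\<alpha> ^^ n) (\<iota> a)"
    have y: "q n o\<^sub>L ?y o\<^sub>L q n = ?y" using compress_orbit [OF a, of n n] by simp
    have "b o\<^sub>L (q n o\<^sub>L ?y o\<^sub>L q n) = q n o\<^sub>L ?y o\<^sub>L q n"
      by (simp only: blinfun_compose_assoc [symmetric] b_q)
    moreover have "(q n o\<^sub>L ?y o\<^sub>L q n) o\<^sub>L b = q n o\<^sub>L ?y o\<^sub>L q n"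
      by (simp only: blinfun_compose_assoc q_b)
    moreover have "?y \<in> bounded_ops"
      using funpow_\<alpha>_mem \<iota>_mem [OF a] corner_subset M.bounded by blast
    ultimately show "?y \<in> bounded_ops \<and> b o\<^sub>L ?y = ?y o\<^sub>L b" by (simp add: y)
  qed
  then have "M \<subseteq> {a \<in> bounded_ops. b o\<^sub>L a = a o\<^sub>L b}"
    using von_neumann_algebra_commutant [OF b adj_b] unfolding generated von_neumann_generated_def by blast
  then have "b \<in> center M" using bM by (auto simp: center_def)
  moreover have "op_le p b"
  proof -
    have pb: "p (b x) = p x" for x using arg_cong [OF q_b [of 0], of "\<lambda>a. a x"] by (simp add: q_0)
    have "norm (p x) \<le> norm (b x)" for x using projection_norm_le [OF p(2), of "b x"] by (simp add: pb)
    then have "(norm (p x))\<^sup>2 \<le> (norm (b x))\<^sup>2" for x by (simp add: power_mono)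
    then show ?thesis
      unfolding op_le_def positive_op_def using b M.bounded_op [OF p(1)]
      by (simp add: bounded_ops_diff blinfun.diff_left cinner_simps is_projectionD(6) [OF proj]
          is_projectionD(6) [OF p(2)] complex_nonneg_Reals_iff del: of_real_power)
  qed
  ultimately have "positive_op (b - id_blinfun)"
    using carrier proj by (auto simp: is_central_carrier_def op_le_def)
  have b_id: "b x = x" for x
  proof -
    have "0 \<le> Re (cinner (b x - x) x)"
      using positive_opD(2) [OF \<open>positive_op (b - id_blinfun)\<close>, of x] by (simp add: blinfun.diff_left)
    moreover have "Re (cinner (x - b x) x) = (norm (x - b x))\<^sup>2"
      by (simp add: projection_complement_square [OF proj] del: of_real_power)
    moreover have "Re (cinner (x - b x) x) = - Re (cinner (b x - x) x)" by (simp add: cinner_simps)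
    ultimately have "(norm (x - b x))\<^sup>2 \<le> 0" by linarith
    then show ?thesis by simp
  qed
  \<comment> \<open>For projections weak convergence to the identity is strong:
    \<open>(norm (x - q n x))\<^sup>2\<close> is the difference of two quadratic forms.\<close>
  have "((\<lambda>n. q n x) \<longlongrightarrow> x) G" for x
  proof -
    have "((\<lambda>n. cinner x x - cinner (q n x) x) \<longlongrightarrow> cinner x x - cinner x x) G"
      using weak_limitD [OF lim, of x x] by (intro tendsto_diff tendsto_const) (simp add: b_id)
    moreover have "(norm (x - q n x))\<^sup>2 = Re (cinner x x - cinner (q n x) x)" for n
      using projection_complement_square [OF q_projection, of x n] by (simp add: cinner_simps flip: of_real_power)
    ultimately have "((\<lambda>n. (norm (x - q n x))\<^sup>2) \<longlongrightarrow> 0) G"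
      using tendsto_Re by fastforce
    then have "((\<lambda>n. sqrt ((norm (x - q n x))\<^sup>2)) \<longlongrightarrow> sqrt 0) G" by (rule tendsto_real_sqrt)
    then have "((\<lambda>n. norm (q n x - x)) \<longlongrightarrow> 0) G" by (simp add: norm_minus_commute)
    then show ?thesis using Lim_null tendsto_norm_zero_iff by blast
  qed
  with G show ?thesis by (rule that)
qed

text \<open>Strong convergence is essential here, since both vectors in the inner product move with
  \<open>n\<close>.\<close>

lemma compressions_weak_limit:
  assumes "\<And>x. ((\<lambda>n. q n x) \<longlongrightarrow> x) G"
  shows "weak_limit (\<lambda>n. q n o\<^sub>L a o\<^sub>L q n) a G"
proof -
  have "((\<lambda>n. cinner (a (q n x)) (q n y)) \<longlongrightarrow> cinner (a x) y) G" for x y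
    by (intro cinner.tendsto bounded_linear.tendsto [OF blinfun.bounded_linear_right] assms)
  moreover have "cinner (q n (a (q n x))) y = cinner (a (q n x)) (q n y)" for n x y
    by (rule is_projectionD(5) [OF q_projection])
  ultimately show ?thesis by (simp add: weak_limit_def)
qed

text \<open>Both operators are the weak limit of the same compressions. The hypothesis starts at
  \<open>Suc n\<close> because \<alpha> carries a compression by \<open>q n\<close> to one by
  \<open>q (Suc n)\<close>; the index 0 is invisible along the filter.\<close>

lemma compressions_determine:
  assumes "\<And>n. q (Suc n) o\<^sub>L a o\<^sub>L q (Suc n) = q (Suc n) o\<^sub>L b o\<^sub>L q (Suc n)"
  shows "a = b"
proof -
  obtain G where G: "G \<noteq> bot" "G \<le> sequentially" "\<And>x. ((\<lambda>n. q n x) \<longlongrightarrow> x) G"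
    by (rule q_strongly_to_id, rule that)
  have "eventually (\<lambda>n. 1 \<le> n) G" using G(2) eventually_ge_at_top [of 1] by (rule filter_leD)
  then have "eventually (\<lambda>n. q n o\<^sub>L b o\<^sub>L q n = q n o\<^sub>L a o\<^sub>L q n) G"
    by eventually_elim (metis assms Suc_pred less_eq_Suc_le One_nat_def)
  then have "weak_limit (\<lambda>n. q n o\<^sub>L a o\<^sub>L q n) b G"
    unfolding weak_limit_def
  proof (intro allI)
    fix x y
    assume "eventually (\<lambda>n. q n o\<^sub>L b o\<^sub>L q n = q n o\<^sub>L a o\<^sub>L q n) G"
    then have "eventually (\<lambda>n. cinner ((q n o\<^sub>L b o\<^sub>L q n) x) y = cinner ((q n o\<^sub>L a o\<^sub>L q n) x) y) G"
      by (rule eventually_mono) (rule arg_cong)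
    with weak_limitD [OF compressions_weak_limit [OF G(3)]]
    show "((\<lambda>n. cinner ((q n o\<^sub>L a o\<^sub>L q n) x) y) \<longlongrightarrow> cinner (b x) y) G"
      by (rule Lim_transform_eventually)
  qed
  then show ?thesis by (rule weak_limit_unique [OF G(1) compressions_weak_limit [OF G(3)]])
qed

section \<open>The compression of fixed points and its inverse\<close>

abbreviation F :: "'h op set" where
  "F \<equiv> fixed_points M \<alpha>"

abbreviation H :: "'k op set" where
  "H \<equiv> fixed_points N P"

abbreviation \<theta> :: "'h op \<Rightarrow> 'k op" where
  "\<theta> \<equiv> compression N \<iota> p"

lemma F_mem: "x \<in> F \<Longrightarrow> x \<in> M"
  by (simp add: fixed_points_def)

lemma H_mem: "x \<in> H \<Longrightarrow> x \<in> N"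
  by (simp add: fixed_points_def)

lemma F: "von_neumann_algebra F"
  by (rule von_neumann_algebra_fixed_points [OF M \<alpha>_normal \<alpha>_hom \<alpha>_id])

sublocale F: unital_star_algebra F id_blinfun
  by (rule von_neumann_algebra_unital_star_algebra [OF F])

lemma funpow_compress:
  assumes "x \<in> F" shows "(\<alpha> ^^ n) (p o\<^sub>L x o\<^sub>L p) = q n o\<^sub>L x o\<^sub>L q n"
proof -
  have "(\<alpha> ^^ n) x = x" using assms by (induction n) (simp_all add: fixed_points_def)
  then show ?thesis by (simp add: \<alpha>.hom_compose M.compose p F_mem assms q_def)
qed

lemma \<iota>_\<theta>: "x \<in> M \<Longrightarrow> \<iota> (\<theta> x) = p o\<^sub>L x o\<^sub>L p"
  by (simp add: compression_def \<iota>_\<kappa> compress_mem)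

lemma \<theta>_mem_N: "x \<in> M \<Longrightarrow> \<theta> x \<in> N"
  by (simp add: compression_def \<kappa>_mem compress_mem)

text \<open>\<alpha> carries the compression of \<open>x\<close> by \<open>p\<close> to that by
  \<open>q 1\<close>, and compressing again by \<open>p\<close> absorbs \<open>q 1\<close> because
  \<open>p\<close> lies below it.\<close>

lemma \<theta>_mem: assumes x: "x \<in> F" shows "\<theta> x \<in> H"
proof -
  have "\<iota> (P (\<theta> x)) = p o\<^sub>L \<alpha> (p o\<^sub>L x o\<^sub>L p) o\<^sub>L p"
    using dilates [OF \<theta>_mem_N [OF F_mem [OF x]], of 1] by (simp add: \<iota>_\<theta> F_mem x)
  also have "\<alpha> (p o\<^sub>L x o\<^sub>L p) = q 1 o\<^sub>L x o\<^sub>L q 1"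
    using funpow_compress [OF x, of 1] by simp
  also have "p o\<^sub>L (q 1 o\<^sub>L x o\<^sub>L q 1) o\<^sub>L p = (q 0 o\<^sub>L q 1) o\<^sub>L x o\<^sub>L (q 1 o\<^sub>L q 0)"
    by (simp only: q_0 blinfun_compose_assoc)
  also have "\<dots> = \<iota> (\<theta> x)"
    using q_increasing [of 0 1] by (simp add: q_0 \<iota>_\<theta> F_mem x)
  finally have "P (\<theta> x) = \<theta> x"
    by (rule \<iota>_inj [OF P_mem [OF \<theta>_mem_N [OF F_mem [OF x]]] \<theta>_mem_N [OF F_mem [OF x]]])
  then show ?thesis using \<theta>_mem_N [OF F_mem [OF x]] by (simp add: fixed_points_def)
qed

lemma compress_clinear: "clinear_on M (\<lambda>x. p o\<^sub>L x o\<^sub>L p)"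
proof -
  have "p o\<^sub>L scale_op c x o\<^sub>L p = scale_op c (p o\<^sub>L x o\<^sub>L p)" if "x \<in> M" for c x
    using that p(1) M.bounded_op by (simp add: scale_op_compose bounded_ops_compose)
  then show ?thesis
    by (simp add: clinear_on_def blinfun_compose_add_left blinfun_compose_add_right)
qed

lemma compress_completely_positive: "completely_positive_on M (\<lambda>x. p o\<^sub>L x o\<^sub>L p)"
  unfolding completely_positive_on_def
proof (intro conjI allI impI compress_clinear)
  fix n a assume a: "(\<forall>i<n. \<forall>j<n. a i j \<in> M) \<and> positive_matrix n a"
  have "(\<Sum>i<n. \<Sum>j<n. cinner ((p o\<^sub>L a i j o\<^sub>L p) (\<xi> j)) (\<xi> i)) =
      (\<Sum>i<n. \<Sum>j<n. cinner (a i j (p (\<xi> j))) (p (\<xi> i)))" for \<xi>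
    by (simp add: is_projectionD(5) [OF p(2)])
  then show "positive_matrix n (\<lambda>i j. p o\<^sub>L a i j o\<^sub>L p)"
    using a p(1) by (simp add: positive_matrix_def M.bounded_op M.compose)
qed

lemma \<theta>_completely_positive: "completely_positive_on F \<theta>"
proof -
  have "completely_positive_on M (\<lambda>x. \<kappa> (p o\<^sub>L x o\<^sub>L p))"
    by (rule completely_positive_on_compose [OF compress_completely_positive _ \<kappa>.completely_positive])
      (simp add: compress_mem)
  then have "completely_positive_on M \<theta>" by (simp add: compression_def [abs_def])
  then show ?thesis
    using F_mem unfolding completely_positive_on_def clinear_on_def by blast
qed

lemma \<theta>_clinear: "clinear_on F \<theta>"
  using \<theta>_completely_positive by (simp add: completely_positive_on_def)

lemma \<theta>_adj: assumes "x \<in> F" shows "\<theta> (adj x) = adj (\<theta> x)"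
proof -
  have xM: "x \<in> M" using assms by (rule F_mem)
  have "adj (p o\<^sub>L x o\<^sub>L p) = p o\<^sub>L adj x o\<^sub>L p"
    using xM p M.bounded_op
    by (simp add: adj_compose bounded_ops_compose is_projectionD(3) [OF p(2)] blinfun_compose_assoc)
  then show ?thesis using \<kappa>.hom_adj [OF compress_mem [OF xM]] by (simp add: compression_def)
qed

lemma \<theta>_id: "\<theta> id_blinfun = id_blinfun"
  by (simp add: compression_def is_projectionD(2) [OF p(2)] \<kappa>_eqI [OF N.unit(1) \<iota>_id])

lemma \<theta>_inj: "inj_on \<theta> F"
proof (rule inj_onI)
  fix x y assume xy: "x \<in> F" "y \<in> F" "\<theta> x = \<theta> y"
  have "p o\<^sub>L x o\<^sub>L p = p o\<^sub>L y o\<^sub>L p"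
    using arg_cong [OF xy(3), of \<iota>] by (simp only: \<iota>_\<theta> F_mem [OF xy(1)] F_mem [OF xy(2)])
  then have "q n o\<^sub>L x o\<^sub>L q n = q n o\<^sub>L y o\<^sub>L q n" for n
    using funpow_compress xy by metis
  then show "x = y" by (rule compressions_determine)
qed

lemma \<theta>_surj: assumes a: "a \<in> H" obtains x where "x \<in> F" "\<theta> x = a"
proof -
  have aN: "a \<in> N" using a by (rule H_mem)
  define y where "y = (\<lambda>n. (\<alpha> ^^ n) (\<iota> a))"
  have \<iota>a: "\<iota> a \<in> M" using \<iota>_mem [OF aN] corner_subset by blast
  have yM: "y n \<in> M" for n by (simp add: y_def funpow_\<alpha>_mem \<iota>a)
  have y_norm: "norm (y n) \<le> norm (\<iota> a)" for n unfolding y_def by (rule \<alpha>.cp_contractive [OF \<iota>a])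
  obtain G and X :: "unit \<Rightarrow> 'h op" where G: "G \<noteq> bot" "G \<le> sequentially" and X: "\<And>i. X i \<in> bounded_ops"
    and limX: "\<And>i. weak_limit y (X i) G"
    using weak_cluster_point [of "\<lambda>n i. y n" "\<lambda>i::unit. norm (\<iota> a)"] M.bounded_op [OF yM] y_norm by metis
  define x where "x = X ()"
  have x: "x \<in> bounded_ops" and lim: "weak_limit y x G" using X limX by (simp_all add: x_def)
  have xM: "x \<in> M" by (rule von_neumann_algebra_weak_limit [OF M G(1) yM x y_norm lim])
  \<comment> \<open>For fixed \<open>n\<close> the compression of \<open>y m\<close> by
    \<open>q n\<close> is constant in \<open>m \<ge> n\<close>, so it passes unchanged to the
    cluster point. At \<open>n = 0\<close> this identifies the compression of \<open>x\<close> by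
    \<open>p\<close> with \<open>\<iota> a\<close>.\<close>
  have compress: "q n o\<^sub>L x o\<^sub>L q n = y n" for n
  proof (rule op_eqI)
    fix \<xi> \<eta>
    have "((\<lambda>m. cinner (y m (q n \<xi>)) (q n \<eta>)) \<longlongrightarrow> cinner (x (q n \<xi>)) (q n \<eta>)) G"
      by (rule weak_limitD [OF lim])
    moreover have "eventually (\<lambda>m. n \<le> m) G" using G(2) eventually_ge_at_top [of n] by (rule filter_leD)
    then have "eventually (\<lambda>m. cinner (y m (q n \<xi>)) (q n \<eta>) = cinner (y n \<xi>) \<eta>) G"
    proof eventually_elim
      case (elim m)
      have "q n o\<^sub>L y m o\<^sub>L q n = y n"
        using compress_orbit [OF aN elim] by (simp add: y_def funpow_fixed [OF a])
      then have "cinner ((q n o\<^sub>L y m o\<^sub>L q n) \<xi>) \<eta> = cinner (y n \<xi>) \<eta>" by simp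
      then show ?case by (simp add: is_projectionD(5) [OF q_projection])
    qed
    then have "((\<lambda>m. cinner (y m (q n \<xi>)) (q n \<eta>)) \<longlongrightarrow> cinner (y n \<xi>) \<eta>) G" by (rule tendsto_eventually)
    ultimately have "cinner (x (q n \<xi>)) (q n \<eta>) = cinner (y n \<xi>) \<eta>" by (rule tendsto_unique [OF G(1)])
    then show "cinner ((q n o\<^sub>L x o\<^sub>L q n) \<xi>) \<eta> = cinner (y n \<xi>) \<eta>"
      by (simp add: is_projectionD(5) [OF q_projection])
  qed
  \<comment> \<open>Applying \<alpha> to \<open>q n o\<^sub>L x o\<^sub>L q n = y n\<close> gives
    \<open>y (Suc n)\<close>, which is also the compression of \<open>x\<close> by
    \<open>q (Suc n)\<close>.\<close>
  have "\<alpha> x = x"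
  proof (rule compressions_determine)
    fix n
    have "q (Suc n) o\<^sub>L \<alpha> x o\<^sub>L q (Suc n) = \<alpha> (q n o\<^sub>L x o\<^sub>L q n)"
      by (simp add: q_Suc \<alpha>_compose M.compose q_mem xM)
    then show "q (Suc n) o\<^sub>L \<alpha> x o\<^sub>L q (Suc n) = q (Suc n) o\<^sub>L x o\<^sub>L q (Suc n)"
      by (simp add: compress y_def)
  qed
  with xM have "x \<in> F" by (simp add: fixed_points_def)
  moreover have "\<theta> x = a"
    using compress [of 0] by (simp add: compression_def q_0 y_def \<kappa>_\<iota> aN)
  ultimately show ?thesis by (rule that)
qed

lemma \<theta>_bij: "bij_betw \<theta> F H"
  unfolding bij_betw_def
proof (intro conjI \<theta>_inj equalityI subsetI)
  show "a \<in> \<theta> ` F" if "a \<in> H" for a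
    using \<theta>_surj [OF that] by blast
qed (use \<theta>_mem in blast)

abbreviation \<Phi> :: "'k op \<Rightarrow> 'h op" where
  "\<Phi> \<equiv> inv_into F \<theta>"

lemma \<Phi>_mem: "a \<in> H \<Longrightarrow> \<Phi> a \<in> F" and \<theta>_\<Phi>: "a \<in> H \<Longrightarrow> \<theta> (\<Phi> a) = a"
  and \<Phi>_\<theta>: "x \<in> F \<Longrightarrow> \<Phi> (\<theta> x) = x"
  using \<theta>_bij by (auto simp: bij_betw_def inv_into_into f_inv_into_f)

lemma \<Phi>_clinear: "clinear_on H \<Phi>"
  unfolding clinear_on_def
proof (intro conjI ballI allI)
  fix a b assume ab: "a \<in> H" "b \<in> H"
  then have "a + b = \<theta> (\<Phi> a + \<Phi> b)"
    using \<theta>_clinear by (simp add: clinear_on_def \<Phi>_mem \<theta>_\<Phi>)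
  then show "\<Phi> (a + b) = \<Phi> a + \<Phi> b" using ab by (simp add: \<Phi>_\<theta> F.add \<Phi>_mem)
next
  fix c a assume a: "a \<in> H"
  then have "scale_op c a = \<theta> (scale_op c (\<Phi> a))"
    using \<theta>_clinear by (simp add: clinear_on_def \<Phi>_mem \<theta>_\<Phi>)
  then show "\<Phi> (scale_op c a) = scale_op c (\<Phi> a)" using a by (simp add: \<Phi>_\<theta> F.scale \<Phi>_mem)
qed

text \<open>\<open>\<theta>\<^sup>-\<^sup>1(a)\<close> is the weak limit of \<open>\<alpha>\<^sup>n(a)\<close>.\<close>

lemma \<Phi>_completely_positive: "completely_positive_on H \<Phi>"
  unfolding completely_positive_on_def
proof (intro conjI allI impI \<Phi>_clinear)
  fix n a assume a: "(\<forall>i<n. \<forall>j<n. a i j \<in> H) \<and> positive_matrix n a"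
  obtain G where G: "G \<noteq> bot" "G \<le> sequentially" "\<And>x. ((\<lambda>n. q n x) \<longlongrightarrow> x) G"
    by (rule q_strongly_to_id, rule that)
  show "positive_matrix n (\<lambda>i j. \<Phi> (a i j))"
  proof (rule positive_matrix_weak_limit [OF G(1)])
    fix k
    have 1: "positive_matrix n (\<lambda>i j. \<iota> (a i j))"
      using \<iota>.completely_positive a H_mem by (simp add: completely_positive_on_def)
    have 2: "\<forall>i<n. \<forall>j<n. \<iota> (a i j) \<in> M"
      using a H_mem \<iota>_mem corner_subset by blast
    show "positive_matrix n (\<lambda>i j. (\<alpha> ^^ k) (\<iota> (a i j)))"
      using \<alpha>.cp [of k] 1 2 by (simp add: completely_positive_on_def)
  next
    fix i j assume ij: "i < n" "j < n"
    then have aH: "a i j \<in> H" using a by blast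
    show "\<Phi> (a i j) \<in> bounded_ops" using \<Phi>_mem [OF aH] F.bounded by blast
    have "p o\<^sub>L \<Phi> (a i j) o\<^sub>L p = \<iota> (a i j)"
      using \<iota>_\<theta> [of "\<Phi> (a i j)"] by (simp add: \<theta>_\<Phi> aH F_mem \<Phi>_mem)
    then have "(\<alpha> ^^ k) (\<iota> (a i j)) = q k o\<^sub>L \<Phi> (a i j) o\<^sub>L q k" for k
      using funpow_compress [OF \<Phi>_mem [OF aH], of k] by simp
    then show "weak_limit (\<lambda>k. (\<alpha> ^^ k) (\<iota> (a i j))) (\<Phi> (a i j)) G"
      using compressions_weak_limit [OF G(3)] by simp
  qed
qed

lemma cp_order_isomorphism: "cp_order_isomorphism F H \<theta>"
proof -
  have "operator_system F"
    using F by (simp add: operator_system_def von_neumann_algebra_def)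
  then show ?thesis
    using operator_system_fixed_points \<theta>_bij \<theta>_completely_positive \<Phi>_completely_positive
    by (simp add: cp_order_isomorphism_def)
qed

subsection \<open>The Choi-Effros product\<close>

text \<open>Inside the corner the difference has the form \<open>norm (x (p \<xi>))\<close> squared
  minus \<open>norm (p (x (p \<xi>)))\<close> squared; positivity of the homomorphism \<kappa>
  carries it over to \<open>N\<close>.\<close>

lemma \<theta>_Schwarz:
  assumes x: "x \<in> F" shows "positive_op (\<theta> (adj x o\<^sub>L x) - (adj (\<theta> x) o\<^sub>L \<theta> x))"
proof -
  have xM: "x \<in> M" and xB: "x \<in> bounded_ops" using x F_mem F.bounded_op by auto
  have pB: "p \<in> bounded_ops" using p(2) by (rule is_projectionD(1))
  have c1: "p o\<^sub>L (adj x o\<^sub>L x) o\<^sub>L p \<in> corner p M" and c2: "p o\<^sub>L x o\<^sub>L p \<in> corner p M"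
    by (intro compress_mem M.compose M.adjoint xM)+
  let ?y = "(p o\<^sub>L (adj x o\<^sub>L x) o\<^sub>L p) - (adj (p o\<^sub>L x o\<^sub>L p) o\<^sub>L (p o\<^sub>L x o\<^sub>L p))"
  have yC: "?y \<in> corner p M" by (intro C.diff c1 C.compose C.adjoint c2)
  have "cinner (?y \<xi>) \<xi> \<in> \<real>\<^sub>\<ge>\<^sub>0" for \<xi>
  proof -
    have "cinner (?y \<xi>) \<xi> = cinner (x (p \<xi>)) (x (p \<xi>)) - cinner (p (x (p \<xi>))) (p (x (p \<xi>)))"
      using is_projectionD(4,5) [OF p(2)] xB pB
      by (simp add: blinfun.diff_left cinner_simps cinner_adj_left bounded_ops_compose)
    moreover have "(norm (p (x (p \<xi>))))\<^sup>2 \<le> (norm (x (p \<xi>)))\<^sup>2"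
      by (intro power_mono projection_norm_le p(2)) simp
    ultimately show ?thesis by (simp add: cinner_self complex_nonneg_Reals_iff del: of_real_power)
  qed
  then have "positive_op ?y" unfolding positive_op_def using C.bounded_op [OF yC] by blast
  then have "positive_op (\<kappa> ?y)" by (rule \<kappa>.hom_positive [OF yC])
  also have "\<kappa> ?y = \<kappa> (p o\<^sub>L (adj x o\<^sub>L x) o\<^sub>L p) - \<kappa> (adj (p o\<^sub>L x o\<^sub>L p) o\<^sub>L (p o\<^sub>L x o\<^sub>L p))"
    using \<kappa>.hom_clinear c1 C.compose [OF C.adjoint [OF c2] c2] yC unfolding clinear_on_def
    by (metis diff_add_cancel eq_diff_eq)
  also have "\<kappa> (adj (p o\<^sub>L x o\<^sub>L p) o\<^sub>L (p o\<^sub>L x o\<^sub>L p)) = adj (\<theta> x) o\<^sub>L \<theta> x"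
    by (simp add: \<kappa>.hom_compose \<kappa>.hom_adj C.adjoint c2 compression_def)
  finally show ?thesis by (simp add: compression_def)
qed

lemma choi_effros_square:
  assumes E: "cp_projection_onto N H E" and x: "x \<in> F"
  shows "E (adj (\<theta> x) o\<^sub>L \<theta> x) = \<theta> (adj x o\<^sub>L x)"
proof -
  have cpE: "completely_positive_on N E" and E_image: "E ` N = H" and E_idem: "\<And>a. a \<in> N \<Longrightarrow> E (E a) = E a"
    using E by (simp_all add: cp_projection_onto_def)
  have E_mem: "E a \<in> H" if "a \<in> N" for a using E_image that by blast
  have E_id: "E a = a" if a: "a \<in> H" for a
  proof -
    obtain b where "b \<in> N" "a = E b" using a unfolding E_image [symmetric] by (rule imageE)
    then show ?thesis by (simp add: E_idem)
  qed
  have linE: "clinear_on N E" using cpE by (simp add: completely_positive_on_def)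
  have id_H: "id_blinfun \<in> H" using \<theta>_mem [OF F.unit(1)] \<theta>_id by simp
  \<comment> \<open>This map takes values in \<open>F\<close>, where the product is ordinary
    composition, and it sends \<open>\<theta> x\<close> to \<open>x\<close>; its Schwarz inequality
    therefore produces \<open>adj x o\<^sub>L x\<close>.\<close>
  let ?\<psi> = "\<lambda>a. \<Phi> (E a)"
  interpret \<psi>: unital_cp_map N ?\<psi>
  proof
    show "completely_positive_on N ?\<psi>"
      by (rule completely_positive_on_compose [OF cpE _ \<Phi>_completely_positive]) (simp add: E_mem)
    show "?\<psi> id_blinfun = id_blinfun"
      using \<Phi>_\<theta> [OF F.unit(1)] by (simp add: E_id id_H \<theta>_id)
  qed
  define b where "b = \<theta> x"
  have bH: "b \<in> H" unfolding b_def by (rule \<theta>_mem [OF x])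
  have bN: "b \<in> N" using bH by (rule H_mem)
  have bbN: "adj b o\<^sub>L b \<in> N" by (intro N.compose N.adjoint bN)
  have xx: "adj x o\<^sub>L x \<in> F" by (intro F.compose F.adjoint x)
  have "?\<psi> b = x" by (simp add: E_id bH b_def \<theta>_mem x \<Phi>_\<theta>)
  then have "positive_op (\<Phi> (E (adj b o\<^sub>L b)) - (adj x o\<^sub>L x))"
    using \<psi>.cp_Schwarz [OF bN] by simp
  then have "positive_op (\<theta> (\<Phi> (E (adj b o\<^sub>L b)) - (adj x o\<^sub>L x)))"
    by (intro completely_positive_on_positive [OF \<theta>_completely_positive] F.diff xx \<Phi>_mem E_mem bbN)
  also have "\<theta> (\<Phi> (E (adj b o\<^sub>L b)) - (adj x o\<^sub>L x)) = \<theta> (\<Phi> (E (adj b o\<^sub>L b))) - \<theta> (adj x o\<^sub>L x)"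
    using \<theta>_clinear F.diff [OF \<Phi>_mem [OF E_mem [OF bbN]] xx] xx unfolding clinear_on_def
    by (metis diff_add_cancel eq_diff_eq)
  finally have 1: "positive_op (E (adj b o\<^sub>L b) - \<theta> (adj x o\<^sub>L x))" by (simp add: \<theta>_\<Phi> E_mem bbN)
  have tN: "\<theta> (adj x o\<^sub>L x) \<in> N" by (intro \<theta>_mem_N F_mem xx)
  \<comment> \<open>\<open>E\<close> fixes \<open>\<theta> (adj x o\<^sub>L x)\<close>, so applying
    it to the Schwarz difference of \<theta> changes only the other term.\<close>
  have "positive_op (E (\<theta> (adj x o\<^sub>L x) - (adj b o\<^sub>L b)))"
    using \<theta>_Schwarz [OF x] unfolding b_def [symmetric]
    by (intro completely_positive_on_positive [OF cpE] N.diff tN bbN)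
  also have "E (\<theta> (adj x o\<^sub>L x) - (adj b o\<^sub>L b)) = E (\<theta> (adj x o\<^sub>L x)) - E (adj b o\<^sub>L b)"
    using linE N.diff [OF tN bbN] bbN unfolding clinear_on_def by (metis diff_add_cancel eq_diff_eq)
  finally have 2: "positive_op (\<theta> (adj x o\<^sub>L x) - E (adj b o\<^sub>L b))" by (simp add: E_id \<theta>_mem xx)
  have "E (adj b o\<^sub>L b) \<in> bounded_ops" using E_mem [OF bbN] H_mem N.bounded_op by blast
  from positive_op_antisym [OF 1 2 this N.bounded_op [OF tN]] show ?thesis by (simp add: b_def)
qed

text \<open>The defect \<open>D\<close> is conjugate-linear in the first and linear in the second
  argument and vanishes on the diagonal. It is thus antisymmetric, and a complex sesquilinear map
  with this property is 0.\<close>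

lemma choi_effros_product_eq:
  assumes E: "cp_projection_onto N H E" and xy: "x \<in> F" "y \<in> F"
  shows "E (adj (\<theta> x) o\<^sub>L \<theta> y) = \<theta> (adj x o\<^sub>L y)"
proof -
  have linE: "clinear_on N E" using E by (simp add: cp_projection_onto_def completely_positive_on_def)
  define D where "D = (\<lambda>x y. E (adj (\<theta> x) o\<^sub>L \<theta> y) - \<theta> (adj x o\<^sub>L y))"
  have N1: "\<theta> x \<in> N" "adj (\<theta> x) \<in> N" if "x \<in> F" for x
    using that by (intro \<theta>_mem_N F_mem N.adjoint; assumption)+
  have D_add: "D (x + y) (x + y) = D x x + D x y + (D y x + D y y)" if "x \<in> F" "y \<in> F" for x y
  proof -
    have "adj (\<theta> (x + y)) o\<^sub>L \<theta> (x + y) =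
        ((adj (\<theta> x) o\<^sub>L \<theta> x) + (adj (\<theta> x) o\<^sub>L \<theta> y)) + ((adj (\<theta> y) o\<^sub>L \<theta> x) + (adj (\<theta> y) o\<^sub>L \<theta> y))"
      using \<theta>_clinear that N1 N.bounded_op
      by (simp add: clinear_on_def adj_add blinfun_compose_add_left blinfun_compose_add_right)
    then have 1: "E (adj (\<theta> (x + y)) o\<^sub>L \<theta> (x + y)) =
        (E (adj (\<theta> x) o\<^sub>L \<theta> x) + E (adj (\<theta> x) o\<^sub>L \<theta> y)) + (E (adj (\<theta> y) o\<^sub>L \<theta> x) + E (adj (\<theta> y) o\<^sub>L \<theta> y))"
      using linE N1 that by (simp add: clinear_on_def N.add N.compose)
    have "adj (x + y) o\<^sub>L (x + y) =
        ((adj x o\<^sub>L x) + (adj x o\<^sub>L y)) + ((adj y o\<^sub>L x) + (adj y o\<^sub>L y))"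
      using that F.bounded_op
      by (simp add: adj_add blinfun_compose_add_left blinfun_compose_add_right)
    then have 2: "\<theta> (adj (x + y) o\<^sub>L (x + y)) =
        (\<theta> (adj x o\<^sub>L x) + \<theta> (adj x o\<^sub>L y)) + (\<theta> (adj y o\<^sub>L x) + \<theta> (adj y o\<^sub>L y))"
      using \<theta>_clinear that by (simp add: clinear_on_def F.add F.compose F.adjoint)
    show ?thesis unfolding D_def 1 2 by simp
  qed
  have D_self: "D x x = 0" if "x \<in> F" for x
    using choi_effros_square [OF E that] by (simp add: D_def)
  have D_sym: "D x y + D y x = 0" if "x \<in> F" "y \<in> F" for x y
    using D_add [OF that] D_self that F.add by simp
  have D_scale: "D x (scale_op c y) = scale_op c (D x y)" "D (scale_op c x) y = scale_op (cnj c) (D x y)"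
    if "x \<in> F" "y \<in> F" for x y c
  proof -
    have s: "scale_op d a - scale_op d b = scale_op d (a - b)" for d and a b :: "'k op"
      by (rule blinfun_eqI) (simp add: blinfun.diff_left scaleC_diff_right)
    have "\<theta> (scale_op c x) = scale_op c (\<theta> x)" if "x \<in> F" for x c
      using \<theta>_clinear that by (simp add: clinear_on_def)
    moreover have "E (scale_op d a) = scale_op d (E a)" if "a \<in> N" for a d
      using linE that by (simp add: clinear_on_def)
    ultimately show "D x (scale_op c y) = scale_op c (D x y)" "D (scale_op c x) y = scale_op (cnj c) (D x y)"
      using that N1 N.bounded_op F.bounded_op
      by (simp_all add: D_def scale_op_compose adj_scale_op adj_bounded_ops s N.compose F.compose F.adjoint)
  qed
  \<comment> \<open>Antisymmetry at \<open>x\<close> and \<open>\<i>\<close> times \<open>y\<close>: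
    the two slots yield opposite factors, so together with \<open>D y x = - D x y\<close> the terms
    add up instead of cancelling.\<close>
  have i: "scale_op \<i> (D x y) + scale_op (- \<i>) (D y x) = 0"
    using D_sym [OF xy(1) F.scale [OF xy(2), of \<i>]] by (simp add: D_scale xy)
  have "D x y = 0"
  proof -
    have neg: "D y x = - D x y" using D_sym [OF xy] by (simp add: eq_neg_iff_add_eq_0 add.commute)
    have "scale_op (- \<i>) (- D x y) = scale_op \<i> (D x y)"
      by (rule blinfun_eqI) (simp add: blinfun.minus_left scaleC_scaleC flip: scaleC_minus_one)
    then have "2 *\<^sub>R scale_op \<i> (D x y) = 0" using i neg by (simp add: scaleR_2)
    then have "scale_op \<i> (D x y) = 0" by simp
    then have "scale_op (- \<i>) (scale_op \<i> (D x y)) = scale_op (- \<i>) 0" by simp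
    then show ?thesis
      by (intro blinfun_eqI) (drule arg_cong [of _ _ "\<lambda>a. blinfun_apply a _"], simp add: scaleC_scaleC)
  qed
  then show ?thesis by (simp add: D_def)
qed

lemma choi_effros_star_isomorphism:
  assumes E: "cp_projection_onto N H E"
  shows "star_isomorphism F (o\<^sub>L) H (choi_effros_product E) \<theta>"
proof -
  \<comment> \<open>The polarized identity carries an adjoint on its first factor, so it is used at
    \<open>adj x\<close>.\<close>
  have "\<theta> (x o\<^sub>L y) = choi_effros_product E (\<theta> x) (\<theta> y)" if "x \<in> F" "y \<in> F" for x y
    using choi_effros_product_eq [OF E F.adjoint [OF that(1)] that(2)] that
      adj_adj [OF N.bounded_op [OF \<theta>_mem_N [OF F_mem [OF that(1)]]]]
    by (simp add: choi_effros_product_def \<theta>_adj adj_adj F.bounded_op)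
  then show ?thesis
    using \<theta>_clinear \<theta>_adj \<theta>_bij by (simp add: star_isomorphism_def star_hom_on_def)
qed

end

text \<open>Quantifying over every completely positive projection \<open>E\<close> shows that the
  product on the fixed points of \<open>P\<close> does not depend on the choice of \<open>E\<close>;
  the existence clause keeps that statement from being vacuous.\<close>

theorem theorem5p1:
  fixes N :: "'k::chilbert_space op set" and P :: "'k op \<Rightarrow> 'k op"
    and M :: "'h::chilbert_space op set" and p :: "'h op" and \<alpha> :: "'h op \<Rightarrow> 'h op"
    and \<iota> :: "'k op \<Rightarrow> 'h op"
  assumes "von_neumann_algebra N"
    and "normal_ucp_map N P"
    and "minimal_dilation N P M p \<alpha> \<iota>"
  shows "cp_order_isomorphism (fixed_points M \<alpha>) (fixed_points N P) (compression N \<iota> p) \<and>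
    von_neumann_algebra (fixed_points M \<alpha>) \<and>
    (\<exists>E. cp_projection_onto N (fixed_points N P) E) \<and>
    (\<forall>E. cp_projection_onto N (fixed_points N P) E \<longrightarrow>
      star_isomorphism (fixed_points M \<alpha>) (o\<^sub>L)
        (fixed_points N P) (choi_effros_product E) (compression N \<iota> p))"
proof -
  interpret dilation N P M p \<alpha> \<iota>
    using assms by unfold_locales
  show ?thesis
    using cp_order_isomorphism F cp_projection_exists choi_effros_star_isomorphism by blast
qed

end
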